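(* Let $p$ be a prime, let $M,N$ be integers with $N\ge 0$, and let $\phi\in\mathcal{D}_N^M$ with $\widehat\phi(0)\ne 0$. Then $\phi$ generates a multiresolution analysis in $L^2(\mathbb{Q}_p)$ if and only if both of the following hold: (1) $\phi$ is refinable; (2) there exist at least $p^{M+N}-p^N$ integers $l$ such that $0\le l<p^{M+N}$ and $\widehat\phi\left(\frac{l}{p^{M}}\right)=0$.
   Context: $\mathbb{Q}_p$ is the field of $p$-adic numbers with norm $|\cdot|_p$ (so $|p|_p=p^{-1}$) and Haar measure $dx$ normalized so that the unit disc $\{|x|_p\le 1\}$ has measure $1$; $B_\gamma(a)=\{x\in\mathbb{Q}_p:|x-a|_p\le p^\gamma\}$ for $\gamma\in\mathbb{Z}$. The set of shifts is $I_p=\{p^{-\gamma}(a_0+a_1p+\cdots+a_{\gamma-1}p^{\gamma-1}):\gamma\in\mathbb{N},\ a_j\in\{0,1,\dots,p-1\}\}$ (one representative of each coset of $B_0(0)$ in $\mathbb{Q}_p$). The Fourier transform is $\widehat\varphi(\xi)=\int_{\mathbb{Q}_p}\chi_p(\xi x)\varphi(x)\,dx$, where $\chi_p(x)=e^{2\pi i\{x\}_p}$ and $\{x\}_p$ is the fractional part of $x$. $\mathcal{D}$ is the space of complex-valued locally constant compactly supported functions on $\mathbb{Q}_p$. $\mathcal{D}_N^M$ is the set of $\phi\in\mathcal{D}$ that are $p^M$-periodic ($\phi(x-p^M)=\phi(x)$ for all $x$) and supported on $B_N(0)$; equivalently $\operatorname{supp}\phi\subset B_N(0)$ and $\operatorname{supp}\widehat\phi\subset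 B_M(0)$. A function $\phi\in L^2(\mathbb{Q}_p)$ is refinable if it satisfies an equation $\phi=\sum_{a\in I_p}\alpha_a\phi(p^{-1}\cdot-a)$ with $\alpha_a\in\mathbb{C}$ (the sum converging in $L^2(\mathbb{Q}_p)$). A multiresolution analysis (MRA) in $L^2(\mathbb{Q}_p)$ is a collection of closed subspaces $V_j\subset L^2(\mathbb{Q}_p)$, $j\in\mathbb{Z}$, such that: (a) $V_j\subset V_{j+1}$ for all $j$; (b) $\bigcup_{j}V_j$ is dense in $L^2(\mathbb{Q}_p)$; (c) $\bigcap_j V_j=\{0\}$; (d) $f(\cdot)\in V_j\Longleftrightarrow f(p^{-1}\cdot)\in V_{j+1}$ for all $j$; (e) there is a function $\phi\in V_0$ with $V_0=\overline{\operatorname{span}\{\phi(\cdot-a):a\in I_p\}}$. The function $\phi$ in (e) is called a scaling function, and $\phi$ is said to generate the MRA; by (d) and (e), $V_j=\overline{\operatorname{span}\{\phi(p^{-j}\cdot-a):a\in I_p\}}$ for all $j$. *)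

theory Defs
  imports
    "HOL-Analysis.Analysis"
    "HOL-Library.Function_Algebras"
    "Berlekamp_Zassenhaus.Finite_Field"
begin

section \<open>The $p$-adic absolute value on the rationals\<close>

definition pabs :: "nat \<Rightarrow> rat \<Rightarrow> real" where
  "pabs p q = (if q = 0 then 0 else
     real p powi (int (multiplicity (int p) (snd (quotient_of q)))
                - int (multiplicity (int p) (fst (quotient_of q)))))"

context
  fixes p :: nat
  assumes p: "prime p"
begin

lemma pabs_quotient:
  fixes a b :: int
  assumes "a \<noteq> 0" "b \<noteq> 0"
  shows "pabs p (of_int a / of_int b) =
    real p powi (int (multiplicity (int p) b) - int (multiplicity (int p) a))"
proof -
  have pp: "prime_elem (int p)"
    using p by auto
  obtain c d where cd: "quotient_of (of_int a / of_int b) = (c, d)"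
    by (cases "quotient_of (of_int a / of_int b)") auto
  have d: "d > 0"
    using quotient_of_denom_pos[OF cd] .
  have eq: "(of_int a / of_int b :: rat) = of_int c / of_int d"
    using quotient_of_div[OF cd] .
  have c: "c \<noteq> 0"
    using eq assms by auto
  have "(of_int (a * d) :: rat) = of_int (c * b)"
    using eq assms d by (simp add: field_simps)
  then have "a * d = c * b"
    by (simp only: of_int_eq_iff)
  then have "multiplicity (int p) (a * d) = multiplicity (int p) (c * b)"
    by simp
  then have "multiplicity (int p) a + multiplicity (int p) d
           = multiplicity (int p) c + multiplicity (int p) b"
    using assms c d pp by (simp add: prime_elem_multiplicity_mult_distrib)
  then have "int (multiplicity (int p) b) - int (multiplicity (int p) a)
           = int (multiplicity (int p) d) - int (multiplicity (int p) c)"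
    by linarith
  then show ?thesis
    using assms by (simp add: pabs_def cd)
qed

lemma rat_cases_common:
  fixes q r :: rat
  obtains a b c :: int where "c \<noteq> 0" "q = of_int a / of_int c" "r = of_int b / of_int c"
proof -
  obtain a1 c1 where 1: "quotient_of q = (a1, c1)" by (cases "quotient_of q") auto
  obtain a2 c2 where 2: "quotient_of r = (a2, c2)" by (cases "quotient_of r") auto
  have "c1 > 0" "c2 > 0"
    using 1 2 by (auto dest: quotient_of_denom_pos)
  then show ?thesis
    using quotient_of_div[OF 1] quotient_of_div[OF 2]
    by (intro that[of "c1 * c2" "a1 * c2" "a2 * c1"]) (auto simp: field_simps)
qed

lemma pabs_0 [simp]: "pabs p 0 = 0"
  by (simp add: pabs_def)

lemma pabs_1 [simp]: "pabs p 1 = 1"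
  using pabs_quotient[of 1 1] by simp

lemma pabs_pos: "q \<noteq> 0 \<Longrightarrow> pabs p q > 0"
  using p by (simp add: pabs_def prime_gt_0_nat)

lemma pabs_nonneg [simp]: "pabs p q \<ge> 0"
  using pabs_pos[of q] by (cases "q = 0") auto

lemma pabs_eq_0_iff [simp]: "pabs p q = 0 \<longleftrightarrow> q = 0"
  using pabs_pos[of q] by (cases "q = 0") auto

lemma pabs_mult: "pabs p (q * r) = pabs p q * pabs p r"
proof (cases "q = 0 \<or> r = 0")
  case False
  obtain a b c :: int where c: "c \<noteq> 0" and q: "q = of_int a / of_int c"
    and r: "r = of_int b / of_int c"
    by (rule rat_cases_common)
  have ab: "a \<noteq> 0" "b \<noteq> 0"
    using False q r by auto
  have qr: "q * r = of_int (a * b) / of_int (c * c)"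
    using q r by simp
  have "pabs p (q * r) = real p powi (int (multiplicity (int p) (c * c))
          - int (multiplicity (int p) (a * b)))"
    unfolding qr using ab c by (intro pabs_quotient) auto
  also have "\<dots> = real p powi ((int (multiplicity (int p) c) - int (multiplicity (int p) a))
          + (int (multiplicity (int p) c) - int (multiplicity (int p) b)))"
    using ab c p by (simp add: prime_elem_multiplicity_mult_distrib algebra_simps)
  also have "\<dots> = pabs p q * pabs p r"
    unfolding q r pabs_quotient[OF ab(1) c] pabs_quotient[OF ab(2) c]
    using p by (intro power_int_add) auto
  finally show ?thesis .
qed auto

lemma pabs_minus [simp]: "pabs p (- q) = pabs p q"
proof -
  have "pabs p (- 1) = 1"
    using pabs_quotient[of "- 1" 1] by (simp add: multiplicity_unit_right)
  then show ?thesis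
    using pabs_mult[of "- 1" q] by simp
qed

lemma pabs_minus_commute: "pabs p (q - r) = pabs p (r - q)"
  by (metis minus_diff_eq pabs_minus)

lemma pabs_inverse: "pabs p (inverse q) = inverse (pabs p q)"
proof (cases "q = 0")
  case False
  then have "pabs p (inverse q) * pabs p q = 1"
    by (simp flip: pabs_mult)
  then show ?thesis
    by (intro inverse_unique[symmetric]) (simp add: mult.commute)
qed auto

lemma pabs_add_le_max: "pabs p (q + r) \<le> max (pabs p q) (pabs p r)"
proof (cases "q = 0 \<or> r = 0 \<or> q + r = 0")
  case True
  then show ?thesis by (auto simp: le_max_iff_disj)
next
  case False
  obtain a b c :: int where c: "c \<noteq> 0" and q: "q = of_int a / of_int c"
    and r: "r = of_int b / of_int c"
    by (rule rat_cases_common)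
  have qr: "q + r = of_int (a + b) / of_int c"
    using q r by (simp add: add_divide_distrib)
  have nz: "a \<noteq> 0" "b \<noteq> 0" "a + b \<noteq> 0"
    using False q r qr by auto
  define m where "m = min (multiplicity (int p) a) (multiplicity (int p) b)"
  have "int p ^ m dvd a" "int p ^ m dvd b"
    unfolding m_def by (auto intro!: multiplicity_dvd')
  then have "int p ^ m dvd a + b"
    by simp
  moreover have "\<not> is_unit (int p)"
    using p prime_gt_1_nat[of p] by auto
  ultimately have m: "m \<le> multiplicity (int p) (a + b)"
    using nz by (intro multiplicity_geI) auto
  have p1: "1 \<le> real p"
    using p prime_ge_1_nat by auto
  have "pabs p (q + r) \<le> real p powi (int (multiplicity (int p) c) - int m)"
    unfolding qr using nz c m p1 by (subst pabs_quotient) (auto intro!: power_int_increasing)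
  also have "\<dots> = pabs p q \<or> \<dots> = pabs p r"
    unfolding q r using nz c by (auto simp: pabs_quotient m_def min_def)
  ultimately show ?thesis
    by auto
qed

lemma pabs_triangle: "pabs p (q + r) \<le> pabs p q + pabs p r"
  using pabs_add_le_max[of q r] pabs_nonneg[of q] pabs_nonneg[of r] by linarith

lemma pabs_triangle_rev: "\<bar>pabs p q - pabs p r\<bar> \<le> pabs p (q - r)"
  using pabs_triangle[of "q - r" r] pabs_triangle[of "r - q" q] pabs_minus_commute[of q r] by simp

end


section \<open>The field of $p$-adic numbers\<close>

text \<open>
  The prime is the cardinality of the index type, and the field is the completion of the
  rationals with respect to the absolute value above.
\<close>

definition pcauchy :: "nat \<Rightarrow> (nat \<Rightarrow> rat) \<Rightarrow> bool" where
  "pcauchy p X \<longleftrightarrow> (\<forall>e>0. \<exists>k. \<forall>m\<ge>k. \<forall>n\<ge>k. pabs p (X m - X n) < e)"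

definition pvanishes :: "nat \<Rightarrow> (nat \<Rightarrow> rat) \<Rightarrow> bool" where
  "pvanishes p X \<longleftrightarrow> (\<lambda>n. pabs p (X n)) \<longlonglongrightarrow> 0"

definition padicrel :: "nat \<Rightarrow> (nat \<Rightarrow> rat) \<Rightarrow> (nat \<Rightarrow> rat) \<Rightarrow> bool" where
  "padicrel p X Y \<longleftrightarrow> pcauchy p X \<and> pcauchy p Y \<and> pvanishes p (\<lambda>n. X n - Y n)"

context
  fixes p :: nat
  assumes p: "prime p"
begin

lemma pvanishes_dominated:
  assumes "pvanishes p X" "\<And>n. pabs p (Y n) \<le> pabs p (X n) * C"
  shows "pvanishes p Y"
  unfolding pvanishes_def
proof (rule tendsto_sandwich[of "\<lambda>_. 0" _ _ "\<lambda>n. pabs p (X n) * C"])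
  show "(\<lambda>n. pabs p (X n) * C) \<longlonglongrightarrow> 0"
    using tendsto_mult_left_zero[of "\<lambda>n. pabs p (X n)"] assms(1) by (auto simp: pvanishes_def)
qed (use assms(2) p in auto)

lemma pvanishes_add:
  assumes "pvanishes p X" "pvanishes p Y"
  shows "pvanishes p (\<lambda>n. X n + Y n)"
  unfolding pvanishes_def
proof (rule tendsto_sandwich[of "\<lambda>_. 0" _ _ "\<lambda>n. pabs p (X n) + pabs p (Y n)"])
  show "(\<lambda>n. pabs p (X n) + pabs p (Y n)) \<longlonglongrightarrow> 0"
    using tendsto_add[of "\<lambda>n. pabs p (X n)" 0 _ "\<lambda>n. pabs p (Y n)" 0] assms
    by (auto simp: pvanishes_def)
qed (use pabs_triangle[OF p] pabs_nonneg[OF p] in \<open>auto intro!: add_nonneg_nonneg\<close>)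

lemma pvanishes_minus: "pvanishes p (\<lambda>n. - X n) \<longleftrightarrow> pvanishes p X"
  using p by (simp add: pvanishes_def)

lemma pvanishes_diff:
  "pvanishes p X \<Longrightarrow> pvanishes p Y \<Longrightarrow> pvanishes p (\<lambda>n. X n - Y n)"
  using pvanishes_add[of X "\<lambda>n. - Y n"] by (simp add: pvanishes_minus)

lemma pcauchy_const: "pcauchy p (\<lambda>_. c)"
  using p by (auto simp: pcauchy_def)

lemma pcauchy_add:
  assumes "pcauchy p X" "pcauchy p Y"
  shows "pcauchy p (\<lambda>n. X n + Y n)"
  unfolding pcauchy_def
proof (intro allI impI)
  fix e :: real assume e: "e > 0"
  obtain i where i: "\<And>m n. m \<ge> i \<Longrightarrow> n \<ge> i \<Longrightarrow> pabs p (X m - X n) < e"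
    using assms(1) e unfolding pcauchy_def by blast
  obtain j where j: "\<And>m n. m \<ge> j \<Longrightarrow> n \<ge> j \<Longrightarrow> pabs p (Y m - Y n) < e"
    using assms(2) e unfolding pcauchy_def by blast
  have "pabs p (X m + Y m - (X n + Y n)) < e" if "m \<ge> max i j" "n \<ge> max i j" for m n
    using pabs_add_le_max[OF p, of "X m - X n" "Y m - Y n"] i[of m n] j[of m n] that
    by (simp add: algebra_simps)
  then show "\<exists>k. \<forall>m\<ge>k. \<forall>n\<ge>k. pabs p (X m + Y m - (X n + Y n)) < e"
    by blast
qed

lemma pcauchy_minus: "pcauchy p X \<Longrightarrow> pcauchy p (\<lambda>n. - X n)"
  using pabs_minus_commute[OF p] by (simp add: pcauchy_def)

lemma pcauchy_diff: "pcauchy p X \<Longrightarrow> pcauchy p Y \<Longrightarrow> pcauchy p (\<lambda>n. X n - Y n)"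
  using pcauchy_add[of X "\<lambda>n. - Y n"] by (simp add: pcauchy_minus)

lemma pcauchy_convergent_pabs:
  assumes "pcauchy p X"
  shows "convergent (\<lambda>n. pabs p (X n))"
proof -
  have "Cauchy (\<lambda>n. pabs p (X n))"
  proof (rule CauchyI)
    fix e :: real assume "e > 0"
    then obtain k where "\<And>m n. m \<ge> k \<Longrightarrow> n \<ge> k \<Longrightarrow> pabs p (X m - X n) < e"
      using assms unfolding pcauchy_def by blast
    then show "\<exists>k. \<forall>m\<ge>k. \<forall>n\<ge>k. norm (pabs p (X m) - pabs p (X n)) < e"
      using pabs_triangle_rev[OF p] by (metis le_less_trans real_norm_def)
  qed
  then show ?thesis
    by (simp add: Cauchy_convergent_iff)
qed

lemma pcauchy_bounded:
  assumes "pcauchy p X"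
  obtains C where "C > 0" "\<And>n. pabs p (X n) \<le> C"
proof -
  have "Bseq (\<lambda>n. pabs p (X n))"
    using pcauchy_convergent_pabs[OF assms] by (rule convergent_imp_Bseq)
  then obtain C where "C > 0" "\<And>n. norm (pabs p (X n)) \<le> C"
    by (auto simp: Bseq_def)
  then show ?thesis
    using p that by auto
qed

lemma pcauchy_mult:
  assumes X: "pcauchy p X" and Y: "pcauchy p Y"
  shows "pcauchy p (\<lambda>n. X n * Y n)"
  unfolding pcauchy_def
proof (intro allI impI)
  fix e :: real assume e: "e > 0"
  obtain C where C: "C > 0" "\<And>n. pabs p (X n) \<le> C"
    using pcauchy_bounded[OF X] by blast
  obtain D where D: "D > 0" "\<And>n. pabs p (Y n) \<le> D"
    using pcauchy_bounded[OF Y] by blast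
  have eD: "e / D > 0" and eC: "e / C > 0"
    using e C D by auto
  obtain i where i: "\<And>m n. m \<ge> i \<Longrightarrow> n \<ge> i \<Longrightarrow> pabs p (X m - X n) < e / D"
    using X eD unfolding pcauchy_def by blast
  obtain j where j: "\<And>m n. m \<ge> j \<Longrightarrow> n \<ge> j \<Longrightarrow> pabs p (Y m - Y n) < e / C"
    using Y eC unfolding pcauchy_def by blast
  have "pabs p (X m * Y m - X n * Y n) < e" if mn: "m \<ge> max i j" "n \<ge> max i j" for m n
  proof -
    have "pabs p (X m * (Y m - Y n)) \<le> C * pabs p (Y m - Y n)"
      using C(2)[of m] p by (simp add: pabs_mult mult_right_mono)
    also have "\<dots> < C * (e / C)"
      using j[of m n] mn C(1) by (intro mult_strict_left_mono) auto
    finally have 1: "pabs p (X m * (Y m - Y n)) < e"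
      using C(1) by simp
    have "pabs p (Y n * (X m - X n)) \<le> D * pabs p (X m - X n)"
      using D(2)[of n] p by (simp add: pabs_mult mult_right_mono)
    also have "\<dots> < D * (e / D)"
      using i[of m n] mn D(1) by (intro mult_strict_left_mono) auto
    finally have 2: "pabs p (Y n * (X m - X n)) < e"
      using D(1) by simp
    have "X m * Y m - X n * Y n = X m * (Y m - Y n) + Y n * (X m - X n)"
      by (simp add: algebra_simps)
    then show ?thesis
      using pabs_add_le_max[OF p, of "X m * (Y m - Y n)" "Y n * (X m - X n)"] 1 2 by simp
  qed
  then show "\<exists>k. \<forall>m\<ge>k. \<forall>n\<ge>k. pabs p (X m * Y m - X n * Y n) < e"
    by blast
qed

lemma pvanishes_mult_pcauchy:
  assumes "pvanishes p X" "pcauchy p Y"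
  shows "pvanishes p (\<lambda>n. X n * Y n)"
proof -
  obtain D where D: "\<And>n. pabs p (Y n) \<le> D"
    using pcauchy_bounded[OF assms(2)] by blast
  show ?thesis
    by (rule pvanishes_dominated[OF assms(1), of _ D])
       (use D p in \<open>auto simp: pabs_mult intro!: mult_left_mono\<close>)
qed

lemma pcauchy_not_pvanishes:
  assumes "pcauchy p X" "\<not> pvanishes p X"
  obtains b k where "b > 0" "\<And>n. n \<ge> k \<Longrightarrow> b < pabs p (X n)"
proof -
  obtain L where L: "(\<lambda>n. pabs p (X n)) \<longlonglongrightarrow> L"
    using pcauchy_convergent_pabs[OF assms(1)] by (auto simp: convergent_def)
  have "L \<ge> 0"
    using L p by (intro LIMSEQ_le_const[OF L]) auto
  moreover have "L \<noteq> 0"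
    using L assms(2) by (auto simp: pvanishes_def)
  ultimately have L0: "L > 0"
    by simp
  then have "eventually (\<lambda>n. L / 2 < pabs p (X n)) sequentially"
    using order_tendstoD(1)[OF L, of "L / 2"] by simp
  then show ?thesis
    using that[of "L / 2"] L0 by (auto simp: eventually_sequentially)
qed

lemma pcauchy_inverse:
  assumes X: "pcauchy p X" "\<not> pvanishes p X"
  shows "pcauchy p (\<lambda>n. inverse (X n))"
  unfolding pcauchy_def
proof (intro allI impI)
  fix e :: real assume e: "e > 0"
  obtain b i where b: "b > 0" "\<And>n. n \<ge> i \<Longrightarrow> b < pabs p (X n)"
    using pcauchy_not_pvanishes[OF X] by blast
  have "e * (b * b) > 0"
    using e b by simp
  then obtain j where j: "\<And>m n. m \<ge> j \<Longrightarrow> n \<ge> j \<Longrightarrow> pabs p (X m - X n) < e * (b * b)"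
    using X(1) unfolding pcauchy_def by blast
  have "pabs p (inverse (X m) - inverse (X n)) < e" if mn: "m \<ge> max i j" "n \<ge> max i j" for m n
  proof -
    have m: "b < pabs p (X m)" and n: "b < pabs p (X n)"
      using b(2) mn by auto
    then have nz: "X m \<noteq> 0" "X n \<noteq> 0"
      using b(1) p by auto
    have "inverse (X m) - inverse (X n) = (X n - X m) * inverse (X m * X n)"
      using nz by (simp add: field_simps)
    then have "pabs p (inverse (X m) - inverse (X n))
             = pabs p (X n - X m) / (pabs p (X m) * pabs p (X n))"
      using p by (simp only: pabs_mult pabs_inverse divide_inverse)
    also have "\<dots> \<le> pabs p (X n - X m) / (b * b)"
      using m n b(1) p by (intro divide_left_mono mult_mono) auto
    also have "\<dots> < e"
      using j[of n m] mn b(1) by (simp add: pos_divide_less_eq)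
    finally show ?thesis .
  qed
  then show "\<exists>k. \<forall>m\<ge>k. \<forall>n\<ge>k. pabs p (inverse (X m) - inverse (X n)) < e"
    by blast
qed

lemma pvanishes_inverse_mult:
  assumes X: "pcauchy p X" "\<not> pvanishes p X"
  shows "pvanishes p (\<lambda>n. inverse (X n) * X n - 1)"
proof -
  obtain b i where b: "b > 0" "\<And>n. n \<ge> i \<Longrightarrow> b < pabs p (X n)"
    using pcauchy_not_pvanishes[OF X] by blast
  have "pabs p (inverse (X n) * X n - 1) = 0" if "n \<ge> i" for n
  proof -
    have "X n \<noteq> 0"
      using b(1) b(2)[OF that] p by auto
    then show ?thesis
      using p by simp
  qed
  then have "eventually (\<lambda>n. pabs p (inverse (X n) * X n - 1) = 0) sequentially"
    by (auto simp: eventually_sequentially)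
  then show ?thesis
    unfolding pvanishes_def by (rule tendsto_eventually)
qed

lemma padicrel_refl: "padicrel p X X \<longleftrightarrow> pcauchy p X"
  using p by (auto simp: padicrel_def pvanishes_def)

lemma padicrel_sym: "padicrel p X Y \<Longrightarrow> padicrel p Y X"
  using pvanishes_minus[of "\<lambda>n. X n - Y n"] by (auto simp: padicrel_def)

lemma padicrel_trans: "padicrel p X Y \<Longrightarrow> padicrel p Y Z \<Longrightarrow> padicrel p X Z"
  using pvanishes_add[of "\<lambda>n. X n - Y n" "\<lambda>n. Y n - Z n"] by (auto simp: padicrel_def)

lemma part_equivp_padicrel: "part_equivp (padicrel p)"
proof (rule part_equivpI)
  show "\<exists>X. padicrel p X X"
    using pcauchy_const[of 0] padicrel_refl by blast
  show "symp (padicrel p)"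
    using padicrel_sym by (auto intro: sympI)
  show "transp (padicrel p)"
    using padicrel_trans by (auto intro: transpI)
qed

lemma padicrel_const: "padicrel p (\<lambda>_. c) (\<lambda>_. c)"
  by (simp add: padicrel_refl pcauchy_const)

lemma padicrel_add:
  assumes "padicrel p X X'" "padicrel p Y Y'"
  shows "padicrel p (\<lambda>n. X n + Y n) (\<lambda>n. X' n + Y' n)"
proof -
  have "pvanishes p (\<lambda>n. (X n - X' n) + (Y n - Y' n))"
    using assms by (intro pvanishes_add) (auto simp: padicrel_def)
  then show ?thesis
    using assms by (simp add: padicrel_def pcauchy_add add_diff_add)
qed

lemma padicrel_minus:
  assumes "padicrel p X Y"
  shows "padicrel p (\<lambda>n. - X n) (\<lambda>n. - Y n)"
proof -
  have "pvanishes p (\<lambda>n. - (X n - Y n))"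
    using assms by (simp only: padicrel_def pvanishes_minus)
  then show ?thesis
    using assms by (simp add: padicrel_def pcauchy_minus)
qed

lemma padicrel_mult:
  assumes "padicrel p X X'" "padicrel p Y Y'"
  shows "padicrel p (\<lambda>n. X n * Y n) (\<lambda>n. X' n * Y' n)"
proof -
  have *: "pcauchy p X" "pcauchy p X'" "pvanishes p (\<lambda>n. X n - X' n)"
    "pcauchy p Y" "pcauchy p Y'" "pvanishes p (\<lambda>n. Y n - Y' n)"
    using assms by (auto simp: padicrel_def)
  have "pvanishes p (\<lambda>n. (X n - X' n) * Y n + (Y n - Y' n) * X' n)"
    using * by (intro pvanishes_add pvanishes_mult_pcauchy)
  moreover have "(\<lambda>n. (X n - X' n) * Y n + (Y n - Y' n) * X' n) = (\<lambda>n. X n * Y n - X' n * Y' n)"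
    by (auto simp: algebra_simps)
  ultimately show ?thesis
    using * by (simp add: padicrel_def pcauchy_mult)
qed

lemma padicrel_pvanishes:
  assumes "padicrel p X Y"
  shows "pvanishes p X \<longleftrightarrow> pvanishes p Y"
proof -
  have "pvanishes p (\<lambda>n. X n - Y n)"
    using assms by (simp add: padicrel_def)
  from pvanishes_diff[OF _ this, of X] pvanishes_add[OF this, of Y] show ?thesis
    by auto
qed

lemma padicrel_inverse:
  assumes XY: "padicrel p X Y" and X: "\<not> pvanishes p X"
  shows "padicrel p (\<lambda>n. inverse (X n)) (\<lambda>n. inverse (Y n))"
proof -
  have *: "pcauchy p X" "pcauchy p Y" "\<not> pvanishes p Y"
    using XY X padicrel_pvanishes[OF XY] by (auto simp: padicrel_def)
  let ?A = "\<lambda>n. inverse (X n)" and ?B = "\<lambda>n. inverse (Y n)"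
  have A: "pcauchy p ?A" and B: "pcauchy p ?B"
    using * X by (auto intro: pcauchy_inverse)
  have "pvanishes p (\<lambda>n. (X n - Y n) * (?A n * ?B n))"
    using XY A B by (intro pvanishes_mult_pcauchy pcauchy_mult) (auto simp: padicrel_def)
  moreover have "pvanishes p (\<lambda>n. (?A n * X n - 1) * ?B n)"
    using * X B by (intro pvanishes_mult_pcauchy pvanishes_inverse_mult)
  moreover have "pvanishes p (\<lambda>n. (?B n * Y n - 1) * ?A n)"
    using * A by (intro pvanishes_mult_pcauchy pvanishes_inverse_mult)
  ultimately have "pvanishes p (\<lambda>n. (?B n * Y n - 1) * ?A n + (X n - Y n) * (?A n * ?B n)
      - (?A n * X n - 1) * ?B n)"
    by (intro pvanishes_add pvanishes_diff)
  then have "pvanishes p (\<lambda>n. ?B n - ?A n)"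
    by (simp add: algebra_simps)
  then have "pvanishes p (\<lambda>n. ?A n - ?B n)"
    using pvanishes_minus[of "\<lambda>n. ?B n - ?A n"] by simp
  then show ?thesis
    using A B by (simp add: padicrel_def)
qed

lemma lim_pabs_cong:
  assumes "padicrel p X Y"
  shows "lim (\<lambda>n. pabs p (X n)) = lim (\<lambda>n. pabs p (Y n))"
proof -
  have XY: "pcauchy p X" "pcauchy p Y" "pvanishes p (\<lambda>n. X n - Y n)"
    using assms by (auto simp: padicrel_def)
  have "(\<lambda>n. pabs p (X n) - pabs p (Y n)) \<longlonglongrightarrow> 0"
  proof (rule Lim_null_comparison)
    show "eventually (\<lambda>n. norm (pabs p (X n) - pabs p (Y n)) \<le> pabs p (X n - Y n)) sequentially"
      using pabs_triangle_rev[OF p] by simp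
    show "(\<lambda>n. pabs p (X n - Y n)) \<longlonglongrightarrow> 0"
      using XY(3) by (simp add: pvanishes_def)
  qed
  moreover have "(\<lambda>n. pabs p (X n) - pabs p (Y n)) \<longlonglongrightarrow>
      lim (\<lambda>n. pabs p (X n)) - lim (\<lambda>n. pabs p (Y n))"
    using XY pcauchy_convergent_pabs by (intro tendsto_diff) (auto simp: convergent_LIMSEQ_iff)
  ultimately show ?thesis
    using LIMSEQ_unique by fastforce
qed

end

text \<open>
  The quotient is set up by hand: the command \<open>quotient_type\<close> does not accept a relation that
  depends on the type argument while its representation type does not.
\<close>

typedef 'a padic =
  "{C. \<exists>X. padicrel CARD('a::prime_card) X X \<and> C = Collect (padicrel CARD('a) X)}"
  using padicrel_refl[OF prime_card] pcauchy_const[OF prime_card] by blast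

definition Padic :: "(nat \<Rightarrow> rat) \<Rightarrow> 'a::prime_card padic" where
  "Padic X = Abs_padic (Collect (padicrel CARD('a) X))"

definition rep_padic :: "'a::prime_card padic \<Rightarrow> nat \<Rightarrow> rat" where
  "rep_padic x = (SOME X. X \<in> Rep_padic x)"

definition cr_padic :: "(nat \<Rightarrow> rat) \<Rightarrow> 'a::prime_card padic \<Rightarrow> bool" where
  "cr_padic X x \<longleftrightarrow> padicrel CARD('a) X X \<and> Padic X = x"

lemma Padic_eq_iff:
  assumes "pcauchy CARD('a::prime_card) X" "pcauchy CARD('a) Y"
  shows "(Padic X :: 'a padic) = Padic Y \<longleftrightarrow> padicrel CARD('a) X Y"
proof -
  have "padicrel CARD('a) X X" "padicrel CARD('a) Y Y"
    using assms padicrel_refl[OF prime_card] by auto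
  then have "(Padic X :: 'a padic) = Padic Y
      \<longleftrightarrow> Collect (padicrel CARD('a) X) = Collect (padicrel CARD('a) Y)"
    unfolding Padic_def by (intro Abs_padic_inject) auto
  also have "\<dots> \<longleftrightarrow> padicrel CARD('a) X Y"
  proof
    assume "Collect (padicrel CARD('a) X) = Collect (padicrel CARD('a) Y)"
    then show "padicrel CARD('a) X Y"
      using \<open>padicrel CARD('a) Y Y\<close> by auto
  next
    assume XY: "padicrel CARD('a) X Y"
    show "Collect (padicrel CARD('a) X) = Collect (padicrel CARD('a) Y)"
      using padicrel_trans[OF prime_card XY]
        padicrel_trans[OF prime_card padicrel_sym[OF prime_card XY]] by auto
  qed
  finally show ?thesis .
qed

lemma rep_padic:
  fixes x :: "'a::prime_card padic"
  shows "pcauchy CARD('a) (rep_padic x)" "Padic (rep_padic x) = x"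
proof -
  obtain X where X: "padicrel CARD('a) X X" "Rep_padic x = Collect (padicrel CARD('a) X)"
    using Rep_padic[of x, THEN CollectD] by (elim exE conjE)
  then have "X \<in> Rep_padic x"
    by simp
  then have "rep_padic x \<in> Rep_padic x"
    unfolding rep_padic_def by (rule someI[of "\<lambda>X. X \<in> Rep_padic x"])
  then have *: "padicrel CARD('a) X (rep_padic x)"
    using X by simp
  then show 1: "pcauchy CARD('a) (rep_padic x)"
    by (simp add: padicrel_def)
  have "x = Padic X"
    unfolding Padic_def X(2)[symmetric] by (rule Rep_padic_inverse[symmetric])
  then show "Padic (rep_padic x) = x"
    using * Padic_eq_iff[of X "rep_padic x", where 'a='a] by (simp add: padicrel_def)
qed

lemma Quotient_padic:
  "Quotient (padicrel CARD('a::prime_card)) (Padic :: _ \<Rightarrow> 'a padic) rep_padic cr_padic"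
proof (rule QuotientI)
  show "cr_padic = (\<lambda>X x. padicrel CARD('a) X X \<and> (Padic X :: 'a padic) = x)"
    by (auto simp: cr_padic_def fun_eq_iff)
  show "padicrel CARD('a) X Y \<longleftrightarrow>
      padicrel CARD('a) X X \<and> padicrel CARD('a) Y Y \<and> (Padic X :: 'a padic) = Padic Y" for X Y
  proof -
    have *: "padicrel CARD('a) X X \<longleftrightarrow> pcauchy CARD('a) X"
      "padicrel CARD('a) Y Y \<longleftrightarrow> pcauchy CARD('a) Y"
      by (rule padicrel_refl[OF prime_card])+
    show ?thesis
    proof (cases "pcauchy CARD('a) X \<and> pcauchy CARD('a) Y")
      case True
      then show ?thesis
        unfolding * using Padic_eq_iff[of X Y, where 'a='a] by simp
    next
      case False
      then show ?thesis
        unfolding * by (auto simp: padicrel_def)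
    qed
  qed
next
  fix x :: "'a padic"
  show "Padic (rep_padic x) = x"
    by (rule rep_padic)
  show "padicrel CARD('a) (rep_padic x) (rep_padic x)"
    using rep_padic(1)[of x] by (simp add: padicrel_refl prime_card)
qed

setup_lifting Quotient_padic

instantiation padic :: (prime_card) field
begin

lift_definition zero_padic :: "'a padic" is "\<lambda>n. 0"
  by (rule padicrel_const[OF prime_card])

lift_definition one_padic :: "'a padic" is "\<lambda>n. 1"
  by (rule padicrel_const[OF prime_card])

lift_definition plus_padic :: "'a padic \<Rightarrow> 'a padic \<Rightarrow> 'a padic" is "\<lambda>X Y n. X n + Y n"
  by (rule padicrel_add[OF prime_card])

lift_definition uminus_padic :: "'a padic \<Rightarrow> 'a padic" is "\<lambda>X n. - X n"
  by (rule padicrel_minus[OF prime_card])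

lift_definition times_padic :: "'a padic \<Rightarrow> 'a padic \<Rightarrow> 'a padic" is "\<lambda>X Y n. X n * Y n"
  by (rule padicrel_mult[OF prime_card])

lift_definition inverse_padic :: "'a padic \<Rightarrow> 'a padic"
  is "\<lambda>X. if pvanishes CARD('a) X then (\<lambda>n. 0) else (\<lambda>n. inverse (X n))"
proof -
  fix X Y assume XY: "padicrel CARD('a) X Y"
  show "?thesis X Y"
  proof (cases "pvanishes CARD('a) X")
    case True
    then have "pvanishes CARD('a) Y"
      using padicrel_pvanishes[OF prime_card XY] by simp
    then show ?thesis
      using True by (simp add: padicrel_refl[OF prime_card] pcauchy_const[OF prime_card])
  next
    case False
    then have "\<not> pvanishes CARD('a) Y"
      using padicrel_pvanishes[OF prime_card XY] by simp
    then show ?thesis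
      using False padicrel_inverse[OF prime_card XY False] by simp
  qed
qed

definition minus_padic :: "'a padic \<Rightarrow> 'a padic \<Rightarrow> 'a padic" where
  "minus_padic x y = x + - y"

definition divide_padic :: "'a padic \<Rightarrow> 'a padic \<Rightarrow> 'a padic" where
  "divide_padic x y = x * inverse y"

instance
proof
  note [simp] = padicrel_refl[OF prime_card] pcauchy_add[OF prime_card]
    pcauchy_mult[OF prime_card] pcauchy_const[OF prime_card] pcauchy_minus[OF prime_card]
  fix a b c :: "'a padic"
  show "a + b = b + a"
    by transfer (simp add: add.commute)
  show "(a + b) + c = a + (b + c)"
    by transfer (simp add: add.assoc)
  show "0 + a = a"
    by transfer simp
  show "- a + a = 0"
    by transfer simp
  show "a - b = a + - b"
    by (rule minus_padic_def)
  show "(a * b) * c = a * (b * c)"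
    by transfer (simp add: mult.assoc)
  show "a * b = b * a"
    by transfer (simp add: mult.commute)
  show "1 * a = a"
    by transfer simp
  show "(a + b) * c = a * c + b * c"
    by transfer (simp add: distrib_right)
  show "(0::'a padic) \<noteq> 1"
    by transfer (simp add: padicrel_def pvanishes_def prime_card LIMSEQ_const_iff)
  show "a \<noteq> 0 \<Longrightarrow> inverse a * a = 1"
    by transfer (auto simp: padicrel_def pcauchy_inverse[OF prime_card]
        pvanishes_inverse_mult[OF prime_card])
  show "a div b = a * inverse b"
    by (rule divide_padic_def)
  show "inverse (0::'a padic) = 0"
    by transfer (simp add: pvanishes_def prime_card)
qed

end

lemma Padic_const_eq_iff: "(Padic (\<lambda>_. q) :: 'a::prime_card padic) = Padic (\<lambda>_. r) \<longleftrightarrow> q = r"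
proof -
  have "(Padic (\<lambda>_. q) :: 'a padic) = Padic (\<lambda>_. r) \<longleftrightarrow> padicrel CARD('a) (\<lambda>_. q) (\<lambda>_. r)"
    by (intro Padic_eq_iff pcauchy_const prime_card)
  also have "\<dots> \<longleftrightarrow> q = r"
    by (simp add: padicrel_def pcauchy_const[OF prime_card] pvanishes_def LIMSEQ_const_iff
        pabs_eq_0_iff[OF prime_card])
  finally show ?thesis .
qed

lemma of_nat_Padic: "(of_nat n :: 'a::prime_card padic) = Padic (\<lambda>_. of_nat n)"
proof (induction n)
  case 0
  then show ?case
    by (simp add: zero_padic.abs_eq)
next
  case (Suc n)
  have "(1 :: 'a padic) + Padic (\<lambda>_. of_nat n) = Padic (\<lambda>_. 1 + of_nat n)"
    unfolding one_padic.abs_eq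
    by (intro plus_padic.abs_eq padicrel_const[OF prime_card])
  then show ?case
    using Suc by simp
qed

instance padic :: (prime_card) field_char_0
  by standard (simp add: inj_def of_nat_Padic Padic_const_eq_iff)

text \<open>
  The overloaded constant \<open>norm\<close> is restricted to real normed vector spaces, so the $p$-adic
  absolute value has its own name.
\<close>

lift_definition padic_norm :: "'a::prime_card padic \<Rightarrow> real"
  is "\<lambda>X. lim (\<lambda>n. pabs CARD('a) (X n))"
  by (rule lim_pabs_cong[OF prime_card])

lemma padic_norm_Padic:
  fixes x :: "'a::prime_card padic"
  obtains X where "pcauchy CARD('a) X" "x = Padic X"
    "(\<lambda>n. pabs CARD('a) (X n)) \<longlonglongrightarrow> padic_norm x"
proof (rule that)
  show X: "pcauchy CARD('a) (rep_padic x)"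
    by (rule rep_padic)
  show "x = Padic (rep_padic x)"
    by (rule rep_padic(2)[symmetric])
  have "padicrel CARD('a) (rep_padic x) (rep_padic x)"
    using X padicrel_refl[OF prime_card] by auto
  then have "padic_norm (Padic (rep_padic x) :: 'a padic) = lim (\<lambda>n. pabs CARD('a) (rep_padic x n))"
    by (rule padic_norm.abs_eq)
  then show "(\<lambda>n. pabs CARD('a) (rep_padic x n)) \<longlonglongrightarrow> padic_norm x"
    using pcauchy_convergent_pabs[OF prime_card X] rep_padic(2)[of x]
    by (simp add: convergent_LIMSEQ_iff)
qed

lemma padic_norm_Padic_eq:
  assumes "pcauchy CARD('a::prime_card) X"
  shows "(\<lambda>n. pabs CARD('a) (X n)) \<longlonglongrightarrow> padic_norm (Padic X :: 'a padic)"
proof -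
  have "padicrel CARD('a) X X"
    using assms padicrel_refl[OF prime_card] by auto
  then have "padic_norm (Padic X :: 'a padic) = lim (\<lambda>n. pabs CARD('a) (X n))"
    by (rule padic_norm.abs_eq)
  then show ?thesis
    using pcauchy_convergent_pabs[OF prime_card assms] by (simp add: convergent_LIMSEQ_iff)
qed

lemma padic_norm_nonneg: "padic_norm (x :: 'a::prime_card padic) \<ge> 0"
proof -
  obtain X where "(\<lambda>n. pabs CARD('a) (X n)) \<longlonglongrightarrow> padic_norm x"
    by (rule padic_norm_Padic)
  then show ?thesis
    by (rule LIMSEQ_le_const) (simp add: pabs_nonneg[OF prime_card])
qed

lemma padic_norm_eq_0_iff: "padic_norm (x :: 'a::prime_card padic) = 0 \<longleftrightarrow> x = 0"
proof -
  obtain X where X: "pcauchy CARD('a) X" "x = Padic X"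
    "(\<lambda>n. pabs CARD('a) (X n)) \<longlonglongrightarrow> padic_norm x"
    by (rule padic_norm_Padic)
  have "x = 0 \<longleftrightarrow> padicrel CARD('a) X (\<lambda>_. 0)"
    unfolding X(2) zero_padic.abs_eq by (intro Padic_eq_iff X(1) pcauchy_const prime_card)
  also have "\<dots> \<longleftrightarrow> (\<lambda>n. pabs CARD('a) (X n)) \<longlonglongrightarrow> 0"
    using X(1) by (simp add: padicrel_def pcauchy_const[OF prime_card] pvanishes_def)
  also have "\<dots> \<longleftrightarrow> padic_norm x = 0"
    using X(3) LIMSEQ_unique by metis
  finally show ?thesis
    by simp
qed

lemma padic_norm_minus: "padic_norm (- x :: 'a::prime_card padic) = padic_norm x"
proof -
  obtain X where X: "pcauchy CARD('a) X" "x = Padic X"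
    "(\<lambda>n. pabs CARD('a) (X n)) \<longlonglongrightarrow> padic_norm x"
    by (rule padic_norm_Padic)
  have "- x = Padic (\<lambda>n. - X n)"
    unfolding X(2) using X(1) padicrel_refl[OF prime_card] by (intro uminus_padic.abs_eq) auto
  then have "(\<lambda>n. pabs CARD('a) (X n)) \<longlonglongrightarrow> padic_norm (- x)"
    using padic_norm_Padic_eq[OF pcauchy_minus[OF prime_card X(1)]] by (simp add: pabs_minus[OF prime_card])
  then show ?thesis
    using X(3) LIMSEQ_unique by blast
qed

lemma padic_norm_add_le_max: "padic_norm (x + y :: 'a::prime_card padic) \<le> max (padic_norm x) (padic_norm y)"
proof -
  obtain X where X: "pcauchy CARD('a) X" "x = Padic X"
    "(\<lambda>n. pabs CARD('a) (X n)) \<longlonglongrightarrow> padic_norm x"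
    by (rule padic_norm_Padic)
  obtain Y where Y: "pcauchy CARD('a) Y" "y = Padic Y"
    "(\<lambda>n. pabs CARD('a) (Y n)) \<longlonglongrightarrow> padic_norm y"
    by (rule padic_norm_Padic)
  have "x + y = Padic (\<lambda>n. X n + Y n)"
    unfolding X(2) Y(2) using X(1) Y(1) padicrel_refl[OF prime_card]
    by (intro plus_padic.abs_eq) auto
  then have "(\<lambda>n. pabs CARD('a) (X n + Y n)) \<longlonglongrightarrow> padic_norm (x + y)"
    using padic_norm_Padic_eq[OF pcauchy_add[OF prime_card X(1) Y(1)]] by simp
  moreover have "(\<lambda>n. max (pabs CARD('a) (X n)) (pabs CARD('a) (Y n))) \<longlonglongrightarrow> max (padic_norm x) (padic_norm y)"
    by (intro tendsto_max X Y)
  ultimately show ?thesis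
    by (rule LIMSEQ_le) (use pabs_add_le_max[OF prime_card] in blast)
qed

lemma padic_norm_mult: "padic_norm (x * y :: 'a::prime_card padic) = padic_norm x * padic_norm y"
proof -
  obtain X where X: "pcauchy CARD('a) X" "x = Padic X"
    "(\<lambda>n. pabs CARD('a) (X n)) \<longlonglongrightarrow> padic_norm x"
    by (rule padic_norm_Padic)
  obtain Y where Y: "pcauchy CARD('a) Y" "y = Padic Y"
    "(\<lambda>n. pabs CARD('a) (Y n)) \<longlonglongrightarrow> padic_norm y"
    by (rule padic_norm_Padic)
  have "x * y = Padic (\<lambda>n. X n * Y n)"
    unfolding X(2) Y(2) using X(1) Y(1) padicrel_refl[OF prime_card]
    by (intro times_padic.abs_eq) auto
  then have "(\<lambda>n. pabs CARD('a) (X n) * pabs CARD('a) (Y n)) \<longlonglongrightarrow> padic_norm (x * y)"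
    using padic_norm_Padic_eq[OF pcauchy_mult[OF prime_card X(1) Y(1)]]
    by (simp add: pabs_mult[OF prime_card])
  then show ?thesis
    using tendsto_mult[OF X(3) Y(3)] LIMSEQ_unique by blast
qed

lemma padic_norm_of_nat: "padic_norm (of_nat n :: 'a::prime_card padic) = pabs CARD('a) (of_nat n)"
proof -
  have "(\<lambda>_. pabs CARD('a) (of_nat n)) \<longlonglongrightarrow> padic_norm (Padic (\<lambda>_. of_nat n) :: 'a padic)"
    by (intro padic_norm_Padic_eq pcauchy_const prime_card)
  then show ?thesis
    by (simp add: of_nat_Padic LIMSEQ_const_iff)
qed

instantiation padic :: (prime_card) metric_space
begin

definition dist_padic :: "'a padic \<Rightarrow> 'a padic \<Rightarrow> real" where
  "dist_padic x y = padic_norm (x - y)"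

definition uniformity_padic :: "('a padic \<times> 'a padic) filter" where
  "uniformity_padic = (INF e\<in>{0 <..}. principal {(x, y). dist x y < e})"

definition open_padic :: "'a padic set \<Rightarrow> bool" where
  "open_padic U \<longleftrightarrow> (\<forall>x\<in>U. eventually (\<lambda>(x', y). x' = x \<longrightarrow> y \<in> U) uniformity)"

instance
proof
  fix x y z :: "'a padic"
  show "dist x y = 0 \<longleftrightarrow> x = y"
    by (simp add: dist_padic_def padic_norm_eq_0_iff)
  have "dist x y \<le> max (padic_norm (x - z)) (padic_norm (z - y))"
    using padic_norm_add_le_max[of "x - z" "z - y"] by (simp add: dist_padic_def)
  also have "padic_norm (z - y) = padic_norm (y - z)"
    using padic_norm_minus[of "y - z"] by simp
  also have "max (padic_norm (x - z)) (padic_norm (y - z)) \<le> dist x z + dist y z"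
    using padic_norm_nonneg[of "x - z"] padic_norm_nonneg[of "y - z"]
    by (simp add: dist_padic_def)
  finally show "dist x y \<le> dist x z + dist y z" .
qed (rule uniformity_padic_def open_padic_def)+

end


section \<open>Shifts, characters and Haar measure\<close>

definition shift_rats :: "nat \<Rightarrow> rat set" where
  "shift_rats p = {(\<Sum>j<\<gamma>. of_nat (a j) * of_nat p ^ j) / of_nat p ^ \<gamma> |\<gamma> a. \<forall>j<\<gamma>. a j < p}"

definition shifts :: "'p::prime_card padic set" where
  "shifts = of_rat ` shift_rats CARD('p)"

text \<open>
  The fractional part of \<open>x\<close> is the representative of the coset \<open>x + B\<^sub>0(0)\<close> among the
  shifts, regarded as a rational number.
\<close>

definition padic_frac :: "'p::prime_card padic \<Rightarrow> rat" where
  "padic_frac x = (THE r. r \<in> shift_rats CARD('p) \<and> padic_norm (x - of_rat r) \<le> 1)"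

definition padic_char :: "'p::prime_card padic \<Rightarrow> complex" where
  "padic_char x = exp (2 * of_real pi * \<i> * of_rat (padic_frac x))"

definition is_padic_haar :: "'p::prime_card padic measure \<Rightarrow> bool" where
  "is_padic_haar \<mu> \<longleftrightarrow> sets \<mu> = sets borel
     \<and> (\<forall>a. \<forall>A\<in>sets borel. emeasure \<mu> ((+) a ` A) = emeasure \<mu> A)
     \<and> emeasure \<mu> (cball 0 1) = 1"

definition padic_haar :: "'p::prime_card padic measure" where
  "padic_haar = (THE \<mu>. is_padic_haar \<mu>)"

definition padic_fourier :: "('p::prime_card padic \<Rightarrow> complex) \<Rightarrow> 'p padic \<Rightarrow> complex" where
  "padic_fourier \<phi> \<xi> = (\<integral>x. padic_char (\<xi> * x) * \<phi> x \<partial>padic_haar)"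


section \<open>Test functions\<close>

definition test_functions :: "('p::prime_card padic \<Rightarrow> complex) set" where
  "test_functions = {\<phi>. (\<forall>x. \<exists>U. open U \<and> x \<in> U \<and> \<phi> constant_on U)
     \<and> compact (closure {x. \<phi> x \<noteq> 0})}"

definition test_functions_within :: "int \<Rightarrow> int \<Rightarrow> ('p::prime_card padic \<Rightarrow> complex) set" where
  "test_functions_within M N = {\<phi> \<in> test_functions.
     (\<forall>x. \<phi> (x - of_nat CARD('p) powi M) = \<phi> x)
     \<and> closure {x. \<phi> x \<noteq> 0} \<subseteq> cball 0 (real CARD('p) powi N)}"


section \<open>The space of square integrable functions\<close>

text \<open>
  Elements of \<open>L\<^sup>2\<close> are represented by square integrable Borel functions. A set \<open>V\<close> of such functions
  with \<open>L2_closure V = V\<close> is closed under almost everywhere equality, so the closed subspaces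
  below correspond to those of the quotient by null functions.
\<close>

interpretation cfun: vector_space "\<lambda>(c::complex) (f :: 'x \<Rightarrow> complex) x. c * f x"
  by unfold_locales (auto simp: fun_eq_iff algebra_simps)

definition L2 :: "('p::prime_card padic \<Rightarrow> complex) set" where
  "L2 = {f \<in> borel_measurable padic_haar. integrable padic_haar (\<lambda>x. (cmod (f x))\<^sup>2)}"

definition L2_norm :: "('p::prime_card padic \<Rightarrow> complex) \<Rightarrow> real" where
  "L2_norm f = sqrt (\<integral>x. (cmod (f x))\<^sup>2 \<partial>padic_haar)"

definition L2_closure ::
    "('p::prime_card padic \<Rightarrow> complex) set \<Rightarrow> ('p padic \<Rightarrow> complex) set" where
  "L2_closure S = {f \<in> L2. \<forall>e>0. \<exists>g\<in>S \<inter> L2. L2_norm (\<lambda>x. f x - g x) < e}"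

definition L2_closed_subspace :: "('p::prime_card padic \<Rightarrow> complex) set \<Rightarrow> bool" where
  "L2_closed_subspace V \<longleftrightarrow> V \<subseteq> L2 \<and> cfun.subspace V \<and> L2_closure V = V"


section \<open>Refinable functions and multiresolution analyses\<close>

text \<open>
  Convergence of the refinement series is unconditional convergence in \<open>L\<^sup>2\<close>, along the finite
  subsets of the countable set of shifts.
\<close>

definition refinable :: "('p::prime_card padic \<Rightarrow> complex) \<Rightarrow> bool" where
  "refinable \<phi> \<longleftrightarrow> \<phi> \<in> L2 \<and> (\<exists>\<alpha> :: 'p padic \<Rightarrow> complex.
     ((\<lambda>F. L2_norm (\<lambda>x. \<phi> x - (\<Sum>a\<in>F. \<alpha> a * \<phi> (x / of_nat CARD('p) - a)))) \<longlongrightarrow> 0)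
       (finite_subsets_at_top shifts))"

definition scaling_function ::
    "(int \<Rightarrow> ('p::prime_card padic \<Rightarrow> complex) set) \<Rightarrow> ('p padic \<Rightarrow> complex) \<Rightarrow> bool" where
  "scaling_function V \<phi> \<longleftrightarrow>
     \<phi> \<in> V 0 \<and> V 0 = L2_closure (cfun.span ((\<lambda>a x. \<phi> (x - a)) ` shifts))"

definition multiresolution_analysis ::
    "(int \<Rightarrow> ('p::prime_card padic \<Rightarrow> complex) set) \<Rightarrow> bool" where
  "multiresolution_analysis V \<longleftrightarrow>
     (\<forall>j. L2_closed_subspace (V j))
     \<and> (\<forall>j. V j \<subseteq> V (j + 1))
     \<and> L2_closure (\<Union>j. V j) = L2
     \<and> (\<Inter>j. V j) = {f \<in> L2. AE x in padic_haar. f x = 0}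
     \<and> (\<forall>j f. f \<in> V j \<longleftrightarrow> (\<lambda>x. f (x / of_nat CARD('p))) \<in> V (j + 1))
     \<and> (\<exists>\<phi>. scaling_function V \<phi>)"

definition generates_MRA :: "('p::prime_card padic \<Rightarrow> complex) \<Rightarrow> bool" where
  "generates_MRA \<phi> \<longleftrightarrow> (\<exists>V. multiresolution_analysis V \<and> scaling_function V \<phi>)"

end

theory Submission
  imports Defs
begin

text \<open>
  Let \<open>Q = p ^ (M + N)\<close>. A function \<open>\<phi>\<close> supported in the ball of radius \<open>p ^ N\<close> and invariant under the ball of radius
  \<open>p ^ (- M)\<close> is determined by its values at the \<open>Q\<close> points \<open>k / p ^ N\<close>, that is, by a function \<open>u\<close> on the cyclic group of
  order \<open>Q\<close>. The values \<open>\<phi>^ (l / p ^ M)\<close> of its Fourier transform are, up to a factor, the discrete Fourier transform of \<open>u\<close>, and the second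
  condition says that this transform is nonzero on a set \<open>S\<close> of at most \<open>p ^ N\<close> roots of unity of order \<open>Q\<close>
  (\<open>card_fourier_zeros\<close>). Translation by \<open>t / p ^ N\<close> multiplies the transform by \<open>z ^ t\<close>.

  All infinite sums and limits reduce to this finite picture: restriction to the ball of radius \<open>p ^ N\<close> keeps only
  finitely many of the functions \<open>\<phi> (x / p - a)\<close>, and a subspace of a finite-dimensional space is closed. So an element of
  \<open>V\<^sub>1\<close> supported in that ball and invariant under the ball of radius \<open>p ^ (- M - 1)\<close> is exactly a combination of the
  functions \<open>\<phi> (x / p - j / p ^ (N + 1))\<close> with \<open>0 \<le> j < p ^ (N + 1)\<close> (\<open>L2_closure_dilated_shifts_finite\<close>). In particular a
  refinable \<open>\<phi>\<close> satisfies a refinement equation with a finite mask.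

  Suppose that \<open>\<phi>\<close> generates a multiresolution analysis. For \<open>0 \<le> i < p ^ N\<close> the translate of \<open>\<phi>\<close> by \<open>i / p ^ N\<close> lies in
  \<open>V\<^sub>0 \<subseteq> V\<^sub>1\<close>. On the Fourier side this yields polynomials \<open>q\<^sub>i\<close> of degree below \<open>p ^ (N + 1)\<close> with \<open>q\<^sub>i = z ^ i q\<^sub>0\<close> on the set
  \<open>T\<close> of all \<open>p\<close>-th roots of elements of \<open>S\<close>, and \<open>q\<^sub>0\<close> vanishes on \<open>T - S\<close>. If \<open>S\<close> had more than \<open>p ^ N\<close> elements, \<open>q\<^sub>0\<close> would have
  more than \<open>(p - 1) p ^ N\<close> zeros, and some \<open>z ^ i q\<^sub>0\<close> would have degree exactly \<open>p ^ (N + 1)\<close>. The nonzero polynomial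
  \<open>z ^ i q\<^sub>0 - q\<^sub>i\<close> of this degree would vanish at the more than \<open>p ^ (N + 1)\<close> points of \<open>T\<close>
  (\<open>card_le_of_polynomial_multipliers\<close>, \<open>card_unity_support_le\<close>).

  Conversely, if \<open>S\<close> has at most \<open>p ^ N\<close> elements, every \<open>z ^ t\<close> agrees on \<open>S\<close> with a polynomial of degree below \<open>p ^ N\<close>, so
  every translate of \<open>\<phi>\<close> by \<open>t / p ^ N\<close> is a combination of the first \<open>p ^ N\<close> of them (\<open>translate_in_span_few\<close>). Hence the span
  of the shifts is invariant under all translations of the field, although the shifts do not form a group
  (\<open>translate_in_shift_span\<close>), and the finite mask gives \<open>V\<^sub>0 \<subseteq> V\<^sub>1\<close>. The sum of the translates of \<open>\<phi>\<close> by all \<open>k / p ^ N\<close> is a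
  multiple of the indicator of a ball, nonzero because \<open>\<phi>^ 0 \<noteq> 0\<close>; its translates and dilates are the indicators of all
  balls, which gives density of the union. The intersection is trivial since its elements are limits of functions that
  are constant on arbitrarily large balls.

  Haar measure is shown to exist as the image of Lebesgue measure on the half line under the Monna map, which mirrors
  base \<open>p\<close> expansions (\<open>is_padic_haar_distr_monna\<close>). It is determined by its values on balls (\<open>measure_eqI_pballs\<close>), and the
  behaviour under dilation follows from this.
\<close>

section \<open>Arithmetic of p-adic numbers\<close>

lemma card_gt_1: "1 < CARD('p::prime_card)"
  using prime_card[where 'a='p] prime_gt_1_nat by blast

lemma real_card_gt_1: "1 < real CARD('p::prime_card)"
  using card_gt_1[where 'p='p] by simp

lemma card_powi_pos [simp]: "0 < real CARD('p::prime_card) powi k"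
  using real_card_gt_1[where 'p='p] by (intro zero_less_power_int) simp

lemma card_powi_le_iff [simp]:
  "real CARD('p::prime_card) powi k \<le> real CARD('p) powi l \<longleftrightarrow> k \<le> l"
  using real_card_gt_1[where 'p='p]
  by (meson power_int_increasing power_int_strict_increasing linorder_not_less less_imp_le)

lemma card_powi_add:
  "real CARD('p::prime_card) powi (k + l) = real CARD('p) powi k * real CARD('p) powi l"
  by (rule power_int_add) simp

lemma card_powi_nat: "real CARD('p::prime_card) powi k = real (CARD('p) ^ nat k)" if "k \<ge> 0"
  using that by (simp add: power_int_def)

lemma exists_card_powi_less:
  assumes "e > 0"
  shows "\<exists>m::nat. real CARD('p::prime_card) powi (- int m) < e"
proof -
  have "inverse (real CARD('p)) < 1"
    using real_card_gt_1[where 'p='p] by (simp add: field_simps)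
  then obtain m where "inverse (real CARD('p)) ^ m < e"
    using real_arch_pow_inv[OF assms] by blast
  then show ?thesis
    by (intro exI[of _ m]) (simp add: power_int_minus power_inverse)
qed

lemma exists_card_powi_ge: "\<exists>m::nat. x \<le> real CARD('p::prime_card) powi (int m)"
  using real_arch_pow[OF real_card_gt_1[where 'p='p], of x] by (auto intro: less_imp_le)

lemma padic_norm_0 [simp]: "padic_norm (0 :: 'p::prime_card padic) = 0"
  by (simp add: padic_norm_eq_0_iff)

lemma padic_norm_1 [simp]: "padic_norm (1 :: 'p::prime_card padic) = 1"
  using padic_norm_of_nat[of 1, where 'a='p] by (simp add: prime_card)

lemma padic_norm_ne_0 [simp]: "0 < padic_norm (x :: 'p::prime_card padic) \<longleftrightarrow> x \<noteq> 0"
  using padic_norm_nonneg[of x] padic_norm_eq_0_iff[of x] by linarith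

lemma padic_norm_diff_commute: "padic_norm (x - y :: 'p::prime_card padic) = padic_norm (y - x)"
  using padic_norm_minus[of "x - y"] by simp

lemma padic_norm_add_le:
  "padic_norm x \<le> r \<Longrightarrow> padic_norm y \<le> r \<Longrightarrow> padic_norm (x + y :: 'p::prime_card padic) \<le> r"
  using padic_norm_add_le_max[of x y] by simp

lemma padic_norm_diff_le:
  "padic_norm x \<le> r \<Longrightarrow> padic_norm y \<le> r \<Longrightarrow> padic_norm (x - y :: 'p::prime_card padic) \<le> r"
  using padic_norm_add_le[of x r "- y"] by (simp add: padic_norm_minus)

lemma padic_norm_trans:
  "padic_norm (x - y) \<le> r \<Longrightarrow> padic_norm (y - z) \<le> r \<Longrightarrow> padic_norm (x - z :: 'p::prime_card padic) \<le> r"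
  using padic_norm_add_le[of "x - y" r "y - z"] by simp

lemma padic_norm_inverse: "padic_norm (inverse x :: 'p::prime_card padic) = inverse (padic_norm x)"
proof (cases "x = 0")
  case False
  then have "padic_norm (inverse x) * padic_norm x = 1"
    by (simp flip: padic_norm_mult)
  then show ?thesis
    by (intro inverse_unique[symmetric]) (simp add: mult.commute)
qed simp

lemma padic_norm_divide: "padic_norm (x / y :: 'p::prime_card padic) = padic_norm x / padic_norm y"
  by (simp add: divide_inverse padic_norm_mult padic_norm_inverse)

lemma padic_norm_power: "padic_norm (x ^ n :: 'p::prime_card padic) = padic_norm x ^ n"
  by (induction n) (simp_all add: padic_norm_mult)

definition ppow :: "int \<Rightarrow> 'p::prime_card padic" where
  "ppow k = of_nat CARD('p) powi k"

lemma ppow_ne_0 [simp]: "(ppow k :: 'p::prime_card padic) \<noteq> 0"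
  by (simp add: ppow_def power_int_eq_0_iff)

lemma ppow_0 [simp]: "(ppow 0 :: 'p::prime_card padic) = 1"
  by (simp add: ppow_def)

lemma ppow_1: "(ppow 1 :: 'p::prime_card padic) = of_nat CARD('p)"
  by (simp add: ppow_def)

lemma ppow_add: "(ppow (k + l) :: 'p::prime_card padic) = ppow k * ppow l"
  unfolding ppow_def by (rule power_int_add) simp

lemma ppow_nat: "(ppow (int n) :: 'p::prime_card padic) = of_nat (CARD('p) ^ n)"
  by (simp add: ppow_def)

lemma ppow_minus: "(ppow (- k) :: 'p::prime_card padic) = inverse (ppow k)"
  by (simp add: ppow_def power_int_minus)

lemma pabs_of_nat:
  assumes "n > 0"
  shows "pabs CARD('p::prime_card) (of_nat n) = real CARD('p) powi (- int (multiplicity CARD('p) n))"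
proof -
  have "pabs CARD('p) (of_int (int n) / of_int 1) =
      real CARD('p) powi (int (multiplicity (int CARD('p)) 1) - int (multiplicity (int CARD('p)) (int n)))"
    using assms by (intro pabs_quotient prime_card) auto
  moreover have "multiplicity (int CARD('p)) (int n) = multiplicity CARD('p) n"
  proof (rule multiplicity_eqI)
    show "int CARD('p) ^ multiplicity CARD('p) n dvd int n"
      using multiplicity_dvd[of "CARD('p)" n] by (simp flip: of_nat_power)
    have "\<not> CARD('p) ^ Suc (multiplicity CARD('p) n) dvd n"
      using assms card_gt_1[where 'p='p]
      by (subst power_dvd_iff_le_multiplicity) auto
    then show "\<not> int CARD('p) ^ Suc (multiplicity CARD('p) n) dvd int n"
      by (simp only: int_dvd_int_iff flip: of_nat_power) simp
  qed
  ultimately show ?thesis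
    by simp
qed

lemma padic_norm_card: "padic_norm (of_nat CARD('p) :: 'p::prime_card padic) = inverse (real CARD('p))"
proof -
  have "multiplicity CARD('p) CARD('p) = 1"
    using card_gt_1[where 'p='p] by (intro multiplicity_self) auto
  then show ?thesis
    using padic_norm_of_nat[of "CARD('p)", where 'a='p] pabs_of_nat[of "CARD('p)", where 'p='p]
    by (simp add: power_int_minus)
qed

lemma padic_norm_ppow [simp]: "padic_norm (ppow k :: 'p::prime_card padic) = real CARD('p) powi (- k)"
proof (cases k)
  case (nonneg n)
  then show ?thesis
    by (simp add: ppow_def padic_norm_power padic_norm_card power_int_minus power_inverse)
next
  case (neg n)
  then show ?thesis
    by (simp add: ppow_def power_int_minus padic_norm_inverse padic_norm_power padic_norm_card
        power_inverse del: power_Suc of_nat_Suc)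
qed

lemma padic_norm_of_nat_le_iff:
  "padic_norm (of_nat n :: 'p::prime_card padic) \<le> real CARD('p) powi (- int m) \<longleftrightarrow> CARD('p) ^ m dvd n"
proof (cases "n = 0")
  case False
  have "CARD('p) ^ m dvd n \<longleftrightarrow> m \<le> multiplicity CARD('p) n"
    using False card_gt_1[where 'p='p] by (intro power_dvd_iff_le_multiplicity) auto
  then show ?thesis
    using False by (simp add: padic_norm_of_nat pabs_of_nat)
qed (simp add: less_imp_le)

lemma padic_norm_of_nat_le_1: "padic_norm (of_nat n :: 'p::prime_card padic) \<le> 1"
  using padic_norm_of_nat_le_iff[of n 0, where 'p='p] by simp

lemma padic_norm_of_int_le_1: "padic_norm (of_int n :: 'p::prime_card padic) \<le> 1"
  by (cases n) (simp_all only: of_int_of_nat_eq of_int_minus padic_norm_minus padic_norm_of_nat_le_1)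

lemma padic_norm_of_int: "padic_norm (of_int n :: 'p::prime_card padic) = padic_norm (of_nat (nat \<bar>n\<bar>) :: 'p padic)"
  by (cases "n \<ge> 0") (simp_all add: padic_norm_minus)

lemma padic_norm_of_int_le_iff:
  "padic_norm (of_int n :: 'p::prime_card padic) \<le> real CARD('p) powi (- int m) \<longleftrightarrow> int CARD('p) ^ m dvd n"
proof -
  have "int CARD('p) ^ m dvd n \<longleftrightarrow> CARD('p) ^ m dvd nat \<bar>n\<bar>"
    by (simp add: int_dvd_int_iff[symmetric])
  then show ?thesis
    by (simp only: padic_norm_of_int padic_norm_of_nat_le_iff)
qed

lemma of_int_Padic: "(of_int n :: 'a::prime_card padic) = Padic (\<lambda>_. of_int n)"
proof (cases n)
  case (neg m)
  have "- (Padic (\<lambda>_. of_nat (Suc m)) :: 'a padic) = Padic (\<lambda>_. - of_nat (Suc m))"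
    by (intro uminus_padic.abs_eq padicrel_const[OF prime_card])
  then show ?thesis
    using neg by (simp only: of_int_minus of_int_of_nat_eq of_nat_Padic)
qed (simp add: of_nat_Padic)

lemma of_rat_Padic: "(of_rat q :: 'a::prime_card padic) = Padic (\<lambda>_. q)"
proof -
  obtain a b where ab: "quotient_of q = (a, b)"
    by fastforce
  have b: "b \<noteq> 0"
    using quotient_of_denom_pos[OF ab] by auto
  have q: "q * of_int b = of_int a"
    using quotient_of_div[OF ab] b by simp
  have "Padic (\<lambda>_. q) * (of_int b :: 'a padic) = of_int a"
    unfolding of_int_Padic q[symmetric]
    using times_padic.abs_eq[OF padicrel_const[OF prime_card] padicrel_const[OF prime_card], of q "of_int b", where 'a='a]
    by simp
  moreover have "of_rat q * (of_int b :: 'a padic) = of_int a"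
    using arg_cong[OF q, of "of_rat :: rat \<Rightarrow> 'a padic"] by (simp add: of_rat_mult)
  ultimately show ?thesis
    using b by (metis mult_cancel_right of_int_eq_0_iff)
qed

lemma padic_norm_of_rat: "padic_norm (of_rat q :: 'p::prime_card padic) = pabs CARD('p) q"
  unfolding of_rat_Padic using padic_norm_Padic_eq[OF pcauchy_const[OF prime_card], of q, where 'a='p]
  by (simp add: LIMSEQ_const_iff)

lemma Padic_approx:
  assumes X: "pcauchy CARD('p) X"
    and k: "\<And>n. n \<ge> k \<Longrightarrow> padic_norm (of_rat (X n) - of_rat (X k) :: 'p padic) \<le> r"
  shows "padic_norm (Padic X - of_rat (X k) :: 'p::prime_card padic) \<le> r"
proof -
  have "padicrel CARD('p) X X"
    using X padicrel_refl[OF prime_card] by blast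
  then have "Padic X - of_rat (X k) = (Padic (\<lambda>n. X n + - X k) :: 'p padic)"
    unfolding of_rat_Padic minus_padic_def
    using uminus_padic.abs_eq[OF padicrel_const[OF prime_card], of "X k", where 'a='p]
      plus_padic.abs_eq[OF _ padicrel_const[OF prime_card], of X "- X k", where 'a='p]
    by simp
  moreover have "(\<lambda>n. pabs CARD('p) (X n + - X k)) \<longlonglongrightarrow> padic_norm (Padic (\<lambda>n. X n + - X k) :: 'p padic)"
    using X by (intro padic_norm_Padic_eq pcauchy_add pcauchy_const prime_card)
  ultimately have "(\<lambda>n. pabs CARD('p) (X n - X k)) \<longlonglongrightarrow> padic_norm (Padic X - of_rat (X k) :: 'p padic)"
    by simp
  then show ?thesis
    by (rule LIMSEQ_le_const2)
      (use k in \<open>auto simp flip: of_rat_diff simp: padic_norm_of_rat intro!: exI[of _ k]\<close>)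
qed

lemma rat_approx:
  fixes x :: "'p::prime_card padic"
  assumes "e > 0"
  shows "\<exists>a b. b \<noteq> 0 \<and> coprime a b \<and> padic_norm (x - of_int a / of_int b) < e"
proof -
  obtain X where X: "pcauchy CARD('p) X" "x = Padic X"
    using padic_norm_Padic[of x] by blast
  obtain k where k: "\<And>m n. m \<ge> k \<Longrightarrow> n \<ge> k \<Longrightarrow> pabs CARD('p) (X m - X n) < e / 2"
    using X(1) assms unfolding pcauchy_def by (meson half_gt_zero)
  obtain a b where ab: "quotient_of (X k) = (a, b)"
    by fastforce
  have b: "b \<noteq> 0" "coprime a b"
    using ab quotient_of_denom_pos[OF ab] quotient_of_coprime[OF ab] by auto
  have "padic_norm (x - of_rat (X k)) \<le> e / 2"
    unfolding X(2) using k by (intro Padic_approx X(1))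
      (simp flip: of_rat_diff add: padic_norm_of_rat less_imp_le)
  moreover have "(of_rat (X k) :: 'p padic) = of_int a / of_int b"
    using quotient_of_div[OF ab] by (simp add: of_rat_divide)
  ultimately show ?thesis
    using b assms by (intro exI[of _ a] exI[of _ b]) simp
qed

lemma padic_norm_sum_le:
  "(\<And>i. i \<in> A \<Longrightarrow> padic_norm (f i :: 'p::prime_card padic) \<le> r) \<Longrightarrow> 0 \<le> r \<Longrightarrow> padic_norm (sum f A) \<le> r"
  by (induction A rule: infinite_finite_induct) (auto intro: padic_norm_add_le)

text \<open>
  A rational number close to a p-adic integer has a denominator prime to p, and such a denominator
  is invertible modulo every power of p.
\<close>

lemma padic_integer_approx:
  fixes x :: "'p::prime_card padic"
  assumes "padic_norm x \<le> 1"
  obtains k where "k < CARD('p) ^ n" "padic_norm (x - of_nat k) \<le> real CARD('p) powi (- int n)"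
proof -
  obtain a b where b: "b \<noteq> 0" "coprime a b"
    and ab: "padic_norm (x - of_int a / of_int b) < real CARD('p) powi (- int n)"
    using rat_approx[of "real CARD('p) powi (- int n)" x] by auto
  have "real CARD('p) powi (- int n) \<le> real CARD('p) powi 0"
    unfolding card_powi_le_iff by simp
  then have "padic_norm (x - of_int a / of_int b) \<le> 1"
    using ab by simp
  from padic_norm_diff_le[OF assms this] have "padic_norm (of_int a / of_int b :: 'p padic) \<le> 1"
    by simp
  then have ab1: "padic_norm (of_int a :: 'p padic) \<le> padic_norm (of_int b :: 'p padic)"
    using b by (simp add: padic_norm_divide field_simps)
  have pb: "\<not> int CARD('p) dvd b"
  proof
    assume *: "int CARD('p) dvd b"
    then have "padic_norm (of_int b :: 'p padic) \<le> real CARD('p) powi (- int 1)"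
      unfolding padic_norm_of_int_le_iff by simp
    then have "int CARD('p) dvd a"
      using ab1 padic_norm_of_int_le_iff[of a 1, where 'p='p] by simp
    with * b(2) have "is_unit (int CARD('p))"
      by (meson coprime_common_divisor)
    then show False
      using card_gt_1[where 'p='p] by simp
  qed
  have "prime (int CARD('p))"
    using prime_card[where 'a='p] by simp
  then have "coprime b (int CARD('p) ^ n)"
    using pb by (metis coprime_commute coprime_power_right_iff prime_imp_coprime)
  then obtain c where c: "[b * c = a] (mod (int CARD('p) ^ n))"
    using cong_solve_dvd_int[of b "int CARD('p) ^ n" 1]
    by (metis cong_scalar_right coprime_imp_gcd_eq_1 dvd_refl mult.assoc mult_1)
  define k where "k = nat (c mod (int CARD('p) ^ n))"
  have pn: "int CARD('p) ^ n > 0"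
    using card_gt_1[where 'p='p] by simp
  have ik: "int k = c mod (int CARD('p) ^ n)"
    unfolding k_def using pn by simp
  have "int k < int (CARD('p) ^ n)"
    using ik pn by simp
  then have kl: "k < CARD('p) ^ n"
    by linarith
  have "[b * int k = a] (mod (int CARD('p) ^ n))"
    using c unfolding ik by (simp add: cong_def mod_mult_right_eq)
  then have "int CARD('p) ^ n dvd a - b * int k"
    by (simp add: cong_iff_dvd_diff dvd_diff_commute)
  then have 1: "padic_norm (of_int (a - b * int k) :: 'p padic) \<le> real CARD('p) powi (- int n)"
    by (simp only: padic_norm_of_int_le_iff)
  have "\<not> padic_norm (of_int b :: 'p padic) \<le> real CARD('p) powi (- int 1)"
    using pb by (simp only: padic_norm_of_int_le_iff) simp
  moreover have "padic_norm (of_int b :: 'p padic) = 1 \<or> padic_norm (of_int b :: 'p padic) \<le> real CARD('p) powi (- int 1)"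
  proof -
    have "padic_norm (of_int b :: 'p padic) = real CARD('p) powi (- int (multiplicity CARD('p) (nat \<bar>b\<bar>)))"
      unfolding padic_norm_of_int padic_norm_of_nat using b by (intro pabs_of_nat) simp
    then show ?thesis
      by (cases "multiplicity CARD('p) (nat \<bar>b\<bar>)") (simp_all only: card_powi_le_iff, simp_all)
  qed
  ultimately have b1: "padic_norm (of_int b :: 'p padic) = 1"
    by blast
  have "(of_int a / of_int b - of_nat k :: 'p padic) = of_int (a - b * int k) / of_int b"
    using b by (simp add: field_simps)
  then have "padic_norm (of_int a / of_int b - of_nat k :: 'p padic) \<le> real CARD('p) powi (- int n)"
    using 1 by (simp only: padic_norm_divide b1 div_by_1)
  then have "padic_norm (x - of_nat k) \<le> real CARD('p) powi (- int n)"
    using padic_norm_trans[OF less_imp_le[OF ab]] by blast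
  with kl show ?thesis
    by (rule that)
qed

text \<open>
  The points \<open>grid N k\<close> with \<open>0 \<le> k < p ^ (M + N)\<close> represent the cosets of the ball of radius
  \<open>p ^ (- M)\<close> in the ball of radius \<open>p ^ N\<close>.
\<close>

definition grid :: "int \<Rightarrow> int \<Rightarrow> 'p::prime_card padic" where
  "grid N k = of_int k * ppow (- N)"

lemma grid_diff: "(grid N k - grid N l :: 'p::prime_card padic) = grid N (k - l)"
  by (simp add: grid_def algebra_simps)

lemma grid_add: "(grid N k + grid N l :: 'p::prime_card padic) = grid N (k + l)"
  by (simp add: grid_def algebra_simps)

lemma padic_norm_grid_le_iff:
  assumes "M + N \<ge> 0"
  shows "padic_norm (grid N k :: 'p::prime_card padic) \<le> real CARD('p) powi (- M)
    \<longleftrightarrow> int CARD('p) ^ nat (M + N) dvd k"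
proof -
  have "padic_norm (grid N k :: 'p padic) = padic_norm (of_int k :: 'p padic) * real CARD('p) powi N"
    by (simp add: grid_def padic_norm_mult)
  moreover have "real CARD('p) powi (- M) = real CARD('p) powi (- int (nat (M + N))) * real CARD('p) powi N"
    using assms by (simp flip: card_powi_add)
  ultimately have "padic_norm (grid N k :: 'p::prime_card padic) \<le> real CARD('p) powi (- M) \<longleftrightarrow>
     padic_norm (of_int k :: 'p padic) \<le> real CARD('p) powi (- int (nat (M + N)))"
    by simp
  then show ?thesis
    by (simp only: padic_norm_of_int_le_iff)
qed

lemma padic_norm_grid_le: "padic_norm (grid N k :: 'p::prime_card padic) \<le> real CARD('p) powi N"
  using padic_norm_of_int_le_1[of k, where 'p='p]
  by (simp add: grid_def padic_norm_mult)

lemma grid_approx: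
  fixes x :: "'p::prime_card padic"
  assumes "padic_norm x \<le> real CARD('p) powi N" "M + N \<ge> 0"
  obtains k where "k < CARD('p) ^ nat (M + N)"
    "padic_norm (x - grid N (int k)) \<le> real CARD('p) powi (- M)"
proof -
  have "padic_norm (x * ppow N) \<le> 1"
    using assms(1) by (simp add: padic_norm_mult power_int_minus field_simps)
  from padic_integer_approx[OF this, of "nat (M + N)"]
  obtain k where k: "k < CARD('p) ^ nat (M + N)"
    "padic_norm (x * ppow N - of_nat k) \<le> real CARD('p) powi (- int (nat (M + N)))"
    by blast
  have "x - grid N (int k) = (x * ppow N - of_nat k) * ppow (- N)"
    by (simp add: grid_def ring_distribs mult.assoc flip: ppow_add)
  then have "padic_norm (x - grid N (int k)) = padic_norm (x * ppow N - of_nat k) * real CARD('p) powi N"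
    by (simp only: padic_norm_mult padic_norm_ppow) simp
  also have "\<dots> \<le> real CARD('p) powi (- int (nat (M + N))) * real CARD('p) powi N"
    using k(2) by (intro mult_right_mono) (auto simp: less_imp_le)
  also have "\<dots> = real CARD('p) powi (- M)"
    using assms(2) by (simp flip: card_powi_add)
  finally show ?thesis
    using k(1) that by blast
qed

lemma grid_eqI:
  assumes "padic_norm (grid N (int k) - grid N (int l) :: 'p::prime_card padic) \<le> real CARD('p) powi (- M)"
    "M + N \<ge> 0" "k < CARD('p) ^ nat (M + N)" "l < CARD('p) ^ nat (M + N)"
  shows "k = l"
proof -
  have "int CARD('p) ^ nat (M + N) dvd int k - int l"
    using assms(1,2) by (simp only: grid_diff padic_norm_grid_le_iff)
  then have "int k mod int (CARD('p) ^ nat (M + N)) = int l mod int (CARD('p) ^ nat (M + N))"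
    by (simp add: mod_eq_dvd_iff)
  then show ?thesis
    using assms(3,4) by (simp flip: zmod_int)
qed

lemma padic_norm_trans':
  "padic_norm (x - y) \<le> r \<Longrightarrow> padic_norm (x - z) \<le> r \<Longrightarrow> padic_norm (y - z :: 'p::prime_card padic) \<le> r"
  using padic_norm_trans[of y x r z] by (simp add: padic_norm_diff_commute)

lemma card_powi_cancel:
  "real CARD('p::prime_card) powi k * real CARD('p) powi (- k) = 1"
  "real CARD('p) powi (- k) * real CARD('p) powi k = 1"
  by (simp_all only: card_powi_add[symmetric]) simp_all

section \<open>Balls\<close>

definition pball :: "'p::prime_card padic \<Rightarrow> int \<Rightarrow> 'p padic set" where
  "pball c j = {x. padic_norm (x - c) \<le> real CARD('p) powi j}"

lemma pball_cball: "pball c j = cball (c :: 'p::prime_card padic) (real CARD('p) powi j)"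
  by (auto simp: pball_def dist_padic_def padic_norm_diff_commute)

lemma centre_in_pball [simp]: "c \<in> pball c j"
  by (simp add: pball_def less_imp_le)

lemma pball_0_iff: "x \<in> pball (0 :: 'p::prime_card padic) j \<longleftrightarrow> padic_norm x \<le> real CARD('p) powi j"
  by (simp add: pball_def)

lemma pball_recentre: "d \<in> pball c j \<Longrightarrow> pball d j = pball c j"
  using padic_norm_trans padic_norm_diff_commute unfolding pball_def by (metis (lifting) mem_Collect_eq)

lemma pball_mono: "i \<le> j \<Longrightarrow> pball c i \<subseteq> pball (c :: 'p::prime_card padic) j"
  using card_powi_le_iff[of i j, where 'p='p] unfolding pball_def by (auto intro: order_trans)

lemma pball_Int:
  "pball c i \<inter> pball d j = {} \<or> pball c i \<inter> pball d j = pball c i \<or> pball c i \<inter> pball d j = pball d j"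
proof (cases "pball c i \<inter> pball d j = {}")
  case False
  then obtain x where "x \<in> pball c i" "x \<in> pball d j"
    by blast
  then have "pball c i = pball x i" "pball d j = pball x j"
    by (simp_all add: pball_recentre)
  then show ?thesis
    using pball_mono[of i j x] pball_mono[of j i x] by (cases "i \<le> j") auto
qed simp

lemma open_pball: "open (pball (c :: 'p::prime_card padic) j)"
  unfolding open_contains_cball
proof
  fix x assume "x \<in> pball c j"
  then have "cball x (real CARD('p) powi j) \<subseteq> pball c j"
    by (simp add: pball_recentre flip: pball_cball)
  then show "\<exists>e>0. cball x e \<subseteq> pball c j"
    using card_powi_pos by blast
qed

lemma pball_borel [measurable]: "pball c j \<in> sets borel"
  by (rule borel_open[OF open_pball])

lemma in_pball_0_large: "\<exists>n::nat. x \<in> pball (0 :: 'p::prime_card padic) (int n)"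
  using exists_card_powi_ge[of "padic_norm x", where 'p='p] by (simp add: pball_0_iff)

lemma pball_0_grid_Union:
  assumes "M + N \<ge> 0"
  shows "pball (0 :: 'p::prime_card padic) N = (\<Union>k<CARD('p) ^ nat (M + N). pball (grid N (int k)) (- M))"
proof (intro equalityI subsetI)
  fix x :: "'p padic" assume "x \<in> pball 0 N"
  then obtain k where "k < CARD('p) ^ nat (M + N)"
      "padic_norm (x - grid N (int k)) \<le> real CARD('p) powi (- M)"
    using grid_approx[of x N M] assms by (auto simp: pball_0_iff)
  then show "x \<in> (\<Union>k<CARD('p) ^ nat (M + N). pball (grid N (int k)) (- M))"
    by (auto simp: pball_def)
next
  fix x :: "'p padic" assume "x \<in> (\<Union>k<CARD('p) ^ nat (M + N). pball (grid N (int k)) (- M))"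
  then obtain k where "x \<in> pball (grid N (int k)) (- M)"
    by blast
  then have "x \<in> pball (grid N (int k)) N"
    using assms pball_mono[of "- M" N] by auto
  moreover have "grid N (int k) \<in> pball (0 :: 'p padic) N"
    by (simp add: pball_0_iff padic_norm_grid_le)
  ultimately show "x \<in> pball 0 N"
    using pball_recentre by blast
qed

lemma disjoint_grid_pballs:
  assumes "M + N \<ge> 0"
  shows "disjoint_family_on (\<lambda>k. pball (grid N (int k) :: 'p::prime_card padic) (- M)) {..<CARD('p) ^ nat (M + N)}"
  unfolding disjoint_family_on_def
proof (intro ballI impI)
  fix k l assume kl: "k \<in> {..<CARD('p) ^ nat (M + N)}" "l \<in> {..<CARD('p) ^ nat (M + N)}" "k \<noteq> l"
  show "pball (grid N (int k)) (- M) \<inter> pball (grid N (int l) :: 'p padic) (- M) = {}"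
  proof (rule ccontr)
    assume "\<not> ?thesis"
    then obtain x :: "'p padic" where "x \<in> pball (grid N (int k)) (- M)" "x \<in> pball (grid N (int l)) (- M)"
      by blast
    then have "padic_norm (grid N (int k) - grid N (int l) :: 'p padic) \<le> real CARD('p) powi (- M)"
      unfolding pball_def using padic_norm_trans' by blast
    then show False
      using grid_eqI[of N k l M, where 'p='p] assms kl by simp
  qed
qed

definition padic_balls :: "'p::prime_card padic set set" where
  "padic_balls = insert {} (range (\<lambda>(c, j). pball c j))"

lemma pball_in_padic_balls [simp]: "pball c j \<in> padic_balls"
  by (auto simp: padic_balls_def image_iff)

lemma countable_padic_balls: "countable (padic_balls :: 'p::prime_card padic set set)"
proof -
  have "padic_balls \<subseteq> insert {} (range (\<lambda>(N, k, j). pball (grid N k :: 'p padic) j))"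
  proof
    fix A :: "'p padic set" assume "A \<in> padic_balls"
    then consider "A = {}" | c j where "A = pball c j"
      by (auto simp: padic_balls_def)
    then show "A \<in> insert {} (range (\<lambda>(N, k, j). pball (grid N k) j))"
    proof cases
      case (2 c j)
      obtain n where n: "c \<in> pball 0 (int n)"
        using in_pball_0_large by blast
      have "pball 0 (int n) \<subseteq> pball (0 :: 'p padic) (max (int n) j)"
        by (intro pball_mono) simp
      then have "padic_norm c \<le> real CARD('p) powi (max (int n) j)"
        using n pball_0_iff by blast
      from grid_approx[OF this, of "- j"]
      obtain k where "padic_norm (c - grid (max (int n) j) (int k)) \<le> real CARD('p) powi j"
        by auto
      then have "pball c j = pball (grid (max (int n) j) (int k)) j"
        by (intro pball_recentre) (simp add: pball_def)
      then show ?thesis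
        using 2 by auto
    qed simp
  qed
  then show ?thesis
    by (rule countable_subset) simp
qed

lemma Int_stable_padic_balls: "Int_stable (padic_balls :: 'p::prime_card padic set set)"
  unfolding Int_stable_def
proof (intro ballI)
  fix A B :: "'p padic set" assume "A \<in> padic_balls" "B \<in> padic_balls"
  then show "A \<inter> B \<in> padic_balls"
    unfolding padic_balls_def
  proof (elim insertE rangeE, goal_cases)
    case (4 x y)
    then show ?case
      using pball_Int[of "fst x" "snd x" "fst y" "snd y"] by (auto simp: case_prod_unfold)
  qed auto
qed

lemma sets_borel_padic: "sets (borel :: 'p::prime_card padic measure) = sigma_sets UNIV padic_balls"
proof -
  have "(borel :: 'p padic measure) = sigma UNIV padic_balls"
  proof (rule borel_eq_countable_basis)
    show "countable (padic_balls :: 'p padic set set)"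
      by (rule countable_padic_balls)
    show "topological_basis (padic_balls :: 'p padic set set)"
    proof (rule topological_basisI)
      fix A :: "'p padic set" assume "A \<in> padic_balls"
      then show "open A"
        using open_pball by (auto simp: padic_balls_def)
    next
      fix U :: "'p padic set" and x assume "open U" "x \<in> U"
      then obtain e where e: "e > 0" "cball x e \<subseteq> U"
        by (meson open_contains_cball)
      obtain m where "real CARD('p) powi (- int m) < e"
        using exists_card_powi_less[OF e(1)] by blast
      then have "pball x (- int m) \<subseteq> cball x e"
        by (auto simp: pball_cball)
      then show "\<exists>B\<in>padic_balls. x \<in> B \<and> B \<subseteq> U"
        using e(2) by (intro bexI[of _ "pball x (- int m)"]) auto
    qed
  qed
  moreover have "sets (sigma UNIV (padic_balls :: 'p padic set set)) = sigma_sets UNIV padic_balls"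
    by (rule sets_measure_of) simp
  ultimately show ?thesis
    by simp
qed

section \<open>Haar measure\<close>

text \<open>
  Balls form a countable base that is closed under intersection, so a measure that is finite on
  balls is determined by its values there.
\<close>

lemma measure_eqI_pballs:
  fixes \<mu> \<nu> :: "'p::prime_card padic measure"
  assumes "sets \<mu> = sets borel" "sets \<nu> = sets borel"
    and eq: "\<And>c j. emeasure \<mu> (pball c j) = emeasure \<nu> (pball c j)"
    and fin: "\<And>j. emeasure \<mu> (pball 0 j) \<noteq> \<infinity>"
  shows "\<mu> = \<nu>"
proof (rule measure_eqI_generator_eq[OF Int_stable_padic_balls])
  show "(padic_balls :: 'p padic set set) \<subseteq> Pow UNIV"
    by simp
  show "sets \<mu> = sigma_sets UNIV padic_balls" "sets \<nu> = sigma_sets UNIV padic_balls"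
    using assms(1,2) sets_borel_padic by simp_all
  show "range (\<lambda>n. pball 0 (int n)) \<subseteq> (padic_balls :: 'p padic set set)"
    by auto
  show "(\<Union>n. pball 0 (int n)) = (UNIV :: 'p padic set)"
    using in_pball_0_large by blast
  show "emeasure \<mu> A = emeasure \<nu> A" if "A \<in> padic_balls" for A
    using that eq by (auto simp: padic_balls_def)
  show "emeasure \<mu> (pball 0 (int n)) \<noteq> \<infinity>" for n
    by (rule fin)
qed

lemma translate_pball: "(+) a ` pball c j = pball (a + c :: 'p::prime_card padic) j"
proof (intro equalityI subsetI)
  fix x assume "x \<in> pball (a + c) j"
  then show "x \<in> (+) a ` pball c j"
    by (intro image_eqI[of _ _ "x - a"]) (simp_all add: pball_def algebra_simps)
qed (auto simp: pball_def)

text \<open>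
  Counting cosets compares each ball with the unit ball: the one of radius \<open>p ^ N\<close> is a disjoint union of
  \<open>p ^ (M + N)\<close> translates of the one of radius \<open>p ^ (- M)\<close>.
\<close>

lemma emeasure_pball:
  fixes \<mu> :: "'p::prime_card padic measure"
  assumes "is_padic_haar \<mu>"
  shows "emeasure \<mu> (pball c j) = ennreal (real CARD('p) powi j)"
proof -
  have sets: "sets \<mu> = sets borel"
    and inv: "\<And>a A. A \<in> sets borel \<Longrightarrow> emeasure \<mu> ((+) a ` A) = emeasure \<mu> A"
    and unit: "emeasure \<mu> (pball 0 0) = 1"
    using assms by (simp_all add: is_padic_haar_def pball_cball)
  have shift: "emeasure \<mu> (pball c j) = emeasure \<mu> (pball 0 j)" for c j
    using inv[OF pball_borel, of c 0 j] by (simp add: translate_pball)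
  have split: "emeasure \<mu> (pball 0 N) = of_nat (CARD('p) ^ nat (M + N)) * emeasure \<mu> (pball 0 (- M))"
    if "M + N \<ge> 0" for M N
  proof -
    have "emeasure \<mu> (pball 0 N) = (\<Sum>k<CARD('p) ^ nat (M + N). emeasure \<mu> (pball (grid N (int k)) (- M)))"
      unfolding pball_0_grid_Union[OF that]
      using disjoint_grid_pballs[OF that] by (intro sum_emeasure[symmetric]) (auto simp: sets)
    then show ?thesis
      by (simp add: shift[of "grid _ _"])
  qed
  have "emeasure \<mu> (pball 0 j) = ennreal (real CARD('p) powi j)"
  proof (cases "j \<ge> 0")
    case True
    then have "emeasure \<mu> (pball 0 j) = of_nat (CARD('p) ^ nat j)"
      using split[of 0 j] unit by simp
    also have "\<dots> = ennreal (real CARD('p) powi j)"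
      using True by (simp only: card_powi_nat ennreal_of_nat_eq_real_of_nat)
    finally show ?thesis .
  next
    case False
    have "ennreal (real CARD('p) powi j) * 1 =
        ennreal (real CARD('p) powi j) * (ennreal (real CARD('p) powi (- j)) * emeasure \<mu> (pball 0 j))"
      using False split[of "- j" 0] unit card_powi_nat[of "- j", where 'p='p]
      by (simp add: ennreal_of_nat_eq_real_of_nat)
    also have "\<dots> = ennreal (real CARD('p) powi j * real CARD('p) powi (- j)) * emeasure \<mu> (pball 0 j)"
      by (simp add: ennreal_mult less_imp_le mult.assoc)
    also have "real CARD('p) powi j * real CARD('p) powi (- j) = 1"
      by (simp flip: card_powi_add)
    finally show ?thesis
      by simp
  qed
  then show ?thesis
    using shift[of c j] by simp
qed

lemma is_padic_haar_unique: "is_padic_haar \<mu> \<Longrightarrow> is_padic_haar \<nu> \<Longrightarrow> \<mu> = \<nu>"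
  by (rule measure_eqI_pballs) (simp_all add: emeasure_pball, simp_all add: is_padic_haar_def)

text \<open>
  Translates of balls are balls of the same radius. Hence a measure with these ball values agrees with all of
  its translates.
\<close>

lemma is_padic_haarI:
  fixes \<mu> :: "'p::prime_card padic measure"
  assumes sets: "sets \<mu> = sets borel"
    and ball: "\<And>c j. emeasure \<mu> (pball c j) = ennreal (real CARD('p) powi j)"
  shows "is_padic_haar \<mu>"
  unfolding is_padic_haar_def
proof (intro conjI allI ballI)
  show "sets \<mu> = sets borel"
    by (rule sets)
  show "emeasure \<mu> (cball 0 1) = 1"
    using ball[of 0 0] by (simp add: pball_cball)
next
  fix a :: "'p padic" and A :: "'p padic set" assume A: "A \<in> sets borel"
  have cont: "continuous_on UNIV (\<lambda>x. x - a)"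
    by (rule continuous_onI) (auto simp: dist_padic_def)
  then have meas: "(\<lambda>x. x - a) \<in> measurable \<mu> borel"
    using sets borel_measurable_continuous_onI measurable_cong_sets by blast
  have space: "space \<mu> = UNIV"
    using sets_eq_imp_space_eq[OF sets] by simp
  have img: "(\<lambda>x. x - a) -` B \<inter> space \<mu> = (+) a ` B" for B
    by (auto simp: space image_iff intro!: bexI[of _ "_ - a"])
  have "\<mu> = distr \<mu> borel (\<lambda>x. x - a)"
  proof (rule measure_eqI_pballs)
    show "emeasure \<mu> (pball c j) = emeasure (distr \<mu> borel (\<lambda>x. x - a)) (pball c j)" for c j
      by (simp add: emeasure_distr[OF meas] img translate_pball ball)
  qed (simp_all add: sets ball)
  then have "emeasure \<mu> A = emeasure (distr \<mu> borel (\<lambda>x. x - a)) A"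
    by simp
  also have "\<dots> = emeasure \<mu> ((+) a ` A)"
    using A by (simp add: emeasure_distr[OF meas] img)
  finally show "emeasure \<mu> ((+) a ` A) = emeasure \<mu> A"
    by simp
qed

text \<open>
  The digit of \<open>x\<close> at \<open>p ^ (- i - 1)\<close>. It becomes the coefficient of \<open>p ^ i\<close> under the Monna map, which mirrors
  base \<open>p\<close> expansions at the radix point.
\<close>

definition base_digit :: "nat \<Rightarrow> int \<Rightarrow> real \<Rightarrow> int" where
  "base_digit p i x = \<lfloor>real p powi (i + 1) * x\<rfloor> mod int p"

definition monna_sum :: "nat \<Rightarrow> real \<Rightarrow> nat \<Rightarrow> rat" where
  "monna_sum p x n = (\<Sum>i\<in>{- int n..<int n}. of_int (base_digit p i x) * of_nat p powi i)"

definition monna :: "real \<Rightarrow> 'p::prime_card padic" where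
  "monna x = Padic (monna_sum CARD('p) x)"

lemma of_rat_power_int: "(of_rat (q powi i) :: 'a::field_char_0) = of_rat q powi i"
  by (cases i rule: int_cases4) (simp_all add: power_int_minus of_rat_inverse of_rat_power)

lemma of_rat_monna_sum:
  "(of_rat (monna_sum CARD('p) x n) :: 'p::prime_card padic) =
    (\<Sum>i\<in>{- int n..<int n}. of_int (base_digit CARD('p) i x) * ppow i)"
  by (simp add: monna_sum_def of_rat_sum of_rat_mult of_rat_power_int ppow_def)

lemma base_digit_eq_0:
  assumes "0 \<le> x" "x < real CARD('p::prime_card) powi K" "i < - K"
  shows "base_digit CARD('p) i x = 0"
proof -
  have "real CARD('p) powi (i + 1) * x < real CARD('p) powi (i + 1) * real CARD('p) powi K"
    using assms(2) by (intro mult_strict_left_mono) auto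
  also have "\<dots> = real CARD('p) powi (i + 1 + K)"
    by (simp only: card_powi_add)
  also have "\<dots> \<le> real CARD('p) powi 0"
    unfolding card_powi_le_iff using assms(3) by simp
  finally have "real CARD('p) powi (i + 1) * x < 1"
    by simp
  moreover have "0 \<le> real CARD('p) powi (i + 1) * x"
    using assms(1) by (simp add: less_imp_le)
  ultimately have "\<lfloor>real CARD('p) powi (i + 1) * x\<rfloor> = 0"
    by (simp add: floor_eq_iff)
  then show ?thesis
    by (simp add: base_digit_def)
qed

lemma padic_norm_digit_le:
  "i \<le> j \<Longrightarrow> padic_norm (of_int d * ppow j :: 'p::prime_card padic) \<le> real CARD('p) powi (- i)"
proof -
  assume "i \<le> j"
  have "padic_norm (of_int d * ppow j :: 'p padic) \<le> 1 * real CARD('p) powi (- j)"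
    unfolding padic_norm_mult padic_norm_ppow
    by (intro mult_right_mono padic_norm_of_int_le_1) (simp add: less_imp_le)
  also have "\<dots> \<le> real CARD('p) powi (- i)"
    using \<open>i \<le> j\<close> by simp
  finally show ?thesis .
qed

lemma monna_sum_close:
  assumes x: "0 \<le> x" "x < real CARD('p::prime_card) powi int K" and nm: "K \<le> n" "n \<le> m"
  shows "padic_norm (of_rat (monna_sum CARD('p) x m) - of_rat (monna_sum CARD('p) x n) :: 'p padic)
    \<le> real CARD('p) powi (- int n)"
proof -
  have "of_rat (monna_sum CARD('p) x m) - of_rat (monna_sum CARD('p) x n) =
      (\<Sum>i\<in>{- int m..<int m} - {- int n..<int n}. of_int (base_digit CARD('p) i x) * ppow i :: 'p padic)"
    unfolding of_rat_monna_sum using nm by (intro sum_diff[symmetric]) auto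
  also have "padic_norm \<dots> \<le> real CARD('p) powi (- int n)"
  proof (rule padic_norm_sum_le)
    fix i assume "i \<in> {- int m..<int m} - {- int n..<int n}"
    then consider "i < - int K" | "i \<ge> int n"
      using nm by fastforce
    then show "padic_norm (of_int (base_digit CARD('p) i x) * ppow i :: 'p padic) \<le> real CARD('p) powi (- int n)"
    proof cases
      case 1
      then show ?thesis
        using base_digit_eq_0[OF x] by (simp add: less_imp_le)
    qed (rule padic_norm_digit_le)
  qed (simp add: less_imp_le)
  finally show ?thesis .
qed

lemma monna_approx:
  assumes x: "0 \<le> x" "x < real CARD('p::prime_card) powi int K" and "K \<le> n"
  shows "padic_norm (monna x - of_rat (monna_sum CARD('p) x n) :: 'p padic) \<le> real CARD('p) powi (- int n)"
  unfolding monna_def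
proof (rule Padic_approx)
  show "pcauchy CARD('p) (monna_sum CARD('p) x)"
    unfolding pcauchy_def
  proof (intro allI impI)
    fix e :: real assume "e > 0"
    then obtain l where l: "real CARD('p) powi (- int l) < e"
      using exists_card_powi_less by blast
    have "pabs CARD('p) (monna_sum CARD('p) x m - monna_sum CARD('p) x n) < e"
      if "m \<ge> max K l" "n \<ge> max K l" for m n
    proof -
      have *: "pabs CARD('p) (monna_sum CARD('p) x m - monna_sum CARD('p) x n) < e"
        if "K \<le> n" "l \<le> n" "n \<le> m" for m n
      proof -
        have "pabs CARD('p) (monna_sum CARD('p) x m - monna_sum CARD('p) x n) \<le> real CARD('p) powi (- int n)"
          using monna_sum_close[OF x that(1,3)] by (simp flip: of_rat_diff add: padic_norm_of_rat)
        moreover have "real CARD('p) powi (- int n) \<le> real CARD('p) powi (- int l)"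
          using that by simp
        ultimately show ?thesis
          using l by linarith
      qed
      show ?thesis
        using *[of m n] *[of n m] that pabs_minus_commute[OF prime_card]
        by (cases "n \<le> m") (auto simp: pabs_minus_commute[OF prime_card, of "monna_sum _ x m"])
    qed
    then show "\<exists>k. \<forall>m\<ge>k. \<forall>n\<ge>k. pabs CARD('p) (monna_sum CARD('p) x m - monna_sum CARD('p) x n) < e"
      by blast
  qed
next
  fix m assume "n \<le> m"
  then show "padic_norm (of_rat (monna_sum CARD('p) x m) - of_rat (monna_sum CARD('p) x n) :: 'p padic)
      \<le> real CARD('p) powi (- int n)"
    using assms monna_sum_close by blast
qed

lemma floor_powi_mono:
  assumes "\<lfloor>real CARD('p::prime_card) powi i * x\<rfloor> = \<lfloor>real CARD('p) powi i * y\<rfloor>" "j \<le> i"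
  shows "\<lfloor>real CARD('p) powi j * x\<rfloor> = \<lfloor>real CARD('p) powi j * y\<rfloor>"
proof -
  have "\<lfloor>real CARD('p) powi j * z\<rfloor> = \<lfloor>real CARD('p) powi i * z\<rfloor> div int (CARD('p) ^ nat (i - j))" for z
  proof -
    have "real CARD('p) powi i = real CARD('p) powi j * real (CARD('p) ^ nat (i - j))"
      using assms(2) card_powi_nat[of "i - j", where 'p='p] card_powi_add[of j "i - j", where 'p='p] by simp
    then have "real CARD('p) powi j * z = real CARD('p) powi i * z / real_of_int (int (CARD('p) ^ nat (i - j)))"
      by simp
    then show ?thesis
      by (simp only: floor_divide_real_eq_div[OF of_nat_0_le_iff])
  qed
  then show ?thesis
    using assms(1) by simp
qed

lemma floor_powi_Suc:
  assumes "\<lfloor>real CARD('p::prime_card) powi i * x\<rfloor> = \<lfloor>real CARD('p) powi i * y\<rfloor>"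
    "base_digit CARD('p) i x = base_digit CARD('p) i y"
  shows "\<lfloor>real CARD('p) powi (i + 1) * x\<rfloor> = \<lfloor>real CARD('p) powi (i + 1) * y\<rfloor>"
proof -
  have "\<lfloor>real CARD('p) powi i * z\<rfloor> = \<lfloor>real CARD('p) powi (i + 1) * z\<rfloor> div int CARD('p)" for z
  proof -
    have "real CARD('p) powi i * z = real CARD('p) powi (i + 1) * z / real_of_int (int CARD('p))"
      by (simp add: card_powi_add)
    then show ?thesis
      by (simp only: floor_divide_real_eq_div[OF of_nat_0_le_iff])
  qed
  then show ?thesis
    using assms unfolding base_digit_def by (metis div_mult_mod_eq)
qed

text \<open>
  Digits below the position \<open>i\<close> agree when the floors do, and digits above it have norm at most
  \<open>p ^ (- (i + 1))\<close>, so only the digit at \<open>i\<close> is left in the difference.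
\<close>

lemma monna_diff:
  assumes "0 \<le> x" "0 \<le> y"
    and eq: "\<lfloor>real CARD('p::prime_card) powi i * x\<rfloor> = \<lfloor>real CARD('p) powi i * y\<rfloor>"
  shows "padic_norm (monna x - monna y - of_int (base_digit CARD('p) i x - base_digit CARD('p) i y) * ppow i :: 'p padic)
    \<le> real CARD('p) powi (- (i + 1))"
proof -
  obtain K where "max x y + 1 \<le> real CARD('p) powi int K"
    using exists_card_powi_ge by blast
  then have K: "x < real CARD('p) powi int K" "y < real CARD('p) powi int K"
    by auto
  define n where "n = max K (Suc (nat \<bar>i\<bar>))"
  have n: "K \<le> n" "i \<in> {- int n..<int n}" "i + 1 \<le> int n"
    by (auto simp: n_def)
  have le: "real CARD('p) powi (- int n) \<le> real CARD('p) powi (- (i + 1))"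
    using n by simp
  let ?d = "\<lambda>z j. of_int (base_digit CARD('p) j z) * ppow j :: 'p padic"
  let ?S = "\<lambda>z. of_rat (monna_sum CARD('p) z n) :: 'p padic"
  have "?S x - ?S y - (?d x i - ?d y i) = (\<Sum>j\<in>{- int n..<int n} - {i}. ?d x j - ?d y j)"
    unfolding of_rat_monna_sum sum_subtractf[symmetric]
    using n by (subst sum.remove[of _ i]) auto
  also have "padic_norm \<dots> \<le> real CARD('p) powi (- (i + 1))"
  proof (rule padic_norm_sum_le)
    fix j assume j: "j \<in> {- int n..<int n} - {i}"
    show "padic_norm (?d x j - ?d y j) \<le> real CARD('p) powi (- (i + 1))"
    proof (cases "j < i")
      case True
      then have "base_digit CARD('p) j x = base_digit CARD('p) j y"
        unfolding base_digit_def using floor_powi_mono[OF eq, of "j + 1"] by simp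
      then show ?thesis
        by (simp add: less_imp_le)
    next
      case False
      then show ?thesis
        using j by (intro padic_norm_diff_le padic_norm_digit_le) auto
    qed
  qed (simp add: less_imp_le)
  finally have 1: "padic_norm (?S x - ?S y - (?d x i - ?d y i)) \<le> real CARD('p) powi (- (i + 1))" .
  have 2: "padic_norm (monna x - ?S x) \<le> real CARD('p) powi (- (i + 1))"
    "padic_norm (monna y - ?S y) \<le> real CARD('p) powi (- (i + 1))"
    using monna_approx[OF assms(1) K(1) n(1)] monna_approx[OF assms(2) K(2) n(1)] le by linarith+
  have "monna x - monna y - of_int (base_digit CARD('p) i x - base_digit CARD('p) i y) * ppow i =
      (monna x - ?S x) - (monna y - ?S y) + (?S x - ?S y - (?d x i - ?d y i))"
    by (simp add: algebra_simps)
  then show ?thesis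
    using 1 2 by (simp only: padic_norm_add_le padic_norm_diff_le)
qed

text \<open>
  Digits are recovered one at a time: below all nonzero digits the floors agree, and a digit at position \<open>i < m\<close>
  that differed would contribute norm \<open>p ^ (- i)\<close>, which nothing above it can cancel.
\<close>

lemma monna_close_iff:
  assumes "0 \<le> x" "0 \<le> y"
  shows "padic_norm (monna x - monna y :: 'p::prime_card padic) \<le> real CARD('p) powi (- m)
    \<longleftrightarrow> \<lfloor>real CARD('p) powi m * x\<rfloor> = \<lfloor>real CARD('p) powi m * y\<rfloor>"
proof
  assume eq: "\<lfloor>real CARD('p) powi m * x\<rfloor> = \<lfloor>real CARD('p) powi m * y\<rfloor>"
  have "\<lfloor>real CARD('p) powi (m - 1) * x\<rfloor> = \<lfloor>real CARD('p) powi (m - 1) * y\<rfloor>"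
    by (rule floor_powi_mono[OF eq]) simp
  moreover have "base_digit CARD('p) (m - 1) x = base_digit CARD('p) (m - 1) y"
    using eq by (simp add: base_digit_def)
  ultimately show "padic_norm (monna x - monna y :: 'p padic) \<le> real CARD('p) powi (- m)"
    using monna_diff[OF assms, of "m - 1", where 'p='p] by simp
next
  assume close: "padic_norm (monna x - monna y :: 'p padic) \<le> real CARD('p) powi (- m)"
  obtain K where K: "max x y + 1 \<le> real CARD('p) powi int K"
    using exists_card_powi_ge by blast
  have floor_0: "\<lfloor>real CARD('p) powi (- int K) * z\<rfloor> = 0" if "0 \<le> z" "z < real CARD('p) powi int K" for z
  proof -
    have "real CARD('p) powi (- int K) * z < real CARD('p) powi (- int K) * real CARD('p) powi int K"
      using that by (intro mult_strict_left_mono) auto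
    also have "\<dots> = 1"
      by (rule card_powi_cancel)
    finally show ?thesis
      using that by (simp add: floor_eq_iff less_imp_le)
  qed
  have base: "\<lfloor>real CARD('p) powi (- int K) * x\<rfloor> = \<lfloor>real CARD('p) powi (- int K) * y\<rfloor>"
    using floor_0 assms K by auto
  have "i \<le> m \<longrightarrow> \<lfloor>real CARD('p) powi i * x\<rfloor> = \<lfloor>real CARD('p) powi i * y\<rfloor>" if "- int K \<le> i" for i
    using that
  proof (induction i rule: int_ge_induct)
    case base
    then show ?case using \<open>\<lfloor>_\<rfloor> = \<lfloor>_\<rfloor>\<close> by simp
  next
    case (step i)
    show ?case
    proof
      assume im: "i + 1 \<le> m"
      then have eq: "\<lfloor>real CARD('p) powi i * x\<rfloor> = \<lfloor>real CARD('p) powi i * y\<rfloor>"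
        using step by simp
      let ?e = "base_digit CARD('p) i x - base_digit CARD('p) i y"
      have "real CARD('p) powi (- m) \<le> real CARD('p) powi (- (i + 1))"
        using im by simp
      then have "padic_norm (monna x - monna y :: 'p padic) \<le> real CARD('p) powi (- (i + 1))"
        using close by linarith
      from padic_norm_diff_le[OF this monna_diff[OF assms eq]]
      have "padic_norm (of_int ?e * ppow i :: 'p padic) \<le> real CARD('p) powi (- (i + 1))"
        by simp
      also have "\<dots> = real CARD('p) powi (- 1) * real CARD('p) powi (- i)"
        by (subst card_powi_add[symmetric]) (simp add: add.commute)
      finally have "padic_norm (of_int ?e * ppow i :: 'p padic) \<le> real CARD('p) powi (- 1) * real CARD('p) powi (- i)" .
      then have "padic_norm (of_int ?e :: 'p padic) \<le> real CARD('p) powi (- int 1)"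
        unfolding padic_norm_mult padic_norm_ppow by (simp only: mult_le_cancel_right) simp
      then have "int CARD('p) dvd ?e"
        unfolding padic_norm_of_int_le_iff by simp
      then have "base_digit CARD('p) i x mod int CARD('p) = base_digit CARD('p) i y mod int CARD('p)"
        by (simp add: mod_eq_dvd_iff)
      then have "base_digit CARD('p) i x = base_digit CARD('p) i y"
        by (simp add: base_digit_def)
      with eq show "\<lfloor>real CARD('p) powi (i + 1) * x\<rfloor> = \<lfloor>real CARD('p) powi (i + 1) * y\<rfloor>"
        by (rule floor_powi_Suc)
    qed
  qed
  then show "\<lfloor>real CARD('p) powi m * x\<rfloor> = \<lfloor>real CARD('p) powi m * y\<rfloor>"
    using floor_powi_mono[OF base, of m] by (cases "- int K \<le> m") auto
qed

lemma monna_0: "(monna 0 :: 'p::prime_card padic) = 0"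
proof -
  have "monna_sum CARD('p) 0 = (\<lambda>_. 0)"
    by (simp add: monna_sum_def base_digit_def fun_eq_iff)
  then show ?thesis
    by (simp add: monna_def zero_padic.abs_eq)
qed

text \<open>
  Pigeonhole principle: the \<open>p ^ (m + N)\<close> intervals of length \<open>p ^ (- m)\<close> in \<open>[0, p ^ N)\<close> go to distinct
  cosets of the ball of radius \<open>p ^ (- m)\<close> in the ball of radius \<open>p ^ N\<close>, hence to all of them.
\<close>

lemma monna_hits_pball:
  fixes c :: "'p::prime_card padic"
  shows "\<exists>y\<ge>0. monna y \<in> pball c (- m)"
proof -
  obtain n0 where n0: "c \<in> pball 0 (int n0)"
    using in_pball_0_large by blast
  define N where "N = max (int n0) (- m)"
  have N: "m + N \<ge> 0" "int n0 \<le> N"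
    by (auto simp: N_def)
  have cN: "padic_norm c \<le> real CARD('p) powi N"
    using n0 pball_mono[OF N(2), of "0 :: 'p padic"] pball_0_iff by blast
  define P where "P = CARD('p) ^ nat (m + N)"
  define y where "y k = real k * real CARD('p) powi (- m)" for k :: nat
  have y0: "y k \<ge> 0" for k
    by (simp add: y_def less_imp_le)
  have floor_y: "\<lfloor>real CARD('p) powi m * y k\<rfloor> = int k" for k
  proof -
    have "real CARD('p) powi m * y k = real k * (real CARD('p) powi m * real CARD('p) powi (- m))"
      by (simp add: y_def)
    also have "\<dots> = real k"
      by (simp flip: card_powi_add)
    finally show ?thesis
      by simp
  qed
  have yN: "padic_norm (monna (y k) :: 'p padic) \<le> real CARD('p) powi N" if "k < P" for k
  proof -
    have "real CARD('p) powi (- N) * y k = real k * real CARD('p) powi (- (m + N))"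
      using card_powi_add[of "- N" "- m", where 'p='p] by (simp add: y_def add.commute)
    also have "\<dots> < real P * real CARD('p) powi (- (m + N))"
      using that by (intro mult_strict_right_mono) auto
    also have "\<dots> = 1"
      unfolding P_def card_powi_nat[OF N(1), symmetric] by (simp flip: card_powi_add)
    finally have "\<lfloor>real CARD('p) powi (- N) * y k\<rfloor> = 0"
      using y0[of k] by (simp add: floor_eq_iff less_imp_le)
    then show ?thesis
      using monna_close_iff[of "y k" 0 "- N", where 'p='p] y0 by (simp add: monna_0)
  qed
  have "\<exists>l<P. padic_norm (monna (y k) - grid N (int l) :: 'p padic) \<le> real CARD('p) powi (- m)"
    if "k < P" for k
    using grid_approx[OF yN[OF that] N(1)] unfolding P_def by blast
  then obtain g where g: "\<And>k. k < P \<Longrightarrow> g k < P"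
    "\<And>k. k < P \<Longrightarrow> padic_norm (monna (y k) - grid N (int (g k)) :: 'p padic) \<le> real CARD('p) powi (- m)"
    by metis
  have "inj_on g {..<P}"
  proof (rule inj_onI)
    fix k l assume kl: "k \<in> {..<P}" "l \<in> {..<P}" "g k = g l"
    then have "padic_norm (monna (y k) - monna (y l) :: 'p padic) \<le> real CARD('p) powi (- m)"
      using g(2)[of k] g(2)[of l] padic_norm_trans padic_norm_diff_commute by (metis lessThan_iff)
    then show "k = l"
      using y0 floor_y by (simp add: monna_close_iff)
  qed
  then have surj: "g ` {..<P} = {..<P}"
    using g(1) by (intro endo_inj_surj) auto
  obtain l where l: "l < P" "padic_norm (c - grid N (int l)) \<le> real CARD('p) powi (- m)"
    using grid_approx[OF cN N(1)] unfolding P_def by blast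
  then obtain k where k: "k < P" "g k = l"
    using surj by (metis imageE lessThan_iff)
  then have "padic_norm (monna (y k) - c) \<le> real CARD('p) powi (- m)"
    using g(2)[of k] l padic_norm_trans padic_norm_diff_commute by metis
  then show ?thesis
    using y0 by (auto simp: pball_def)
qed

lemma monna_vimage_pball:
  fixes c :: "'p::prime_card padic"
  obtains k :: int where "monna -` pball c (- m) \<inter> {0..} =
      {real_of_int k * real CARD('p) powi (- m)..<(real_of_int k + 1) * real CARD('p) powi (- m)}"
proof -
  obtain y where y: "y \<ge> 0" "monna y \<in> pball c (- m)"
    using monna_hits_pball by blast
  define k where "k = \<lfloor>real CARD('p) powi m * y\<rfloor>"
  have k0: "k \<ge> 0"
    using y by (simp add: k_def less_imp_le)
  have inv: "real CARD('p) powi (- m) = 1 / real CARD('p) powi m"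
    by (simp add: power_int_minus divide_inverse)
  have "monna x \<in> pball c (- m) \<and> 0 \<le> x \<longleftrightarrow>
      real_of_int k * real CARD('p) powi (- m) \<le> x \<and> x < (real_of_int k + 1) * real CARD('p) powi (- m)" for x
  proof (cases "0 \<le> x")
    case True
    have "pball c (- m) = pball (monna y) (- m)"
      using pball_recentre[OF y(2)] by simp
    then have "monna x \<in> pball c (- m) \<longleftrightarrow> \<lfloor>real CARD('p) powi m * x\<rfloor> = k"
      using monna_close_iff[OF True y(1), of m, where 'p='p] by (simp add: pball_def k_def)
    also have "\<dots> \<longleftrightarrow> real_of_int k * real CARD('p) powi (- m) \<le> x \<and> x < (real_of_int k + 1) * real CARD('p) powi (- m)"
      unfolding inv floor_eq_iff by (simp add: field_simps)
    finally show ?thesis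
      using True by simp
  next
    case False
    have "0 \<le> real_of_int k * real CARD('p) powi (- m)"
      using k0 by (simp add: less_imp_le)
    then show ?thesis
      using False by linarith
  qed
  then have "monna -` pball c (- m) \<inter> {0..} =
      {real_of_int k * real CARD('p) powi (- m)..<(real_of_int k + 1) * real CARD('p) powi (- m)}"
    by - (rule Set.set_eqI, simp only: Int_iff vimage_eq atLeast_iff atLeastLessThan_iff)
  then show ?thesis
    by (rule that)
qed

text \<open>
  The preimage of a ball under the Monna map is an interval whose length is the radius, so the map carries
  Lebesgue measure to a measure with the ball values of Haar measure.
\<close>

lemma is_padic_haar_distr_monna:
  "is_padic_haar (distr (restrict_space lborel {0..}) borel (monna :: real \<Rightarrow> 'p::prime_card padic))"
proof (rule is_padic_haarI)
  let ?M = "restrict_space lborel {0::real..}"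
  have space: "space ?M = {0..}"
    by (simp add: space_restrict_space)
  have ivl: "{a..<b} \<in> sets ?M" if "{a..<b} \<subseteq> {0..}" for a b :: real
    using that by (subst sets_restrict_space_iff) auto
  have vim: "monna -` pball c j \<inter> space ?M \<in> sets ?M" for c :: "'p padic" and j
  proof -
    obtain k :: int where k: "monna -` pball c (- (- j)) \<inter> {0..} =
      {real_of_int k * real CARD('p) powi (- (- j))..<(real_of_int k + 1) * real CARD('p) powi (- (- j))}"
      by (rule monna_vimage_pball)
    then have "\<dots> \<subseteq> {0..}"
      by blast
    then show ?thesis
      using k ivl space by simp
  qed
  have meas: "(monna :: real \<Rightarrow> 'p padic) \<in> measurable ?M borel"
  proof (rule measurable_sigma_sets[OF sets_borel_padic])
    show "monna -` B \<inter> space ?M \<in> sets ?M" if "B \<in> (padic_balls :: 'p padic set set)" for B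
      using that vim by (auto simp: padic_balls_def)
  qed auto
  show "emeasure (distr ?M borel monna) (pball c j) = ennreal (real CARD('p) powi j)" for c :: "'p padic" and j
  proof -
    obtain k :: int where k: "monna -` pball c (- (- j)) \<inter> {0..} =
      {real_of_int k * real CARD('p) powi (- (- j))..<(real_of_int k + 1) * real CARD('p) powi (- (- j))}"
      by (rule monna_vimage_pball)
    have "emeasure (distr ?M borel monna) (pball c j) = emeasure ?M (monna -` pball c j \<inter> {0..})"
      using emeasure_distr[OF meas pball_borel, of c j] by (simp add: space)
    also have "\<dots> = emeasure lborel (monna -` pball c j \<inter> {0..})"
      by (intro emeasure_restrict_space) auto
    also have "\<dots> = ennreal ((real_of_int k + 1) * real CARD('p) powi j - real_of_int k * real CARD('p) powi j)"
      using k by (simp add: algebra_simps less_imp_le)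
    finally show ?thesis
      by (simp add: algebra_simps)
  qed
qed simp

lemma is_padic_haar_padic_haar: "is_padic_haar (padic_haar :: 'p::prime_card padic measure)"
  unfolding padic_haar_def
  by (rule theI[of is_padic_haar, OF is_padic_haar_distr_monna is_padic_haar_unique[OF _ is_padic_haar_distr_monna]])

lemma sets_padic_haar [simp, measurable_cong]: "sets (padic_haar :: 'p::prime_card padic measure) = sets borel"
  using is_padic_haar_padic_haar[where 'p='p] by (simp add: is_padic_haar_def)

lemma space_padic_haar [simp]: "space (padic_haar :: 'p::prime_card padic measure) = UNIV"
  using sets_eq_imp_space_eq[OF sets_padic_haar[where 'p='p]] by simp

lemma emeasure_padic_haar_pball [simp]:
  "emeasure padic_haar (pball (c :: 'p::prime_card padic) j) = ennreal (real CARD('p) powi j)"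
  by (rule emeasure_pball[OF is_padic_haar_padic_haar])

lemma measure_padic_haar_pball [simp]:
  "measure padic_haar (pball (c :: 'p::prime_card padic) j) = real CARD('p) powi j"
  by (simp add: measure_def less_imp_le)

section \<open>Step functions\<close>

text \<open>
  Periodicity is stated as invariance under a whole ball, the form in which local constancy is used.
\<close>

definition step_fun :: "int \<Rightarrow> int \<Rightarrow> ('p::prime_card padic \<Rightarrow> 'b::zero) \<Rightarrow> bool" where
  "step_fun M N f \<longleftrightarrow> (\<forall>x y. padic_norm (y - x) \<le> real CARD('p) powi (- M) \<longrightarrow> f y = f x)
    \<and> (\<forall>x. x \<notin> pball 0 N \<longrightarrow> f x = 0)"

lemma step_funD:
  "step_fun M N (f :: 'p::prime_card padic \<Rightarrow> 'b::zero) \<Longrightarrow> padic_norm (y - x) \<le> real CARD('p) powi (- M) \<Longrightarrow> f y = f x"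
  "step_fun M N f \<Longrightarrow> x \<notin> pball 0 N \<Longrightarrow> f x = 0"
  unfolding step_fun_def by blast+

lemma step_fun_mono: "step_fun M N f \<Longrightarrow> M \<le> M' \<Longrightarrow> N \<le> N' \<Longrightarrow> step_fun M' N' f"
  for f :: "'p::prime_card padic \<Rightarrow> 'b::zero"
proof -
  assume f: "step_fun M N f" and MN: "M \<le> M'" "N \<le> N'"
  have "real CARD('p) powi (- M') \<le> real CARD('p) powi (- M)"
    using MN by simp
  then show ?thesis
    using f pball_mono[OF MN(2), of "0 :: 'p padic"] unfolding step_fun_def
    by (meson order_trans subsetD)
qed

lemma step_fun_comp: "step_fun M N f \<Longrightarrow> h 0 = 0 \<Longrightarrow> step_fun M N (\<lambda>x. h (f x))"
  unfolding step_fun_def by metis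

lemma step_fun_comp2: "step_fun M N f \<Longrightarrow> step_fun M N g \<Longrightarrow> h 0 0 = 0 \<Longrightarrow> step_fun M N (\<lambda>x. h (f x) (g x))"
  unfolding step_fun_def by metis

lemma step_fun_sum:
  "(\<And>i. i \<in> A \<Longrightarrow> step_fun M N (f i)) \<Longrightarrow> step_fun M N (\<lambda>x. \<Sum>i\<in>A. f i x :: complex)"
  by (induction A rule: infinite_finite_induct)
    (auto intro!: step_fun_comp2[where h="(+)"] simp: step_fun_def)

lemma step_fun_eqI:
  fixes f g :: "'p::prime_card padic \<Rightarrow> 'b::zero"
  assumes "step_fun M N f" "step_fun M N g" "M + N \<ge> 0"
    and eq: "\<And>k. k < CARD('p) ^ nat (M + N) \<Longrightarrow> f (grid N (int k)) = g (grid N (int k))"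
  shows "f = g"
proof
  fix x
  show "f x = g x"
  proof (cases "x \<in> pball 0 N")
    case True
    then obtain k where k: "k < CARD('p) ^ nat (M + N)"
      "padic_norm (x - grid N (int k)) \<le> real CARD('p) powi (- M)"
      using grid_approx[of x N M] assms(3) unfolding pball_0_iff by blast
    then show ?thesis
      using eq step_funD(1)[OF assms(1) k(2)] step_funD(1)[OF assms(2) k(2)] by simp
  qed (use assms in \<open>auto simp: step_funD\<close>)
qed

text \<open>
  The balls around the grid points partition the ball of radius \<open>p ^ N\<close>, so only one summand is nonzero at each point.
\<close>

lemma step_fun_expand:
  fixes f :: "'p::prime_card padic \<Rightarrow> 'b::real_vector"
  assumes f: "step_fun M N f" and MN: "M + N \<ge> 0"
  shows "f x = (\<Sum>k<CARD('p) ^ nat (M + N). indicat_real (pball (grid N (int k)) (- M)) x *\<^sub>R f (grid N (int k)))"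
proof (cases "x \<in> pball 0 N")
  case True
  then obtain l where l: "l < CARD('p) ^ nat (M + N)"
    "padic_norm (x - grid N (int l)) \<le> real CARD('p) powi (- M)"
    using grid_approx[of x N M] MN unfolding pball_0_iff by blast
  have "indicat_real (pball (grid N (int k)) (- M)) x = (if k = l then 1 else 0)"
    if "k < CARD('p) ^ nat (M + N)" for k
  proof -
    have xl: "x \<in> pball (grid N (int l)) (- M)"
      using l by (simp add: pball_def)
    have "x \<notin> pball (grid N (int k)) (- M)" if "k \<noteq> l"
      using disjoint_grid_pballs[OF MN, where 'p='p] \<open>k < _\<close> l(1) xl that
      unfolding disjoint_family_on_def by blast
    then show ?thesis
      using xl by (auto simp: indicator_def)
  qed
  then have "(\<Sum>k<CARD('p) ^ nat (M + N). indicat_real (pball (grid N (int k)) (- M)) x *\<^sub>R f (grid N (int k)))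
      = (\<Sum>k<CARD('p) ^ nat (M + N). if k = l then f (grid N (int k)) else 0)"
    by (intro sum.cong) auto
  also have "\<dots> = f x"
    using l step_funD(1)[OF f l(2)] by simp
  finally show ?thesis
    by simp
next
  case False
  have "indicat_real (pball (grid N (int k)) (- M)) x = 0" if "k < CARD('p) ^ nat (M + N)" for k
    using False that unfolding pball_0_grid_Union[OF MN] by (auto simp: indicator_def)
  then show ?thesis
    using False step_funD(2)[OF f] by simp
qed

lemma has_bochner_integral_step_fun:
  fixes f :: "'p::prime_card padic \<Rightarrow> 'b::{banach, second_countable_topology}"
  assumes f: "step_fun M N f" and MN: "M + N \<ge> 0"
  shows "has_bochner_integral padic_haar f
    (\<Sum>k<CARD('p) ^ nat (M + N). real CARD('p) powi (- M) *\<^sub>R f (grid N (int k)))"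
proof -
  have ball: "has_bochner_integral padic_haar
      (\<lambda>x. indicat_real (pball c j) x *\<^sub>R v) (real CARD('p) powi j *\<^sub>R v)"
    for c :: "'p padic" and j and v :: 'b
    using has_bochner_integral_indicator[of "pball c j" padic_haar v] by simp
  have "has_bochner_integral padic_haar
      (\<lambda>x :: 'p padic. \<Sum>k<CARD('p) ^ nat (M + N). indicat_real (pball (grid N (int k)) (- M)) x *\<^sub>R f (grid N (int k)))
      (\<Sum>k<CARD('p) ^ nat (M + N). real CARD('p) powi (- M) *\<^sub>R f (grid N (int k)))"
    by (rule has_bochner_integral_sum) (rule ball)
  then show ?thesis
    by (simp only: step_fun_expand[OF f MN, symmetric])
qed

lemma integral_step_fun:
  fixes f :: "'p::prime_card padic \<Rightarrow> complex"
  assumes f: "step_fun M N f" and MN: "M + N \<ge> 0"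
  shows "(\<integral>x. f x \<partial>padic_haar) =
    of_real (real CARD('p) powi (- M)) * (\<Sum>k<CARD('p) ^ nat (M + N). f (grid N (int k)))"
  using has_bochner_integral_integral_eq[OF has_bochner_integral_step_fun[OF assms]]
  by (simp only: scaleR_conv_of_real sum_distrib_left)

section \<open>Square integrable functions\<close>

definition L2_sq :: "('p::prime_card padic \<Rightarrow> complex) \<Rightarrow> real" where
  "L2_sq f = (\<integral>x. (cmod (f x))\<^sup>2 \<partial>padic_haar)"

lemma L2_sq_nonneg [simp]: "0 \<le> L2_sq f"
  by (simp add: L2_sq_def)

lemma L2_norm_eq: "L2_norm f = sqrt (L2_sq f)"
  by (simp add: L2_norm_def L2_sq_def)

lemma L2_sq_scale: "L2_sq (\<lambda>x. c * f x) = (cmod c)\<^sup>2 * L2_sq f"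
  by (simp add: L2_sq_def norm_mult power_mult_distrib)

lemma L2_sq_commute: "L2_sq (\<lambda>x. f x - g x) = L2_sq (\<lambda>x. g x - f x)"
  by (simp add: L2_sq_def norm_minus_commute)

lemma L2_measurable: "f \<in> L2 \<Longrightarrow> f \<in> borel_measurable padic_haar"
  by (simp add: L2_def)

lemma L2_integrable: "f \<in> L2 \<Longrightarrow> integrable padic_haar (\<lambda>x. (cmod (f x))\<^sup>2)"
  by (simp add: L2_def)

text \<open>
  Closures are insensitive to constant factors, so this pointwise bound takes the place of the triangle
  inequality for the norm.
\<close>

lemma cmod_add_sq_le: "(cmod (a + b))\<^sup>2 \<le> 2 * (cmod a)\<^sup>2 + 2 * (cmod b)\<^sup>2"
proof -
  have "(cmod (a + b))\<^sup>2 \<le> (cmod a + cmod b)\<^sup>2"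
    by (intro power_mono norm_triangle_ineq) simp
  also have "\<dots> \<le> 2 * (cmod a)\<^sup>2 + 2 * (cmod b)\<^sup>2"
    using sum_squares_bound[of "cmod a" "cmod b"] by (simp add: power2_sum)
  finally show ?thesis .
qed

lemma L2_add: "f \<in> L2 \<Longrightarrow> g \<in> L2 \<Longrightarrow> (\<lambda>x. f x + g x) \<in> L2"
proof -
  assume f: "f \<in> L2" and g: "g \<in> L2"
  have "integrable padic_haar (\<lambda>x. (cmod (f x + g x))\<^sup>2)"
  proof (rule Bochner_Integration.integrable_bound)
    show "integrable padic_haar (\<lambda>x. 2 * (cmod (f x))\<^sup>2 + 2 * (cmod (g x))\<^sup>2)"
      using f g by (simp add: L2_integrable)
    show "(\<lambda>x. (cmod (f x + g x))\<^sup>2) \<in> borel_measurable padic_haar"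
      using L2_measurable[OF f] L2_measurable[OF g] by measurable
    show "AE x in padic_haar. norm ((cmod (f x + g x))\<^sup>2) \<le> norm (2 * (cmod (f x))\<^sup>2 + 2 * (cmod (g x))\<^sup>2)"
      using cmod_add_sq_le by simp
  qed
  then show ?thesis
    using f g by (simp add: L2_def borel_measurable_add)
qed

lemma L2_sq_add_le: "f \<in> L2 \<Longrightarrow> g \<in> L2 \<Longrightarrow> L2_sq (\<lambda>x. f x + g x) \<le> 2 * L2_sq f + 2 * L2_sq g"
proof -
  assume f: "f \<in> L2" and g: "g \<in> L2"
  have "L2_sq (\<lambda>x. f x + g x) \<le> (\<integral>x. 2 * (cmod (f x))\<^sup>2 + 2 * (cmod (g x))\<^sup>2 \<partial>padic_haar)"
    unfolding L2_sq_def using f g L2_integrable[OF L2_add[OF f g]]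
    by (intro integral_mono cmod_add_sq_le) (auto simp: L2_integrable)
  also have "\<dots> = 2 * L2_sq f + 2 * L2_sq g"
    using f g by (simp add: L2_sq_def L2_integrable)
  finally show ?thesis .
qed

lemma L2_scale: "f \<in> L2 \<Longrightarrow> (\<lambda>x. c * f x) \<in> L2"
  unfolding L2_def by (auto simp: norm_mult power_mult_distrib)

lemma L2_0: "(\<lambda>_. 0) \<in> L2"
  by (simp add: L2_def)

lemma L2_diff: "f \<in> L2 \<Longrightarrow> g \<in> L2 \<Longrightarrow> (\<lambda>x. f x - g x) \<in> L2"
  using L2_add[of f "\<lambda>x. - 1 * g x"] L2_scale[of g "- 1"] by simp

lemma L2_sq_triangle:
  assumes "f \<in> L2" "g \<in> L2" "h \<in> L2"
  shows "L2_sq (\<lambda>x. f x - h x) \<le> 2 * L2_sq (\<lambda>x. f x - g x) + 2 * L2_sq (\<lambda>x. g x - h x)"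
  using L2_sq_add_le[OF L2_diff[OF assms(1,2)] L2_diff[OF assms(2,3)]] by simp

lemma subspace_L2: "cfun.subspace (L2 :: ('p::prime_card padic \<Rightarrow> complex) set)"
  unfolding cfun.subspace_def
  by (auto simp: plus_fun_def zero_fun_def intro: L2_add L2_scale L2_0)

lemma step_fun_L2:
  fixes f :: "'p::prime_card padic \<Rightarrow> complex"
  assumes f: "step_fun M N f" and MN: "M + N \<ge> 0"
  shows "f \<in> L2"
    and "L2_sq f = real CARD('p) powi (- M) * (\<Sum>k<CARD('p) ^ nat (M + N). (cmod (f (grid N (int k))))\<^sup>2)"
proof -
  have sq: "step_fun M N (\<lambda>x. (cmod (f x))\<^sup>2)"
    using f by (rule step_fun_comp) simp
  show "f \<in> L2"
    unfolding L2_def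
    using has_bochner_integral_step_fun[OF f MN] has_bochner_integral_step_fun[OF sq MN]
    by (auto simp: has_bochner_integral_iff)
  show "L2_sq f = real CARD('p) powi (- M) * (\<Sum>k<CARD('p) ^ nat (M + N). (cmod (f (grid N (int k))))\<^sup>2)"
    unfolding L2_sq_def using has_bochner_integral_integral_eq[OF has_bochner_integral_step_fun[OF sq MN]]
    by (simp add: sum_distrib_left)
qed

text \<open>
  A value of a step function is attained on a whole ball of radius \<open>p ^ (- M)\<close>, so the mass of that ball controls it.
\<close>

lemma step_fun_pointwise_le:
  fixes f :: "'p::prime_card padic \<Rightarrow> complex"
  assumes f: "step_fun M N f" and MN: "M + N \<ge> 0"
  shows "real CARD('p) powi (- M) * (cmod (f x))\<^sup>2 \<le> L2_sq f"
proof (cases "x \<in> pball 0 N")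
  case True
  then obtain k where k: "k < CARD('p) ^ nat (M + N)"
    "padic_norm (x - grid N (int k)) \<le> real CARD('p) powi (- M)"
    using grid_approx[of x N M] MN unfolding pball_0_iff by blast
  have "(cmod (f x))\<^sup>2 \<le> (\<Sum>k<CARD('p) ^ nat (M + N). (cmod (f (grid N (int k))))\<^sup>2)"
    unfolding step_funD(1)[OF f k(2)] using k(1) by (intro member_le_sum) auto
  then show ?thesis
    unfolding step_fun_L2(2)[OF assms] by (intro mult_left_mono) (auto simp: less_imp_le)
qed (use f in \<open>auto simp: step_funD(2)\<close>)

lemma L2_restrict:
  fixes f :: "'p::prime_card padic \<Rightarrow> complex"
  assumes f: "f \<in> L2" and B: "B \<in> sets borel"
  shows "(\<lambda>x. indicator B x * f x) \<in> L2" "L2_sq (\<lambda>x. indicator B x * f x) \<le> L2_sq f"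
proof -
  have le: "(cmod (indicator B x * f x))\<^sup>2 \<le> (cmod (f x))\<^sup>2" for x
    by (simp add: indicator_def)
  have meas: "(\<lambda>x. indicator B x * f x) \<in> borel_measurable padic_haar"
    using L2_measurable[OF f] B by measurable
  have int: "integrable padic_haar (\<lambda>x. (cmod (indicator B x * f x))\<^sup>2)"
    using meas le by (intro Bochner_Integration.integrable_bound[OF L2_integrable[OF f]]) auto
  show "(\<lambda>x. indicator B x * f x) \<in> L2"
    using meas int by (simp add: L2_def)
  show "L2_sq (\<lambda>x. indicator B x * f x) \<le> L2_sq f"
    unfolding L2_sq_def by (intro integral_mono int L2_integrable f le)
qed

subsection \<open>Affine changes of variable\<close>

lemma borel_measurable_affine: "(\<lambda>x :: 'p::prime_card padic. ppow j * x - a) \<in> borel \<rightarrow>\<^sub>M borel"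
proof (rule borel_measurable_continuous_onI, unfold continuous_on_iff, intro ballI allI impI)
  fix x :: "'p padic" and e :: real assume e: "0 < e"
  have "dist (ppow j * y - a) (ppow j * x - a) < e" if "dist y x < e * real CARD('p) powi j" for y
  proof -
    have "dist (ppow j * y - a) (ppow j * x - a) = padic_norm (ppow j * (y - x))"
      by (simp add: dist_padic_def right_diff_distrib)
    also have "\<dots> = real CARD('p) powi (- j) * dist y x"
      by (simp add: padic_norm_mult dist_padic_def)
    also have "\<dots> < real CARD('p) powi (- j) * (e * real CARD('p) powi j)"
      using that by (intro mult_strict_left_mono) auto
    also have "\<dots> = e"
      using card_powi_cancel[of j, where 'p='p] by simp
    finally show ?thesis .
  qed
  then show "\<exists>d>0. \<forall>y\<in>UNIV. dist y x < d \<longrightarrow> dist (ppow j * y - a) (ppow j * x - a) < e"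
    using e by (intro exI[of _ "e * real CARD('p) powi j"]) auto
qed

lemma padic_haar_measurable_affine:
  "(\<lambda>x :: 'p::prime_card padic. ppow j * x - a) \<in> padic_haar \<rightarrow>\<^sub>M borel"
  using borel_measurable_affine[of j a] measurable_cong_sets[OF sets_padic_haar refl] by blast

lemma affine_pball_iff:
  "ppow j * x - a \<in> pball c i \<longleftrightarrow> x \<in> pball ((c + a) * ppow (- j)) (i + j :: int)"
  for x :: "'p::prime_card padic"
proof -
  have "ppow j * x - a - c = ppow j * (x - (c + a) * ppow (- j))"
    by (simp add: algebra_simps flip: ppow_add mult.assoc) 
  then have "padic_norm (ppow j * x - a - c) = real CARD('p) powi (- j) * padic_norm (x - (c + a) * ppow (- j))"
    by (simp only: padic_norm_mult padic_norm_ppow)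
  moreover have "real CARD('p) powi i = real CARD('p) powi (- j) * real CARD('p) powi (i + j)"
    by (subst card_powi_add[symmetric]) simp
  ultimately show ?thesis
    by (simp only: pball_def mem_Collect_eq mult_le_cancel_left_pos card_powi_pos)
qed

text \<open>
  The preimage of a ball under \<open>x \<mapsto> p\<^sup>j x - a\<close> is a ball whose radius is larger by the factor \<open>p\<^sup>j\<close>, so the pushforward is a
  multiple of Haar measure.
\<close>

lemma distr_affine_padic_haar:
  "distr padic_haar borel (\<lambda>x :: 'p::prime_card padic. ppow j * x - a) =
    density padic_haar (\<lambda>_. ennreal (real CARD('p) powi j))"
proof (rule measure_eqI_pballs)
  fix c :: "'p padic" and i
  have "(\<lambda>x. ppow j * x - a) -` pball c i = pball ((c + a) * ppow (- j)) (i + j)"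
    by (auto simp only: vimage_eq affine_pball_iff)
  then have "emeasure (distr padic_haar borel (\<lambda>x. ppow j * x - a)) (pball c i) = ennreal (real CARD('p) powi (i + j))"
    using padic_haar_measurable_affine[of j a] by (subst emeasure_distr) auto
  then show "emeasure (distr padic_haar borel (\<lambda>x. ppow j * x - a)) (pball c i) =
      emeasure (density padic_haar (\<lambda>_. ennreal (real CARD('p) powi j))) (pball c i)"
    by (simp add: emeasure_density_const card_powi_add ennreal_mult less_imp_le mult.commute)
next
  fix i
  have "(\<lambda>x. ppow j * x - a) -` pball 0 i = pball ((0 + a) * ppow (- j)) (i + j)"
    by (auto simp only: vimage_eq affine_pball_iff)
  then show "emeasure (distr padic_haar borel (\<lambda>x. ppow j * x - a)) (pball 0 i) \<noteq> \<infinity>"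
    using padic_haar_measurable_affine[of j a] by (subst emeasure_distr) auto
qed simp_all

lemma
  fixes f :: "'p::prime_card padic \<Rightarrow> complex"
  assumes f: "f \<in> L2"
  shows L2_affine: "(\<lambda>x. f (ppow j * x - a)) \<in> L2"
    and L2_sq_affine: "L2_sq (\<lambda>x. f (ppow j * x - a)) = real CARD('p) powi j * L2_sq f"
proof -
  let ?T = "\<lambda>x :: 'p padic. ppow j * x - a"
  have T: "?T \<in> padic_haar \<rightarrow>\<^sub>M borel"
    by (rule padic_haar_measurable_affine)
  have fm: "f \<in> borel_measurable borel"
    using L2_measurable[OF f] by simp
  have sq: "(\<lambda>x. (cmod (f x))\<^sup>2) \<in> borel_measurable borel"
    using fm by measurable
  have c: "AE x in padic_haar. 0 \<le> real CARD('p) powi j"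
    by (simp add: less_imp_le)
  have "integrable (distr padic_haar borel ?T) (\<lambda>x. (cmod (f x))\<^sup>2)"
    unfolding distr_affine_padic_haar using L2_integrable[OF f] c sq
    by (subst integrable_density) auto
  then have "integrable padic_haar (\<lambda>x. (cmod (f (?T x)))\<^sup>2)"
    using integrable_distr_eq[OF T, of "\<lambda>x. (cmod (f x))\<^sup>2"] sq by simp
  moreover have "(\<lambda>x. f (?T x)) \<in> borel_measurable padic_haar"
    using measurable_compose[OF T fm] by simp
  ultimately show "(\<lambda>x. f (?T x)) \<in> L2"
    by (simp add: L2_def)
  have "L2_sq (\<lambda>x. f (?T x)) = (\<integral>x. (cmod (f x))\<^sup>2 \<partial>distr padic_haar borel ?T)"
    unfolding L2_sq_def using integral_distr[OF T, of "\<lambda>x. (cmod (f x))\<^sup>2"] sq by simp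
  also have "\<dots> = real CARD('p) powi j * L2_sq f"
    unfolding distr_affine_padic_haar L2_sq_def using c sq
    by (subst integral_density) auto
  finally show "L2_sq (\<lambda>x. f (?T x)) = real CARD('p) powi j * L2_sq f" .
qed

subsection \<open>Closures\<close>

lemma L2_closure_iff:
  "f \<in> L2_closure S \<longleftrightarrow> f \<in> L2 \<and> (\<forall>e>0. \<exists>g\<in>S \<inter> L2. L2_sq (\<lambda>x. f x - g x) < e)"
proof -
  have "(\<forall>e>0. \<exists>g\<in>S \<inter> L2. sqrt (L2_sq (\<lambda>x. f x - g x)) < e) \<longleftrightarrow>
      (\<forall>e>0. \<exists>g\<in>S \<inter> L2. L2_sq (\<lambda>x. f x - g x) < e)"
  proof (intro iffI allI impI)
    fix e :: real
    assume *: "\<forall>e>0. \<exists>g\<in>S \<inter> L2. sqrt (L2_sq (\<lambda>x. f x - g x)) < e" and "e > 0"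
    then obtain g where "g \<in> S \<inter> L2" "sqrt (L2_sq (\<lambda>x. f x - g x)) < sqrt e"
      by (meson real_sqrt_gt_zero)
    then show "\<exists>g\<in>S \<inter> L2. L2_sq (\<lambda>x. f x - g x) < e"
      by auto
  next
    fix e :: real
    assume *: "\<forall>e>0. \<exists>g\<in>S \<inter> L2. L2_sq (\<lambda>x. f x - g x) < e" and "e > 0"
    then have "e\<^sup>2 > 0"
      by simp
    with * obtain g where "g \<in> S \<inter> L2" "L2_sq (\<lambda>x. f x - g x) < e\<^sup>2"
      by blast
    then show "\<exists>g\<in>S \<inter> L2. sqrt (L2_sq (\<lambda>x. f x - g x)) < e"
      using \<open>e > 0\<close> by (intro bexI[of _ g] real_less_lsqrt) auto
  qed
  then show ?thesis
    unfolding L2_closure_def by (simp add: L2_norm_eq)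
qed

lemma L2_closureD: "f \<in> L2_closure S \<Longrightarrow> e > 0 \<Longrightarrow> \<exists>g\<in>S \<inter> L2. L2_sq (\<lambda>x. f x - g x) < e"
  by (simp add: L2_closure_iff)

lemma L2_closure_subset_L2: "L2_closure S \<subseteq> L2"
  by (auto simp: L2_closure_iff)

lemma L2_sq_zero [simp]: "L2_sq (\<lambda>_. 0) = 0"
  by (simp add: L2_sq_def)

lemma L2_closure_superset: "f \<in> S \<Longrightarrow> f \<in> L2 \<Longrightarrow> f \<in> L2_closure S"
  unfolding L2_closure_iff by (auto intro!: bexI[of _ f])

lemma L2_closure_minimal:
  assumes "S \<inter> L2 \<subseteq> L2_closure T"
  shows "L2_closure S \<subseteq> L2_closure T"
proof
  fix f assume f: "f \<in> L2_closure S"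
  show "f \<in> L2_closure T"
    unfolding L2_closure_iff
  proof (intro conjI allI impI)
    show fL: "f \<in> L2"
      using f L2_closure_subset_L2 by blast
    fix e :: real assume "e > 0"
    then have "e / 4 > 0"
      by simp
    from L2_closureD[OF f this] obtain g where g: "g \<in> S \<inter> L2" "L2_sq (\<lambda>x. f x - g x) < e / 4"
      by blast
    then have "g \<in> L2_closure T"
      using assms by blast
    from L2_closureD[OF this \<open>e / 4 > 0\<close>]
    obtain h where h: "h \<in> T \<inter> L2" "L2_sq (\<lambda>x. g x - h x) < e / 4"
      by blast
    have "L2_sq (\<lambda>x. f x - h x) < e"
      using L2_sq_triangle[OF fL, of g h] g h by simp
    then show "\<exists>h\<in>T \<inter> L2. L2_sq (\<lambda>x. f x - h x) < e"
      using h by blast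
  qed
qed

lemma L2_closure_idem: "L2_closure (L2_closure S) = L2_closure S"
proof
  show "L2_closure (L2_closure S) \<subseteq> L2_closure S"
    by (intro L2_closure_minimal) simp
  show "L2_closure S \<subseteq> L2_closure (L2_closure S)"
    using L2_closure_superset L2_closure_subset_L2 by blast
qed

lemma subspace_L2_closure:
  fixes S :: "('p::prime_card padic \<Rightarrow> complex) set"
  assumes S: "cfun.subspace S"
  shows "cfun.subspace (L2_closure S)"
  unfolding cfun.subspace_def
proof (intro conjI ballI allI)
  have "(\<lambda>_. 0) \<in> S"
    using cfun.subspace_0[OF S] by (simp add: zero_fun_def)
  then show "0 \<in> L2_closure S"
    using L2_closure_superset L2_0 by (simp add: zero_fun_def)
next
  fix f g assume f: "f \<in> L2_closure S" and g: "g \<in> L2_closure S"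
  have fgL: "f \<in> L2" "g \<in> L2"
    using f g L2_closure_subset_L2 by blast+
  show "f + g \<in> L2_closure S"
    unfolding L2_closure_iff
  proof (intro conjI allI impI)
    show "f + g \<in> L2"
      using L2_add[OF fgL] by (simp add: plus_fun_def)
    fix e :: real assume "e > 0"
    then have e: "e / 4 > 0"
      by simp
    obtain f' where f': "f' \<in> S \<inter> L2" "L2_sq (\<lambda>x. f x - f' x) < e / 4"
      using L2_closureD[OF f e] by blast
    obtain g' where g': "g' \<in> S \<inter> L2" "L2_sq (\<lambda>x. g x - g' x) < e / 4"
      using L2_closureD[OF g e] by blast
    have "L2_sq (\<lambda>x. (f x - f' x) + (g x - g' x)) < e"
      using L2_sq_add_le[OF L2_diff L2_diff, of f f' g g'] f' g' fgL by simp
    moreover have "(\<lambda>x. (f x - f' x) + (g x - g' x)) = (\<lambda>x. (f + g) x - (f' + g') x)"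
      by (simp add: fun_eq_iff)
    moreover have "f' + g' \<in> S \<inter> L2"
      using f' g' cfun.subspace_add[OF S] L2_add[of f' g'] by (auto simp: plus_fun_def)
    ultimately show "\<exists>h\<in>S \<inter> L2. L2_sq (\<lambda>x. (f + g) x - h x) < e"
      by metis
  qed
next
  fix c and f assume f: "f \<in> L2_closure S"
  show "(\<lambda>x. c * f x) \<in> L2_closure S"
    unfolding L2_closure_iff
  proof (intro conjI allI impI)
    show "(\<lambda>x. c * f x) \<in> L2"
      using f L2_closure_subset_L2 L2_scale by blast
    fix e :: real assume "e > 0"
    then have e: "e / ((cmod c)\<^sup>2 + 1) > 0"
      by (intro divide_pos_pos) (auto intro: add_nonneg_pos)
    obtain g where g: "g \<in> S \<inter> L2" "L2_sq (\<lambda>x. f x - g x) < e / ((cmod c)\<^sup>2 + 1)"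
      using L2_closureD[OF f e] by blast
    have "L2_sq (\<lambda>x. c * f x - c * g x) = (cmod c)\<^sup>2 * L2_sq (\<lambda>x. f x - g x)"
      by (simp flip: L2_sq_scale add: right_diff_distrib)
    also have "\<dots> \<le> ((cmod c)\<^sup>2 + 1) * L2_sq (\<lambda>x. f x - g x)"
      by (intro mult_right_mono) auto
    also have "\<dots> < ((cmod c)\<^sup>2 + 1) * (e / ((cmod c)\<^sup>2 + 1))"
      using g(2) by (intro mult_strict_left_mono) (auto intro: add_nonneg_pos)
    also have "\<dots> = e"
      by (simp add: add_nonneg_eq_0_iff)
    finally have "L2_sq (\<lambda>x. c * f x - c * g x) < e" .
    moreover have "(\<lambda>x. c * g x) \<in> S \<inter> L2"
      using g cfun.subspace_scale[OF S] L2_scale by blast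
    ultimately show "\<exists>h\<in>S \<inter> L2. L2_sq (\<lambda>x. c * f x - h x) < e"
      by (intro bexI[of _ "\<lambda>x. c * g x"])
  qed
qed

section \<open>Test functions are step functions\<close>

text \<open>
  Integer multiples of the period are dense in the ball of radius \<open>p ^ (- M)\<close>, so for a locally constant
  function one period yields invariance under the whole ball.
\<close>

lemma step_fun_test_functions_within:
  fixes \<phi> :: "'p::prime_card padic \<Rightarrow> complex"
  assumes "\<phi> \<in> test_functions_within M N"
  shows "step_fun M N \<phi>"
  unfolding step_fun_def
proof (intro conjI allI impI)
  have loc: "\<exists>U. open U \<and> x \<in> U \<and> \<phi> constant_on U" for x
    using assms by (auto simp: test_functions_within_def test_functions_def)
  have period: "\<phi> (x - ppow M) = \<phi> x" for x
    using assms by (simp add: test_functions_within_def ppow_def)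
  have multiple: "\<phi> (x + of_nat k * ppow M) = \<phi> x" for x k
  proof (induction k)
    case (Suc k)
    show ?case
      using period[of "x + of_nat (Suc k) * ppow M"] Suc by (simp add: algebra_simps)
  qed simp
  show "\<phi> y = \<phi> x" if close: "padic_norm (y - x) \<le> real CARD('p) powi (- M)" for x y
  proof -
    obtain U where U: "open U" "y \<in> U" "\<phi> constant_on U"
      using loc by blast
    then obtain e where e: "e > 0" "cball y e \<subseteq> U"
      by (meson open_contains_cball)
    obtain m0 where m0: "real CARD('p) powi (- int m0) < e"
      using exists_card_powi_less[OF e(1)] by blast
    define m where "m = max M (int m0)"
    have "real CARD('p) powi (- m) \<le> real CARD('p) powi (- int m0)"
      unfolding card_powi_le_iff by (simp add: m_def)
    then have me: "real CARD('p) powi (- m) < e"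
      using m0 by linarith
    have "m + - M \<ge> 0"
      by (simp add: m_def)
    from grid_approx[OF close this]
    obtain k where "padic_norm (y - x - grid (- M) (int k)) \<le> real CARD('p) powi (- m)"
      by blast
    then have "x + of_nat k * ppow M \<in> cball y e"
      using me by (simp add: grid_def dist_padic_def algebra_simps)
    then have "\<phi> (x + of_nat k * ppow M) = \<phi> y"
      using e(2) U(2,3) unfolding constant_on_def by (metis subsetD)
    then show ?thesis
      using multiple by simp
  qed
next
  fix x :: "'p padic" assume "x \<notin> pball 0 N"
  moreover have "closure {x. \<phi> x \<noteq> 0} \<subseteq> pball 0 N"
    using assms by (simp add: test_functions_within_def pball_cball)
  ultimately show "\<phi> x = 0"
    using closure_subset[of "{x. \<phi> x \<noteq> 0}"] by blast
qed

text \<open>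
  If \<open>f x \<noteq> 0\<close>, the point \<open>x + p\<^sup>M\<close> lies in the support as well, so the period has norm at most \<open>p ^ N\<close>.
\<close>

lemma step_fun_nonneg_order:
  fixes f :: "'p::prime_card padic \<Rightarrow> 'b::zero"
  assumes f: "step_fun M N f" and x: "f x \<noteq> 0"
  shows "M + N \<ge> 0"
proof (rule ccontr)
  assume neg: "\<not> M + N \<ge> 0"
  have "x \<in> pball 0 N"
    using step_funD(2)[OF f] x by blast
  have "f (x + ppow M) = f x"
    by (rule step_funD(1)[OF f]) simp
  then have "x + ppow M \<in> pball 0 N"
    using step_funD(2)[OF f] x by metis
  then have "padic_norm (x + ppow M - x) \<le> real CARD('p) powi N"
    using \<open>x \<in> pball 0 N\<close> unfolding pball_0_iff by (rule padic_norm_diff_le)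
  then have "- M \<le> N"
    by simp
  then show False
    using neg by simp
qed

section \<open>Shifts and characters\<close>

lemma sum_base_digits_lt:
  assumes "\<And>j. j < n \<Longrightarrow> a j < p"
  shows "(\<Sum>j<n. a j * p ^ j) < (p :: nat) ^ n"
  using assms
proof (induction n)
  case (Suc n)
  have "(\<Sum>j<Suc n. a j * p ^ j) < p ^ n + a n * p ^ n"
    using Suc by simp
  also have "\<dots> = Suc (a n) * p ^ n"
    by simp
  also have "\<dots> \<le> p * p ^ n"
    using Suc.prems[of n] by (intro mult_right_mono) auto
  finally show ?case
    by simp
qed simp

lemma exists_base_digits:
  assumes "k < (p :: nat) ^ n"
  shows "\<exists>a. (\<forall>j<n. a j < p) \<and> k = (\<Sum>j<n. a j * p ^ j)"
  using assms
proof (induction n arbitrary: k)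
  case (Suc n)
  then have "k div p < p ^ n" and p: "p > 0"
    by (auto simp: less_mult_imp_div_less mult.commute intro: Nat.gr0I)
  then obtain a where a: "\<forall>j<n. a j < p" "k div p = (\<Sum>j<n. a j * p ^ j)"
    using Suc.IH by blast
  have "k = k mod p + p * (k div p)"
    by simp
  also have "\<dots> = k mod p * p ^ 0 + (\<Sum>j<n. a j * p ^ Suc j)"
    unfolding a(2) by (simp add: sum_distrib_left mult_ac)
  also have "\<dots> = (\<Sum>j<Suc n. (case j of 0 \<Rightarrow> k mod p | Suc i \<Rightarrow> a i) * p ^ j)"
    by (subst sum.lessThan_Suc_shift) simp
  finally show ?case
    using a(1) p by (intro exI[of _ "\<lambda>j. case j of 0 \<Rightarrow> k mod p | Suc i \<Rightarrow> a i"]) (auto split: nat.split)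
qed simp

text \<open>
  The digit sums \<open>a\<^sub>0 + \<dots> + a\<^bsub>n-1\<^esub> p ^ (n - 1)\<close> are exactly the naturals below \<open>p ^ n\<close>.
\<close>

lemma shift_rats_eq: "shift_rats p = {of_nat k / of_nat p ^ n |k n. k < p ^ n}"
proof (intro equalityI subsetI)
  fix r assume "r \<in> shift_rats p"
  then obtain n a where a: "\<forall>j<n. a j < p" and r: "r = (\<Sum>j<n. of_nat (a j) * of_nat p ^ j) / of_nat p ^ n"
    unfolding shift_rats_def by blast
  have "r = of_nat (\<Sum>j<n. a j * p ^ j) / of_nat p ^ n"
    using r by simp
  moreover have "(\<Sum>j<n. a j * p ^ j) < p ^ n"
    using a by (intro sum_base_digits_lt) auto
  ultimately show "r \<in> {of_nat k / of_nat p ^ n |k n. k < p ^ n}"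
    by blast
next
  fix r :: rat assume "r \<in> {of_nat k / of_nat p ^ n |k n. k < p ^ n}"
  then obtain k n where k: "k < p ^ n" and r: "r = of_nat k / of_nat p ^ n"
    by blast
  obtain a where "\<forall>j<n. a j < p" "k = (\<Sum>j<n. a j * p ^ j)"
    using exists_base_digits[OF k] by blast
  then show "r \<in> shift_rats p"
    unfolding shift_rats_def r by (auto intro!: exI[of _ n] exI[of _ a])
qed

lemma of_rat_shift: "(of_rat (of_nat k / of_nat CARD('p) ^ n) :: 'p::prime_card padic) = grid (int n) (int k)"
  by (simp add: of_rat_divide of_rat_power grid_def ppow_minus ppow_nat) (simp add: field_simps)

lemma shifts_eq: "(shifts :: 'p::prime_card padic set) = {grid (int n) (int k) |k n. k < CARD('p) ^ n}"
  unfolding shifts_def shift_rats_eq by (auto simp flip: of_rat_shift) 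

lemma grid_in_shifts: "k < CARD('p) ^ n \<Longrightarrow> (grid (int n) (int k) :: 'p::prime_card padic) \<in> shifts"
  unfolding shifts_eq by blast

lemma grid_lift: "(grid N k :: 'p::prime_card padic) = grid (N + int d) (k * int CARD('p) ^ d)"
proof -
  have "(ppow (- N) :: 'p padic) = ppow (int d) * ppow (- (N + int d))"
    by (subst ppow_add[symmetric]) simp
  then show ?thesis
    by (simp add: grid_def ppow_nat)
qed

text \<open>
  Lifting to a common denominator shows that distinct shifts lie in distinct cosets of the unit ball.
\<close>

lemma shift_rat_unique:
  assumes "padic_norm (grid (int n) (int k) - grid (int m) (int l) :: 'p::prime_card padic) \<le> 1"
    and "k < CARD('p) ^ n" "l < CARD('p) ^ m"
  shows "(of_nat k / of_nat CARD('p) ^ n :: rat) = of_nat l / of_nat CARD('p) ^ m"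
proof -
  let ?P = "CARD('p)"
  have "grid (int n) (int k) = (grid (int (n + m)) (int (k * ?P ^ m)) :: 'p padic)"
    "grid (int m) (int l) = (grid (int (n + m)) (int (l * ?P ^ n)) :: 'p padic)"
    using grid_lift[of "int n" "int k" m, where 'p='p] grid_lift[of "int m" "int l" n, where 'p='p]
    by (simp_all add: add.commute)
  moreover have "k * ?P ^ m < ?P ^ nat (0 + int (n + m))" "l * ?P ^ n < ?P ^ nat (0 + int (n + m))"
    using assms(2,3) card_gt_1[where 'p='p] by (simp_all add: power_add nat_int_add)
  ultimately have "k * ?P ^ m = l * ?P ^ n"
    using assms(1) by (intro grid_eqI[of "int (n + m)" _ _ 0]) auto
  then have "(of_nat (k * ?P ^ m) :: rat) = of_nat (l * ?P ^ n)"
    by simp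
  then show ?thesis
    using card_gt_1[where 'p='p] by (simp add: field_simps)
qed

lemma padic_frac_eq:
  fixes x :: "'p::prime_card padic"
  assumes "padic_norm (x - grid (int n) (int k)) \<le> 1"
  shows "padic_frac x = of_nat (k mod CARD('p) ^ n) / of_nat CARD('p) ^ n"
proof -
  let ?P = "CARD('p)"
  have P: "k mod ?P ^ n < ?P ^ n"
    using card_gt_1[where 'p='p] by simp
  have "grid (int n) (int k) - grid (int n) (int (k mod ?P ^ n)) = (grid (int n) (int (k - k mod ?P ^ n)) :: 'p padic)"
    by (simp add: grid_diff of_nat_diff)
  moreover have "int ?P ^ nat (0 + int n) dvd int (k - k mod ?P ^ n)"
    by (metis add_0 dvd_minus_mod int_dvd_int_iff nat_int of_nat_power)
  ultimately have "padic_norm (grid (int n) (int k) - grid (int n) (int (k mod ?P ^ n)) :: 'p padic) \<le> 1"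
    using padic_norm_grid_le_iff[of 0 "int n" "int (k - k mod ?P ^ n)", where 'p='p] by simp
  with assms have close: "padic_norm (x - grid (int n) (int (k mod ?P ^ n))) \<le> 1"
    by (rule padic_norm_trans)
  show ?thesis
    unfolding padic_frac_def
  proof (rule the_equality)
    show "of_nat (k mod ?P ^ n) / of_nat ?P ^ n \<in> shift_rats ?P \<and>
        padic_norm (x - of_rat (of_nat (k mod ?P ^ n) / of_nat ?P ^ n)) \<le> 1"
      using close P unfolding of_rat_shift shift_rats_eq by blast
  next
    fix r assume r: "r \<in> shift_rats ?P \<and> padic_norm (x - of_rat r) \<le> 1"
    then obtain l m where l: "l < ?P ^ m" "r = of_nat l / of_nat ?P ^ m"
      unfolding shift_rats_eq by blast
    then have "padic_norm (x - grid (int m) (int l)) \<le> 1"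
      using r by (simp only: of_rat_shift)
    with padic_norm_trans'[OF this close] show "r = of_nat (k mod ?P ^ n) / of_nat ?P ^ n"
      unfolding l(2) using l(1) P by (intro shift_rat_unique) auto
  qed
qed

text \<open>
  The fractional part is \<open>k / p ^ n\<close> up to an integer, and the exponential does not see integers.
\<close>

lemma padic_char_eq:
  fixes x :: "'p::prime_card padic"
  assumes "padic_norm (x - grid (int n) (int k)) \<le> 1"
  shows "padic_char x = cis (2 * pi * real k / real (CARD('p) ^ n))"
proof -
  let ?Q = "CARD('p) ^ n"
  have Q: "real ?Q > 0"
    using card_gt_1[where 'p='p] by simp
  have "padic_char x = cis (2 * pi * real (k mod ?Q) / real ?Q)"
    unfolding padic_char_def padic_frac_eq[OF assms]
    by (simp add: of_rat_divide of_rat_power cis_conv_exp mult_ac)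
  also have "\<dots> = cis (2 * pi * real (k mod ?Q) / real ?Q) * cis (2 * pi * real (k div ?Q))"
    by (simp add: cis_multiple_2pi)
  also have "\<dots> = cis (2 * pi * real (k mod ?Q) / real ?Q + 2 * pi * real (k div ?Q))"
    by (rule cis_mult)
  also have "2 * pi * real r / real ?Q + 2 * pi * real q = 2 * pi * real (r + ?Q * q) / real ?Q" for r q
    using Q by (simp add: field_simps)
  finally show ?thesis
    by (simp only: mod_mult_div_eq)
qed

lemma padic_char_cong:
  fixes x y :: "'p::prime_card padic"
  assumes "padic_norm (x - y) \<le> 1"
  shows "padic_char x = padic_char y"
proof -
  obtain n where n: "y \<in> pball 0 (int n)"
    using in_pball_0_large by blast
  then obtain k where k: "padic_norm (y - grid (int n) (int k)) \<le> 1"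
    using grid_approx[of y "int n" 0] unfolding pball_0_iff by auto
  show ?thesis
    using padic_char_eq[OF k] padic_char_eq[OF padic_norm_trans[OF assms k]] by simp
qed

text \<open>On the grid the Fourier transform of a step function is a discrete Fourier transform.\<close>

lemma padic_fourier_step_fun:
  fixes f :: "'p::prime_card padic \<Rightarrow> complex"
  assumes f: "step_fun M N f" and MN: "M + N \<ge> 0"
  shows "padic_fourier f (of_nat l * ppow (- M)) =
    of_real (real CARD('p) powi (- M)) * (\<Sum>k<CARD('p) ^ nat (M + N).
      f (grid N (int k)) * cis (2 * pi * real l / real (CARD('p) ^ nat (M + N))) ^ k)"
proof -
  let ?\<xi> = "of_nat l * ppow (- M) :: 'p padic"
  let ?Q = "CARD('p) ^ nat (M + N)"
  have "padic_char (?\<xi> * y) = padic_char (?\<xi> * x)" if "padic_norm (y - x) \<le> real CARD('p) powi (- M)" for x y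
  proof (rule padic_char_cong)
    have "padic_norm (?\<xi> * y - ?\<xi> * x) = padic_norm (of_nat l :: 'p padic) * (real CARD('p) powi M * padic_norm (y - x))"
      by (simp add: padic_norm_mult flip: right_diff_distrib)
    also have "\<dots> \<le> 1 * (real CARD('p) powi M * real CARD('p) powi (- M))"
      using that padic_norm_nonneg by (intro mult_mono mult_left_mono padic_norm_of_nat_le_1) (auto simp: less_imp_le)
    finally show "padic_norm (?\<xi> * y - ?\<xi> * x) \<le> 1"
      by (simp add: card_powi_cancel)
  qed
  then have "step_fun M N (\<lambda>x. padic_char (?\<xi> * x) * f x)"
    using f unfolding step_fun_def by (metis mult_zero_right)
  then have "padic_fourier f ?\<xi> = of_real (real CARD('p) powi (- M)) *
      (\<Sum>k<?Q. padic_char (?\<xi> * grid N (int k)) * f (grid N (int k)))"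
    unfolding padic_fourier_def using MN by (rule integral_step_fun)
  also have "(\<Sum>k<?Q. padic_char (?\<xi> * grid N (int k)) * f (grid N (int k))) =
      (\<Sum>k<?Q. f (grid N (int k)) * cis (2 * pi * real l / real ?Q) ^ k)"
  proof (intro sum.cong refl)
    fix k
    have "(ppow (- M) * ppow (- N) :: 'p padic) = ppow (- int (nat (M + N)))"
      using MN by (simp flip: ppow_add)
    then have "?\<xi> * grid N (int k) = grid (int (nat (M + N))) (int (l * k))"
      by (simp add: grid_def mult_ac)
    then have "padic_char (?\<xi> * grid N (int k)) = cis (2 * pi * real (l * k) / real ?Q)"
      by (intro padic_char_eq) simp
    also have "\<dots> = cis (2 * pi * real l / real ?Q) ^ k"
      unfolding Complex.DeMoivre by (simp add: mult_ac)
    finally show "padic_char (?\<xi> * grid N (int k)) * f (grid N (int k)) =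
        f (grid N (int k)) * cis (2 * pi * real l / real ?Q) ^ k"
      by (simp add: mult.commute)
  qed
  finally show ?thesis .
qed

section \<open>Exact representation of local limits\<close>

text \<open>
  Subspaces of a finite-dimensional space are closed. The induction adds a point \<open>x\<close>: if some function of the
  subspace is \<open>1\<close> at \<open>x\<close>, a multiple of it removes the value at \<open>x\<close>, and what remains is approximated by functions of
  the subspace that vanish at \<open>x\<close>.
\<close>

lemma finite_approx_attained:
  fixes f :: "'x \<Rightarrow> complex"
  assumes "finite X" "cfun.subspace E"
    and "\<And>e. e > 0 \<Longrightarrow> \<exists>g\<in>E. \<forall>x\<in>X. cmod (f x - g x) < e"
  shows "\<exists>g\<in>E. \<forall>x\<in>X. g x = f x"
  using assms
proof (induction X arbitrary: E f rule: finite_induct)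
  case empty
  then show ?case
    using cfun.subspace_0 by auto
next
  case (insert x X)
  note E = insert.prems(1)
  show ?case
  proof (cases "\<exists>g\<in>E. g x \<noteq> 0")
    case False
    have fx: "f x = 0"
    proof (rule ccontr)
      assume "f x \<noteq> 0"
      then obtain g where "g \<in> E" "cmod (f x - g x) < cmod (f x)"
        using insert.prems(2)[of "cmod (f x)"] by auto
      moreover from this have "g x = 0"
        using False by blast
      ultimately show False
        by simp
    qed
    have "\<exists>g\<in>E. \<forall>x\<in>X. g x = f x"
      using insert.prems(2) by (intro insert.IH E) (meson insert_iff)
    then show ?thesis
      using False fx by auto
  next
    case True
    then obtain g1 where g1: "g1 \<in> E" "g1 x \<noteq> 0"
      by blast
    define g0 where "g0 = (\<lambda>y. inverse (g1 x) * g1 y)"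
    have g0: "g0 \<in> E" "g0 x = 1"
      using g1 cfun.subspace_scale[OF E] by (auto simp: g0_def)
    define E' where "E' = {g \<in> E. g x = 0}"
    have E': "cfun.subspace E'"
      using E unfolding cfun.subspace_def E'_def by auto
    have "\<exists>g\<in>E'. \<forall>y\<in>X. cmod (f y - f x * g0 y - g y) < e" if "e > 0" for e
    proof -
      define C where "C = 1 + (\<Sum>y\<in>X. cmod (g0 y))"
      have C: "C > 0" "\<And>y. y \<in> X \<Longrightarrow> 1 + cmod (g0 y) \<le> C"
        using insert.hyps(1) by (auto simp: C_def intro!: add_pos_nonneg sum_nonneg member_le_sum)
      obtain g where g: "g \<in> E" "\<And>y. y \<in> insert x X \<Longrightarrow> cmod (f y - g y) < e / C"
        using insert.prems(2)[of "e / C"] \<open>e > 0\<close> C by auto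
      have "cmod (f y - f x * g0 y - (g y - g x * g0 y)) < e" if "y \<in> X" for y
      proof -
        have eq: "f y - f x * g0 y - (g y - g x * g0 y) = (f y - g y) - (f x - g x) * g0 y"
          by (simp add: algebra_simps)
        have "cmod (f y - f x * g0 y - (g y - g x * g0 y)) \<le> cmod (f y - g y) + cmod (f x - g x) * cmod (g0 y)"
          unfolding eq using norm_triangle_ineq4[of "f y - g y" "(f x - g x) * g0 y"] by (simp add: norm_mult)
        also have "\<dots> < e / C + e / C * cmod (g0 y)"
          using g(2)[of y] g(2)[of x] that by (intro add_less_le_mono mult_right_mono) auto
        also have "\<dots> = e / C * (1 + cmod (g0 y))"
          by (simp add: distrib_left)
        also have "\<dots> \<le> e / C * C"
          using C \<open>e > 0\<close> that by (intro mult_left_mono) auto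
        finally show ?thesis
          using C by simp
      qed
      moreover have "(\<lambda>y. g y - g x * g0 y) \<in> E'"
        using cfun.subspace_diff[OF E g(1) cfun.subspace_scale[OF E g0(1), of "g x"]] g0(2)
        by (simp add: E'_def fun_diff_def)
      ultimately show ?thesis
        by (intro bexI[of _ "\<lambda>y. g y - g x * g0 y"]) auto
    qed
    from insert.IH[OF E' this] obtain g where g: "g \<in> E'" "\<And>y. y \<in> X \<Longrightarrow> g y = f y - f x * g0 y"
      by blast
    have "(\<lambda>y. g y + f x * g0 y) \<in> E"
      using cfun.subspace_add[OF E _ cfun.subspace_scale[OF E g0(1), of "f x"]] g(1)
      by (simp add: E'_def plus_fun_def)
    then show ?thesis
      using g g0 by (intro bexI[of _ "\<lambda>y. g y + f x * g0 y"]) (auto simp: E'_def)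
  qed
qed

lemma shifts_in_pball:
  assumes "a \<in> shifts" "a \<in> pball (0 :: 'p::prime_card padic) (int n)"
  obtains k where "k < CARD('p) ^ n" "a = grid (int n) (int k)"
proof -
  obtain l m where l: "l < CARD('p) ^ m" "a = grid (int m) (int l)"
    using assms(1) unfolding shifts_eq by blast
  obtain k where k: "k < CARD('p) ^ nat (0 + int n)" "padic_norm (a - grid (int n) (int k)) \<le> real CARD('p) powi (- 0)"
    using grid_approx[of a "int n" 0] assms(2) unfolding pball_0_iff by auto
  then have "(of_nat l / of_nat CARD('p) ^ m :: rat) = of_nat k / of_nat CARD('p) ^ n"
    using l by (intro shift_rat_unique[where 'p='p]) auto
  then have "a = grid (int n) (int k)"
    unfolding l(2) of_rat_shift[symmetric] by simp
  then show ?thesis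
    using k(1) that by simp
qed

lemma step_fun_translate:
  assumes f: "step_fun M N f" and a: "a \<in> pball (0 :: 'p::prime_card padic) N"
  shows "step_fun M N (\<lambda>x. f (x - a))"
  unfolding step_fun_def
proof (intro conjI allI impI)
  fix x y :: "'p padic" assume "padic_norm (y - x) \<le> real CARD('p) powi (- M)"
  then show "f (y - a) = f (x - a)"
    by (intro step_funD(1)[OF f]) simp
next
  fix x :: "'p padic" assume x: "x \<notin> pball 0 N"
  have "x - a \<notin> pball 0 N"
  proof
    assume "x - a \<in> pball 0 N"
    then have "padic_norm (x - a + a) \<le> real CARD('p) powi N"
      using a unfolding pball_0_iff by (rule padic_norm_add_le)
    then show False
      using x by (simp add: pball_0_iff)
  qed
  then show "f (x - a) = 0"
    by (rule step_funD(2)[OF f])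
qed

lemma grid_in_pball [simp]: "grid N k \<in> pball (0 :: 'p::prime_card padic) N"
  by (simp add: pball_0_iff padic_norm_grid_le)

lemma divide_card_eq: "x / of_nat CARD('p) = x * (ppow (- 1) :: 'p::prime_card padic)"
  by (simp add: ppow_minus ppow_1 divide_inverse)

lemma padic_norm_divide_card:
  "padic_norm (x / of_nat CARD('p) :: 'p::prime_card padic) = padic_norm x * real CARD('p) powi 1"
  unfolding divide_card_eq padic_norm_mult padic_norm_ppow by simp

lemma grid_divide_card: "grid N k / of_nat CARD('p) = (grid (N + 1) k :: 'p::prime_card padic)"
proof -
  have "(ppow (- N) * ppow (- 1) :: 'p padic) = ppow (- (N + 1))"
    by (simp flip: ppow_add)
  then show ?thesis
    unfolding divide_card_eq by (simp only: grid_def mult.assoc)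
qed

lemma
  fixes f :: "'p::prime_card padic \<Rightarrow> 'b::zero"
  assumes f: "step_fun M (int n) f" and a: "a \<in> shifts"
  shows step_fun_dilate_shift: "a \<in> pball 0 (int n + 1) \<Longrightarrow> step_fun (M + 1) (int n) (\<lambda>x. f (x / of_nat CARD('p) - a))"
    and dilate_shift_vanishes: "a \<notin> pball 0 (int n + 1) \<Longrightarrow> x \<in> pball 0 (int n) \<Longrightarrow> f (x / of_nat CARD('p) - a) = 0"
proof -
  have ball: "x / of_nat CARD('p) \<in> pball 0 (int n + 1) \<longleftrightarrow> x \<in> pball 0 (int n)" for x :: "'p padic"
    unfolding pball_0_iff padic_norm_divide_card card_powi_add by simp
  have zero: "f (y - a) = 0" if "(y \<in> pball 0 (int n + 1)) \<noteq> (a \<in> pball 0 (int n + 1))" for y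
  proof (rule step_funD(2)[OF f], rule notI)
    assume "y - a \<in> pball 0 (int n)"
    then have *: "padic_norm (y - a) \<le> real CARD('p) powi (int n + 1)"
      using pball_mono[of "int n" "int n + 1" "0 :: 'p padic"] pball_0_iff by auto
    have "y \<in> pball 0 (int n + 1) \<longleftrightarrow> a \<in> pball 0 (int n + 1)"
      unfolding pball_0_iff
      using padic_norm_add_le[OF *, of a] padic_norm_diff_le[OF _ *, of y] by auto
    then show False
      using that by blast
  qed
  show "f (x / of_nat CARD('p) - a) = 0" if "a \<notin> pball 0 (int n + 1)" "x \<in> pball 0 (int n)"
    using zero[of "x / of_nat CARD('p)"] that ball by blast
  show "step_fun (M + 1) (int n) (\<lambda>x. f (x / of_nat CARD('p) - a))" if aB: "a \<in> pball 0 (int n + 1)"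
    unfolding step_fun_def
  proof (intro conjI allI impI)
    fix x y :: "'p padic" assume "padic_norm (y - x) \<le> real CARD('p) powi (- (M + 1))"
    then have "padic_norm (y - x) * real CARD('p) powi 1 \<le> real CARD('p) powi (- (M + 1)) * real CARD('p) powi 1"
      by (intro mult_right_mono) (auto simp: less_imp_le)
    also have "\<dots> = real CARD('p) powi (- M)"
      unfolding card_powi_add[symmetric] by simp
    finally have "padic_norm ((y - x) / of_nat CARD('p)) \<le> real CARD('p) powi (- M)"
      by (simp only: padic_norm_divide_card)
    then show "f (y / of_nat CARD('p) - a) = f (x / of_nat CARD('p) - a)"
      by (intro step_funD(1)[OF f]) (simp add: diff_divide_distrib)
  next
    fix x :: "'p padic" assume "x \<notin> pball 0 (int n)"
    then show "f (x / of_nat CARD('p) - a) = 0"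
      using zero[of "x / of_nat CARD('p)"] aB ball by blast
  qed
qed

text \<open>
  Restriction to the ball of radius \<open>p ^ n\<close> kills the generators with \<open>\<bar>a\<bar> > p ^ (n + 1)\<close> and preserves the
  others. It does not increase the distance to \<open>f\<close>, which is supported in that ball. Hence \<open>f\<close> is a limit within the
  finite-dimensional span of the preserved generators and belongs to it.
\<close>

lemma L2_closure_dilated_shifts_finite:
  fixes \<phi> f :: "'p::prime_card padic \<Rightarrow> complex"
  assumes \<phi>: "step_fun M (int n) \<phi>" and f: "step_fun (M + 1) (int n) f" and Mn: "M + int n \<ge> 0"
    and lim: "f \<in> L2_closure (cfun.span ((\<lambda>a x. \<phi> (x / of_nat CARD('p) - a)) ` shifts))"
  obtains c where "f = (\<lambda>x. \<Sum>j<CARD('p) ^ (n + 1). c j * \<phi> (x / of_nat CARD('p) - grid (int n + 1) (int j)))"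
proof -
  let ?J = "CARD('p) ^ (n + 1)"
  let ?G = "(\<lambda>a x. \<phi> (x / of_nat CARD('p) - a)) ` shifts"
  define comb where "comb c = (\<lambda>x. \<Sum>j<?J. c j * \<phi> (x / of_nat CARD('p) - grid (int n + 1) (int j)))" for c :: "nat \<Rightarrow> complex"
  have shift_j: "(grid (int n + 1) (int j) :: 'p padic) \<in> shifts" if "j < ?J" for j
    using grid_in_shifts[OF that] by (simp add: add.commute)
  have step_comb: "step_fun (M + 1) (int n) (comb c)" for c
    unfolding comb_def
    by (intro step_fun_sum step_fun_comp[where h="\<lambda>x. _ * x"] step_fun_dilate_shift[OF \<phi>] shift_j) auto
  have sub: "cfun.subspace (range comb)"
    unfolding cfun.subspace_def
  proof (intro conjI ballI allI)
    have "(0 :: 'p padic \<Rightarrow> complex) = comb (\<lambda>_. 0)"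
      by (simp add: comb_def zero_fun_def)
    then show "0 \<in> range comb"
      by blast
  next
    fix g h assume "g \<in> range comb" "h \<in> range comb"
    then obtain c d where "g = comb c" "h = comb d"
      by blast
    then have "g + h = comb (\<lambda>j. c j + d j)"
      by (simp add: comb_def fun_eq_iff sum.distrib ring_distribs)
    then show "g + h \<in> range comb"
      by blast
  next
    fix r g assume "g \<in> range comb"
    then obtain c where "g = comb c"
      by blast
    then have "(\<lambda>x. r * g x) = comb (\<lambda>j. r * c j)"
      by (simp add: comb_def fun_eq_iff sum_distrib_left mult.assoc)
    then show "(\<lambda>x. r * g x) \<in> range comb"
      by blast
  qed
  let ?B = "pball (0 :: 'p padic) (int n)"
  let ?R = "{g. (\<lambda>x. indicator ?B x * g x) \<in> range comb}"
  have "cfun.span ?G \<subseteq> ?R"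
  proof (rule cfun.span_minimal)
    show "?G \<subseteq> ?R"
    proof
      fix g assume "g \<in> ?G"
      then obtain a where a: "a \<in> shifts" and g: "g = (\<lambda>x. \<phi> (x / of_nat CARD('p) - a))"
        by blast
      show "g \<in> ?R"
      proof (cases "a \<in> pball 0 (int n + 1)")
        case True
        then have "a \<in> pball 0 (int (n + 1))"
          by (simp add: add.commute)
        from shifts_in_pball[OF a this] obtain j where j: "j < ?J" "a = grid (int n + 1) (int j)"
          by (auto simp: add.commute)
        have "(\<lambda>x. indicator ?B x * g x) = g"
          using step_funD(2)[OF step_fun_dilate_shift[OF \<phi> a True]] by (auto simp: g fun_eq_iff indicator_def)
        also have "g = comb (\<lambda>i. if i = j then 1 else 0)"
          using j by (simp add: comb_def g fun_eq_iff if_distrib[of "\<lambda>c. c * _"] cong: if_cong)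
        finally show ?thesis
          by blast
      next
        case False
        then have "(\<lambda>x. indicator ?B x * g x) = comb (\<lambda>_. 0)"
          using dilate_shift_vanishes[OF \<phi> a False] by (auto simp: g comb_def fun_eq_iff indicator_def)
        then show ?thesis
          by blast
      qed
    qed
    show "cfun.subspace ?R"
      unfolding cfun.subspace_def
    proof (intro conjI ballI allI CollectI)
      show "(\<lambda>x. indicator ?B x * (0 :: 'p padic \<Rightarrow> complex) x) \<in> range comb"
        using cfun.subspace_0[OF sub] by (simp add: zero_fun_def)
    next
      fix g h assume "g \<in> ?R" "h \<in> ?R"
      then show "(\<lambda>x. indicator ?B x * (g + h) x) \<in> range comb"
        using cfun.subspace_add[OF sub] by (force simp: plus_fun_def ring_distribs)
    next
      fix r g assume "g \<in> ?R"
      then show "(\<lambda>x. indicator ?B x * (r * g x)) \<in> range comb"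
        using cfun.subspace_scale[OF sub, of _ r] by (force simp: mult.left_commute)
    qed
  qed
  then have restrict: "(\<lambda>x. indicator ?B x * g x) \<in> range comb" if "g \<in> cfun.span ?G" for g
    using that by blast
  have Mn1: "(M + 1) + int n \<ge> 0"
    using Mn by simp
  have "\<exists>h\<in>range comb. \<forall>x\<in>(\<lambda>k. grid (int n) (int k)) ` {..<CARD('p) ^ nat (M + 1 + int n)}. cmod (f x - h x) < e"
    if e: "e > 0" for e
  proof -
    have "real CARD('p) powi (- (M + 1)) * e\<^sup>2 > 0"
      using e by simp
    from L2_closureD[OF lim this]
    obtain g where g: "g \<in> cfun.span ?G \<inter> L2" "L2_sq (\<lambda>x. f x - g x) < real CARD('p) powi (- (M + 1)) * e\<^sup>2"
      by blast
    let ?h = "\<lambda>x. indicator ?B x * g x"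
    have h: "?h \<in> range comb"
      using restrict g(1) by blast
    then have step: "step_fun (M + 1) (int n) (\<lambda>x. f x - ?h x)"
      using f step_comb by (intro step_fun_comp2[where h="(-)"]) auto
    have "(\<lambda>x. f x - ?h x) = (\<lambda>x. indicator ?B x * (f x - g x))"
      using step_funD(2)[OF f] by (auto simp: fun_eq_iff indicator_def)
    then have le: "L2_sq (\<lambda>x. f x - ?h x) < real CARD('p) powi (- (M + 1)) * e\<^sup>2"
      using L2_restrict(2)[OF L2_diff, of f g ?B] g lim L2_closure_subset_L2 by fastforce
    have "cmod (f x - ?h x) < e" for x
    proof -
      have "real CARD('p) powi (- (M + 1)) * (cmod (f x - ?h x))\<^sup>2 < real CARD('p) powi (- (M + 1)) * e\<^sup>2"
        using step_fun_pointwise_le[OF step Mn1, of x] le by linarith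
      then have "(cmod (f x - ?h x))\<^sup>2 < e\<^sup>2"
        by (simp only: mult_less_cancel_left_pos card_powi_pos)
      then show ?thesis
        using e by (simp add: power2_less_imp_less)
    qed
    then show ?thesis
      by (intro bexI[OF _ h] ballI)
  qed
  from finite_approx_attained[OF _ sub this]
  obtain h where h: "h \<in> range comb" "\<And>k. k < CARD('p) ^ nat (M + 1 + int n) \<Longrightarrow> h (grid (int n) (int k)) = f (grid (int n) (int k))"
    by auto
  then obtain c where "h = comb c"
    by blast
  then have "f = comb c"
    using h(2) by (intro step_fun_eqI[OF f step_comb Mn1]) simp
  then show ?thesis
    unfolding comb_def by (rule that)
qed

section \<open>Discrete Fourier transform on a cyclic group\<close>

text \<open>
  At the roots of unity of order \<open>R\<close> this is the discrete Fourier transform of a function of period \<open>R\<close>.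
\<close>

definition unity_sum :: "nat \<Rightarrow> (int \<Rightarrow> complex) \<Rightarrow> complex \<Rightarrow> complex" where
  "unity_sum R h z = (\<Sum>k<R. h (int k) * z ^ k)"

definition unity_support :: "nat \<Rightarrow> (int \<Rightarrow> complex) \<Rightarrow> complex set" where
  "unity_support Q u = {z. z ^ Q = 1 \<and> unity_sum Q u z \<noteq> 0}"

lemma unity_sum_shift:
  assumes per: "\<And>k. h (k + int R) = h k" and z: "z ^ R = 1" and R: "R > 0"
  shows "unity_sum R (\<lambda>k. h (k - int i)) z = z ^ i * unity_sum R h z"
proof (induction i)
  case (Suc i)
  have z0: "z \<noteq> 0"
    using z R by (auto simp: power_0_left)
  obtain S where S: "R = Suc S"
    using R by (cases R) auto
  define g where "g k = h (k - int i)" for k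
  have g1: "g (- 1) = g (int S)"
    using per[of "- 1 - int i"] by (simp add: g_def S)
  have "unity_sum R (\<lambda>k. h (k - int (Suc i))) z = (\<Sum>k<Suc S. g (int k - 1) * z ^ k)"
    by (simp add: unity_sum_def S g_def algebra_simps)
  also have "\<dots> = g (- 1) + (\<Sum>k<S. g (int k) * z ^ Suc k)"
    by (subst sum.lessThan_Suc_shift) simp
  also have "g (- 1) = g (int S) * z ^ Suc S"
    using z by (simp add: S g1)
  also have "g (int S) * z ^ Suc S + (\<Sum>k<S. g (int k) * z ^ Suc k) = z * (\<Sum>k<Suc S. g (int k) * z ^ k)"
    by (simp add: sum_distrib_left algebra_simps)
  also have "(\<Sum>k<Suc S. g (int k) * z ^ k) = z ^ i * unity_sum R h z"
    using Suc.IH by (simp add: unity_sum_def S g_def)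
  finally show ?case
    by simp
qed simp

lemma unity_sum_periodic:
  assumes per: "\<And>k. u (k + int Q) = u k"
  shows "unity_sum (p * Q) u z = unity_sum Q u z * (\<Sum>s<p. (z ^ Q) ^ s)"
proof (induction p)
  case (Suc p)
  have shift: "u (int (p * Q + k)) = u (int k)" for k
  proof (induction p)
    case (Suc p)
    then show ?case
      using per[of "int (p * Q + k)"] by (simp add: algebra_simps)
  qed simp
  have "u (int (p * Q + k)) * z ^ (p * Q + k) = u (int k) * z ^ k * (z ^ Q) ^ p" for k
    unfolding shift by (simp add: power_add mult.commute[of p] flip: power_mult)
  then have "(\<Sum>k<Q. u (int (p * Q + k)) * z ^ (p * Q + k)) = (\<Sum>k<Q. u (int k) * z ^ k) * (z ^ Q) ^ p"
    by (simp only: sum_distrib_right)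
  moreover have "unity_sum (Suc p * Q) u z =
      unity_sum (p * Q) u z + (\<Sum>k<Q. u (int (p * Q + k)) * z ^ (p * Q + k))"
  proof -
    have "(\<Sum>k<A + B. f k) = (\<Sum>k<A. f k) + (\<Sum>k<B. f (A + k))" for f :: "nat \<Rightarrow> complex" and A B
      by (induction B) simp_all
    from this[where A = "p * Q" and B = Q] show ?thesis
      unfolding unity_sum_def by (simp only: mult_Suc add.commute[of Q])
  qed
  ultimately show ?case
    using Suc.IH by (simp add: unity_sum_def distrib_left)
qed (simp add: unity_sum_def)

text \<open>
  A function of period \<open>Q\<close> has no frequencies beyond those of order \<open>Q\<close>: at the other roots of unity the
  geometric sum over the periods vanishes.
\<close>

lemma unity_sum_periodic_eq_0:
  assumes per: "\<And>k. u (k + int Q) = u k" and z: "z ^ (p * Q) = 1" "z \<notin> unity_support Q u"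
  shows "unity_sum (p * Q) u z = 0"
proof (cases "z ^ Q = 1")
  case True
  then have "unity_sum Q u z = 0"
    using z(2) by (simp add: unity_support_def)
  then show ?thesis
    by (simp add: unity_sum_periodic[where u=u and Q=Q, OF per])
next
  case False
  have "(z ^ Q) ^ p = 1"
    using z(1) by (simp add: mult.commute flip: power_mult)
  then show ?thesis
    using False by (simp add: unity_sum_periodic[where u=u and Q=Q, OF per] geometric_sum)
qed

text \<open>
  The function \<open>w\<close> is \<open>u\<close> spread out by the factor \<open>p\<close> with zeros in between, the sampled form of dilation.
\<close>

lemma unity_sum_dilate:
  assumes p: "p > 0" and w: "\<And>k. w (int p * k) = u k" "\<And>k. \<not> int p dvd k \<Longrightarrow> w k = 0"
  shows "unity_sum (p * Q) w z = unity_sum Q u (z ^ p)"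
proof -
  have "(\<Sum>k<p * Q. w (int k) * z ^ k) = (\<Sum>k\<in>(\<lambda>k. p * k) ` {..<Q}. w (int k) * z ^ k)"
  proof (rule sum.mono_neutral_right)
    show "\<forall>k\<in>{..<p * Q} - (\<lambda>k. p * k) ` {..<Q}. w (int k) * z ^ k = 0"
    proof
      fix k assume k: "k \<in> {..<p * Q} - (\<lambda>k. p * k) ` {..<Q}"
      have "\<not> p dvd k"
        using k by (auto elim!: dvdE)
      then have "\<not> int p dvd int k"
        by simp
      then show "w (int k) * z ^ k = 0"
        using w(2) by simp
    qed
  qed (use p in auto)
  also have "\<dots> = (\<Sum>k<Q. w (int (p * k)) * z ^ (p * k))"
    using p by (subst sum.reindex) (auto simp: inj_on_def)
  finally show ?thesis
    by (simp add: unity_sum_def w(1) power_mult)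
qed

lemma finite_unity_support: "Q > 0 \<Longrightarrow> finite (unity_support Q u)"
  unfolding unity_support_def by (rule finite_subset[OF _ finite_roots_unity[of Q]]) auto

lemma card_power_vimage:
  assumes "finite S" "0 \<notin> (S :: complex set)" "p > 0"
  shows "finite {z. z ^ p \<in> S}" "card {z. z ^ p \<in> S} = p * card S"
proof -
  have eq: "{z. z ^ p \<in> S} = (\<Union>y\<in>S. {z. z ^ p = y})"
    by auto
  have fin: "finite {z. z ^ p = y}" if "y \<in> S" for y
    using that assms by (intro finite_nth_roots) auto
  show "finite {z. z ^ p \<in> S}"
    unfolding eq using assms fin by auto
  have "card (\<Union>y\<in>S. {z. z ^ p = y}) = (\<Sum>y\<in>S. card {z. z ^ p = y})"
    using assms fin by (intro card_UN_disjoint) auto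
  also have "\<dots> = (\<Sum>y\<in>S. p)"
    using assms by (intro sum.cong refl card_nth_roots) auto
  finally show "card {z. z ^ p \<in> S} = p * card S"
    unfolding eq by simp
qed

text \<open>
  The polynomial \<open>q 0\<close> vanishes on \<open>T - S\<close>, which forces its degree above \<open>(p - 1) P\<close> when \<open>card S > P\<close>. Some
  monomial \<open>z ^ i\<close> with \<open>i < P\<close> then raises the degree to exactly \<open>p P\<close>. Since \<open>q i\<close> has smaller degree,
  \<open>z ^ i q 0 - q i\<close> is a nonzero polynomial of degree \<open>p P\<close>; but it vanishes on \<open>T\<close>, which has more than \<open>p P\<close> points.
\<close>

lemma card_le_of_polynomial_multipliers:
  fixes q :: "nat \<Rightarrow> complex poly"
  assumes fin: "finite T" and ST: "S \<subseteq> T" and card: "card T = p * card S"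
    and deg: "\<And>i. i < P \<Longrightarrow> degree (q i) < p * P"
    and eq: "\<And>i z. i < P \<Longrightarrow> z \<in> T \<Longrightarrow> poly (q i) z = z ^ i * poly (q 0) z"
    and nz: "q 0 \<noteq> 0" and van: "\<And>z. z \<in> T - S \<Longrightarrow> poly (q 0) z = 0"
    and P: "P > 0" and p: "p > 1"
  shows "card S \<le> P"
proof (rule ccontr)
  assume "\<not> card S \<le> P"
  then have big: "card S > P"
    by simp
  let ?d = "degree (q 0)"
  have "card (T - S) \<le> card {z. poly (q 0) z = 0}"
    using van nz by (intro card_mono poly_roots_finite) auto
  also have "\<dots> \<le> ?d"
    using nz by (rule card_poly_roots_bound)
  finally have bound: "p * card S - card S \<le> ?d"
    using card_Diff_subset[OF finite_subset[OF ST fin] ST] card by simp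
  have dlt: "?d < p * P"
    using deg[OF P] .
  \<comment> \<open>the exponent for which \<open>z ^ i q 0\<close> reaches the degree \<open>p P\<close>, out of reach for \<open>q i\<close>\<close>
  define i where "i = p * P - ?d"
  have "i < P"
  proof -
    have "(p - 1) * P < (p - 1) * card S"
      using big p by simp
    then have "p * P - P < ?d"
      using bound by (simp add: diff_mult_distrib)
    then show ?thesis
      using dlt by (simp add: i_def)
  qed
  define g where "g = Polynomial.monom 1 i * q 0 - q i"
  have "degree (Polynomial.monom 1 i * q 0) = p * P"
    using nz dlt by (simp add: degree_mult_eq Polynomial.degree_monom_eq i_def monom_eq_0_iff)
  moreover have "degree (q i) < p * P"
    using deg \<open>i < P\<close> .
  ultimately have dg: "degree g = p * P"
    unfolding g_def diff_conv_add_uminus by (subst degree_add_eq_left) auto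
  then have g0: "g \<noteq> 0"
    using p P by auto
  have "card T \<le> card {z. poly g z = 0}"
    using eq[OF \<open>i < P\<close>] g0 by (intro card_mono poly_roots_finite) (auto simp: g_def Polynomial.poly_monom)
  also have "\<dots> \<le> p * P"
    using card_poly_roots_bound[OF g0] dg by simp
  finally show False
    using card big p by simp
qed

section \<open>The bound on the number of nonzero Fourier coefficients\<close>

lemma poly_sum_monom: "poly (\<Sum>j<n. Polynomial.monom (c j) j) z = (\<Sum>j<n. c j * z ^ j :: 'a::comm_semiring_1)"
  by (simp add: poly_sum Polynomial.poly_monom)

lemma coeff_sum_monom: "poly.coeff (\<Sum>j<n. Polynomial.monom (c j) j) i = (if i < n then c i else 0 :: 'a::comm_semiring_1)"
  by (simp add: Polynomial.coeff_sum if_distrib cong: if_cong)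

lemma degree_sum_monom_less: "n > 0 \<Longrightarrow> degree (\<Sum>j<n. Polynomial.monom (c j) j :: 'a::comm_semiring_1 poly) < n"
  by (intro degree_lessI) (auto simp: coeff_sum_monom)

lemma step_fun_grid_periodic:
  assumes f: "step_fun M N (f :: 'p::prime_card padic \<Rightarrow> 'b::zero)" and MN: "M + N \<ge> 0"
  shows "f (grid N (k + int (CARD('p) ^ nat (M + N)))) = f (grid N k)"
proof (rule step_funD(1)[OF f])
  show "padic_norm (grid N (k + int (CARD('p) ^ nat (M + N))) - grid N k :: 'p padic) \<le> real CARD('p) powi (- M)"
    using padic_norm_grid_le_iff[OF MN, of "int (CARD('p) ^ nat (M + N))", where 'p='p] by (simp add: grid_diff)
qed

lemma unity_sum_sum_translates:
  assumes per: "\<And>k. h (k + int R) = h k" and z: "z ^ R = 1" and R: "R > 0"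
  shows "unity_sum R (\<lambda>k. \<Sum>j<m. c j * h (k - int j)) z = poly (\<Sum>j<m. Polynomial.monom (c j) j) z * unity_sum R h z"
proof -
  have "unity_sum R (\<lambda>k. \<Sum>j<m. c j * h (k - int j)) z = (\<Sum>j<m. c j * unity_sum R (\<lambda>k. h (k - int j)) z)"
    unfolding unity_sum_def sum_distrib_right sum_distrib_left by (subst sum.swap) (simp add: mult.assoc)
  also have "\<dots> = (\<Sum>j<m. c j * z ^ j) * unity_sum R h z"
    by (simp add: unity_sum_shift[of h, OF per z R] sum_distrib_right mult.assoc)
  finally show ?thesis
    by (simp only: poly_sum_monom)
qed

text \<open>
  The discrete Fourier transform turns the representation of the translate by \<open>grid n i\<close> into the product of the
  transform of \<open>\<phi> (x / p)\<close> with a polynomial \<open>q i\<close> of degree below \<open>p ^ (n + 1)\<close>, and the translation itself into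
  multiplication by \<open>z ^ i\<close>. Hence \<open>q i = z ^ i q 0\<close> wherever the transform of \<open>\<phi> (x / p)\<close> is nonzero.
\<close>

lemma card_unity_support_le:
  fixes \<phi> :: "'p::prime_card padic \<Rightarrow> complex"
  assumes \<phi>: "step_fun M (int n) \<phi>" and Mn: "M + int n \<ge> 0" and nz: "\<phi> \<noteq> (\<lambda>_. 0)"
    and rep: "\<And>i. i < CARD('p) ^ n \<Longrightarrow> \<exists>c. (\<lambda>x. \<phi> (x - grid (int n) (int i))) =
      (\<lambda>x. \<Sum>j<CARD('p) ^ (n + 1). c j * \<phi> (x / of_nat CARD('p) - grid (int n + 1) (int j)))"
  shows "card (unity_support (CARD('p) ^ nat (M + int n)) (\<lambda>k. \<phi> (grid (int n) k))) \<le> CARD('p) ^ n"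
proof -
  define p where "p = CARD('p)"
  have p: "p > 1"
    using card_gt_1[where 'p='p] by (simp add: p_def)
  define Q where "Q = p ^ nat (M + int n)"
  have Q: "Q > 0"
    using p by (simp add: Q_def)
  define u where "u k = \<phi> (grid (int n) k)" for k
  define w where "w k = \<phi> (grid (int n + 1) k)" for k
  have u_per: "u (k + int Q) = u k" for k
    unfolding u_def Q_def p_def by (rule step_fun_grid_periodic[OF \<phi> Mn])
  have w_p: "w (int p * k) = u k" for k
    using grid_lift[of "int n" k 1, where 'p='p] by (simp add: w_def u_def p_def mult.commute)
  have w_0: "w k = 0" if "\<not> int p dvd k" for k
  proof -
    have "grid (int n + 1) k \<notin> pball (0 :: 'p padic) (int n)"
      using padic_norm_grid_le_iff[of "- int n" "int n + 1" k, where 'p='p] that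
      by (simp add: pball_0_iff p_def)
    then show ?thesis
      unfolding w_def by (rule step_funD(2)[OF \<phi>])
  qed
  have w_per: "w (k + int (p * Q)) = w k" for k
  proof (cases "int p dvd k")
    case True
    then obtain l where l: "k = int p * l"
      by blast
    have "w (k + int (p * Q)) = w (int p * (l + int Q))"
      by (simp add: l distrib_left)
    then show ?thesis
      by (simp only: w_p u_per l)
  next
    case False
    then have "\<not> int p dvd k + int (p * Q)"
      by (simp add: dvd_add_left_iff)
    then show ?thesis
      using False w_0 by simp
  qed
  have "\<forall>i. \<exists>c. i < p ^ n \<longrightarrow> (\<lambda>x. \<phi> (x - grid (int n) (int i))) =
      (\<lambda>x. \<Sum>j<p ^ (n + 1). c j * \<phi> (x / of_nat p - grid (int n + 1) (int j)))"
    using rep unfolding p_def by blast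
  from choice[OF this] obtain c where c: "\<And>i. i < p ^ n \<Longrightarrow> (\<lambda>x. \<phi> (x - grid (int n) (int i))) =
      (\<lambda>x. \<Sum>j<p ^ (n + 1). c i j * \<phi> (x / of_nat p - grid (int n + 1) (int j)))"
    by blast
  have uw: "u (k - int i) = (\<Sum>j<p ^ (n + 1). c i j * w (k - int j))" if "i < p ^ n" for i k
    using fun_cong[OF c[OF that], of "grid (int n) k"]
    by (simp add: u_def w_def p_def grid_divide_card grid_diff)
  define S where "S = unity_support Q u"
  define T where "T = {z. z ^ p \<in> S}"
  define q where "q i = (\<Sum>j<p ^ (n + 1). Polynomial.monom (c i j) j)" for i
  have S: "finite S" "0 \<notin> S"
    using finite_unity_support[OF Q, of u] Q by (auto simp: S_def unity_support_def power_0_left)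
  have key: "z ^ i * unity_sum (p * Q) u z = poly (q i) z * unity_sum Q u (z ^ p)"
    if "i < p ^ n" "z ^ (p * Q) = 1" for i z
  proof -
    have pQ: "p * Q > 0"
      using p Q by simp
    have "u (k + int (m * Q)) = u k" for k m
    proof (induction m)
      case (Suc m)
      then show ?case
        using u_per[of "k + int (m * Q)"] by (simp add: algebra_simps)
    qed simp
    then have "z ^ i * unity_sum (p * Q) u z = unity_sum (p * Q) (\<lambda>k. u (k - int i)) z"
      using unity_sum_shift[of u "p * Q" z i] that pQ by simp
    also have "\<dots> = unity_sum (p * Q) (\<lambda>k. \<Sum>j<p ^ (n + 1). c i j * w (k - int j)) z"
      by (simp only: uw[OF that(1)])
    also have "\<dots> = poly (q i) z * unity_sum (p * Q) w z"
      unfolding q_def using w_per that(2) pQ by (rule unity_sum_sum_translates)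
    also have "unity_sum (p * Q) w z = unity_sum Q u (z ^ p)"
      using p w_p w_0 by (intro unity_sum_dilate) auto
    finally show ?thesis .
  qed
  have T: "z ^ (p * Q) = 1" "unity_sum Q u (z ^ p) \<noteq> 0" if "z \<in> T" for z
    using that by (auto simp: T_def S_def unity_support_def power_mult)
  have van: "unity_sum (p * Q) u z = 0" if "z ^ (p * Q) = 1" "z \<notin> S" for z
    using unity_sum_periodic_eq_0[of u Q z p] u_per that by (simp add: S_def)
  have "card S \<le> p ^ n"
  proof (rule card_le_of_polynomial_multipliers[where q=q])
    show "finite T" "card T = p * card S"
      unfolding T_def using S p by (intro card_power_vimage; simp)+
    show "S \<subseteq> T"
    proof
      fix z assume z: "z \<in> S"
      have "z ^ Q = 1" and "unity_sum Q u z \<noteq> 0"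
        using z by (auto simp: S_def unity_support_def)
      then have zpQ: "z ^ (p * Q) = 1"
        by (simp add: mult.commute[of p] power_mult)
      have "unity_sum (p * Q) u z = unity_sum Q u z * of_nat p"
        using unity_sum_periodic[of u Q p z] u_per \<open>z ^ Q = 1\<close> by simp
      then have "poly (q 0) z * unity_sum Q u (z ^ p) = unity_sum Q u z * of_nat p"
        using key[of 0 z] zpQ p by simp
      moreover have "unity_sum Q u z * of_nat p \<noteq> 0"
        using \<open>unity_sum Q u z \<noteq> 0\<close> p by simp
      ultimately have "poly (q 0) z * unity_sum Q u (z ^ p) \<noteq> 0"
        by metis
      moreover have "(z ^ p) ^ Q = 1"
        using zpQ by (simp add: power_mult)
      ultimately show "z \<in> T"
        by (simp add: T_def S_def unity_support_def)
    qed
    show "degree (q i) < p * p ^ n" for i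
      using degree_sum_monom_less[of "p ^ (n + 1)" "c i"] p by (simp add: q_def)
    show "poly (q i) z = z ^ i * poly (q 0) z" if "i < p ^ n" "z \<in> T" for i z
      using key[of i z] key[of 0 z] T[OF that(2)] that(1) p by (auto simp: mult.assoc)
    show "q 0 \<noteq> 0"
    proof
      assume "q 0 = 0"
      then have "c 0 j = 0" if "j < p ^ (n + 1)" for j
        using coeff_sum_monom[of "c 0" "p ^ (n + 1)" j] that by (simp add: q_def)
      then have "\<phi> = (\<lambda>_. 0)"
        using c[of 0] p by (simp add: grid_def)
      then show False
        using nz by simp
    qed
    show "poly (q 0) z = 0" if "z \<in> T - S" for z
      using key[of 0 z] T[of z] van[of z] that p by auto
  qed (use p in auto)
  then show ?thesis
    by (simp add: S_def p_def Q_def u_def[abs_def])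
qed

section \<open>Interpolation of translates\<close>

text \<open>
  The remainder of \<open>X ^ t\<close> modulo the polynomial with zero set \<open>S\<close> agrees with \<open>X ^ t\<close> on \<open>S\<close> and has as few coefficients
  as \<open>S\<close> has elements.
\<close>

lemma exists_low_degree_interpolant:
  fixes S :: "complex set"
  assumes "finite S" "card S \<le> P" "P > 0"
  shows "\<exists>b. \<forall>z\<in>S. (\<Sum>j<P. b j * z ^ j) = z ^ t"
proof -
  define D where "D = (\<Prod>s\<in>S. [:- s, 1:])"
  have D0: "D \<noteq> 0"
    using assms(1) by (simp add: D_def)
  have degD: "degree D = card S"
    unfolding D_def by (subst degree_prod_eq_sum_degree) auto
  define r where "r = Polynomial.monom 1 t mod D"
  have "r = 0 \<or> degree r < degree D"
    unfolding r_def using D0 degree_mod_less by blast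
  then have r: "poly.coeff r j = 0" if "j \<ge> P" for j
    using assms degD that by (auto intro: coeff_eq_0)
  have "(\<Sum>j<P. poly.coeff r j * z ^ j) = z ^ t" if "z \<in> S" for z
  proof -
    have "r = (\<Sum>j<P. Polynomial.monom (poly.coeff r j) j)"
      using r by (intro poly_eqI) (simp add: coeff_sum_monom)
    then have "(\<Sum>j<P. poly.coeff r j * z ^ j) = poly r z"
      using poly_sum_monom[of "poly.coeff r" P z] by simp
    also have "poly D z = 0"
      using that assms(1) by (auto simp: D_def poly_prod)
    then have "poly r z = poly (Polynomial.monom 1 t div D * D + Polynomial.monom 1 t mod D) z"
      by (simp only: r_def poly_add poly_mult mult_zero_right add_0)
    also have "\<dots> = z ^ t"
      by (simp only: div_mult_mod_eq Polynomial.poly_monom mult_1)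
    finally show ?thesis .
  qed
  then show ?thesis
    by blast
qed

lemma unity_sum_eq_0_imp:
  assumes "\<And>z. z ^ Q = 1 \<Longrightarrow> unity_sum Q h z = 0" "Q > 0" "k < Q"
  shows "h (int k) = 0"
proof -
  define g where "g = (\<Sum>k<Q. Polynomial.monom (h (int k)) k)"
  have "g = 0"
  proof (rule ccontr)
    assume g: "g \<noteq> 0"
    have "card {z :: complex. z ^ Q = 1} \<le> card {z. poly g z = 0}"
      using assms(1) g by (intro card_mono poly_roots_finite) (auto simp: g_def poly_sum_monom unity_sum_def)
    also have "\<dots> \<le> degree g"
      using g by (rule card_poly_roots_bound)
    also have "\<dots> < Q"
      unfolding g_def using assms(2) by (rule degree_sum_monom_less)
    finally show False
      using assms(2) by (simp add: card_roots_unity_eq)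
  qed
  then show ?thesis
    using coeff_sum_monom[of "\<lambda>k. h (int k)" Q k] assms(3) by (simp add: g_def)
qed

text \<open>
  Both sides are step functions, determined by their discrete Fourier transforms. The transforms agree if the
  polynomial with coefficients \<open>b i\<close> equals \<open>z ^ t\<close> on the support of the transform of \<open>\<phi>\<close>.
\<close>

lemma translate_in_span_few:
  fixes \<phi> :: "'p::prime_card padic \<Rightarrow> complex"
  assumes \<phi>: "step_fun M (int n) \<phi>" and Mn: "M + int n \<ge> 0"
    and card: "card (unity_support (CARD('p) ^ nat (M + int n)) (\<lambda>k. \<phi> (grid (int n) k))) \<le> CARD('p) ^ n"
  shows "\<exists>b. \<forall>x. \<phi> (x - grid (int n) (int t)) = (\<Sum>i<CARD('p) ^ n. b i * \<phi> (x - grid (int n) (int i)))"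
proof -
  define Q where "Q = CARD('p) ^ nat (M + int n)"
  define P where "P = CARD('p) ^ n"
  have pos: "Q > 0" "P > 0"
    using card_gt_1[where 'p='p] by (simp_all add: Q_def P_def)
  define u where "u k = \<phi> (grid (int n) k)" for k
  have u_per: "u (k + int Q) = u k" for k
    unfolding u_def Q_def by (rule step_fun_grid_periodic[OF \<phi> Mn])
  have "card (unity_support Q u) \<le> P"
    using card by (simp add: Q_def P_def u_def[abs_def])
  with finite_unity_support[OF pos(1)]
  obtain b where b: "\<And>z. z \<in> unity_support Q u \<Longrightarrow> (\<Sum>i<P. b i * z ^ i) = z ^ t"
    using exists_low_degree_interpolant[of "unity_support Q u" P t] pos by blast
  have eq: "u (int k - int t) = (\<Sum>i<P. b i * u (int k - int i))" if "k < Q" for k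
  proof -
    have "unity_sum Q (\<lambda>k. u (k - int t) - (\<Sum>i<P. b i * u (k - int i))) z = 0" if z: "z ^ Q = 1" for z
    proof -
      have "unity_sum Q (\<lambda>k. u (k - int t) - (\<Sum>i<P. b i * u (k - int i))) z =
          z ^ t * unity_sum Q u z - (\<Sum>i<P. b i * z ^ i) * unity_sum Q u z"
        using unity_sum_shift[of u Q z t, OF u_per z pos(1)]
          unity_sum_sum_translates[of u Q z b P, OF u_per z pos(1)]
        by (simp add: unity_sum_def left_diff_distrib sum_subtractf poly_sum_monom)
      then show ?thesis
        using b[of z] z by (cases "unity_sum Q u z = 0") (auto simp: unity_support_def)
    qed
    from unity_sum_eq_0_imp[OF this pos(1) that] show ?thesis
      by simp
  qed
  have "(\<lambda>x. \<phi> (x - grid (int n) (int t))) = (\<lambda>x. \<Sum>i<P. b i * \<phi> (x - grid (int n) (int i)))"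
  proof (rule step_fun_eqI[OF _ _ Mn])
    show "step_fun M (int n) (\<lambda>x. \<phi> (x - grid (int n) (int t)))"
      by (rule step_fun_translate[OF \<phi>]) simp
    show "step_fun M (int n) (\<lambda>x. \<Sum>i<P. b i * \<phi> (x - grid (int n) (int i)))"
      by (intro step_fun_sum step_fun_comp[where h="\<lambda>x. _ * x"] step_fun_translate[OF \<phi>]) auto
  qed (use eq in \<open>simp add: u_def Q_def grid_diff\<close>)
  then show ?thesis
    unfolding P_def by (intro exI[of _ b]) (simp add: fun_eq_iff)
qed

section \<open>Balls span a dense subspace\<close>

lemma L2_closure_of_dominated_limit:
  fixes f :: "'p::prime_card padic \<Rightarrow> complex"
  assumes f: "f \<in> L2" and g: "\<And>i. g i \<in> L2_closure S"
    and lim: "\<And>x. (\<lambda>i. g i x) \<longlonglongrightarrow> f x" and bound: "\<And>i x. cmod (g i x) \<le> 2 * cmod (f x)"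
  shows "f \<in> L2_closure S"
proof -
  have gL: "g i \<in> L2" for i
    using g L2_closure_subset_L2 by blast
  have "(\<lambda>i. \<integral>x. (cmod (f x - g i x))\<^sup>2 \<partial>padic_haar) \<longlonglongrightarrow> integral\<^sup>L padic_haar (\<lambda>_ :: 'p padic. 0)"
  proof (rule integral_dominated_convergence[where w="\<lambda>x. 9 * (cmod (f x))\<^sup>2" and f="\<lambda>_. 0"
        and s="\<lambda>i x. (cmod (f x - g i x))\<^sup>2"])
    show "integrable padic_haar (\<lambda>x. 9 * (cmod (f x))\<^sup>2)"
      using L2_integrable[OF f] by simp
    show "AE x in padic_haar. (\<lambda>i. (cmod (f x - g i x))\<^sup>2) \<longlonglongrightarrow> 0"
    proof (rule AE_I2)
      fix x
      have "(\<lambda>i. (cmod (f x - g i x))\<^sup>2) \<longlonglongrightarrow> (cmod (f x - f x))\<^sup>2"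
        by (intro tendsto_intros lim)
      then show "(\<lambda>i. (cmod (f x - g i x))\<^sup>2) \<longlonglongrightarrow> 0"
        by simp
    qed
    show "AE x in padic_haar. norm ((cmod (f x - g i x))\<^sup>2) \<le> 9 * (cmod (f x))\<^sup>2" for i
    proof (rule AE_I2)
      fix x
      have "cmod (f x - g i x) \<le> 3 * cmod (f x)"
        using norm_triangle_ineq4[of "f x" "g i x"] bound[of i x] by linarith
      then have "(cmod (f x - g i x))\<^sup>2 \<le> (3 * cmod (f x))\<^sup>2"
        by (intro power_mono) auto
      then show "norm ((cmod (f x - g i x))\<^sup>2) \<le> 9 * (cmod (f x))\<^sup>2"
        by (simp add: power_mult_distrib)
    qed
    show "(\<lambda>x. (cmod (f x - g i x))\<^sup>2) \<in> borel_measurable padic_haar" for i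
      using L2_integrable[OF L2_diff[OF f gL]] by auto
  qed simp
  then have conv: "(\<lambda>i. L2_sq (\<lambda>x. f x - g i x)) \<longlonglongrightarrow> 0"
    by (simp add: L2_sq_def)
  have "f \<in> L2_closure (L2_closure S)"
    unfolding L2_closure_iff[of f]
  proof (intro conjI allI impI f)
    fix e :: real assume "e > 0"
    then have "eventually (\<lambda>i. L2_sq (\<lambda>x. f x - g i x) < e) sequentially"
      by (rule order_tendstoD(2)[OF conv])
    then obtain i where "L2_sq (\<lambda>x. f x - g i x) < e"
      by (auto simp: eventually_sequentially)
    then show "\<exists>h\<in>L2_closure S \<inter> L2. L2_sq (\<lambda>x. f x - h x) < e"
      using g gL by blast
  qed
  then show ?thesis
    by (simp add: L2_closure_idem)
qed

lemma indicator_pball_step: "step_fun (- j) (max j N) (indicator (pball (c :: 'p::prime_card padic) j) :: _ \<Rightarrow> complex)"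
  if "c \<in> pball 0 N"
  unfolding step_fun_def
proof (intro conjI allI impI)
  fix x y :: "'p padic" assume "padic_norm (y - x) \<le> real CARD('p) powi (- (- j))"
  then have "y \<in> pball x j"
    by (simp add: pball_def)
  then have "y \<in> pball c j \<longleftrightarrow> x \<in> pball c j"
    using pball_recentre centre_in_pball by blast
  then show "indicator (pball c j) y = (indicator (pball c j) x :: complex)"
    by (simp add: indicator_def)
next
  fix x :: "'p padic" assume x: "x \<notin> pball 0 (max j N)"
  have "x \<notin> pball c j"
  proof
    assume "x \<in> pball c j"
    then have "x \<in> pball c (max j N)"
      using pball_mono[of j "max j N" c] by auto
    moreover have "c \<in> pball 0 (max j N)"
      using that pball_mono[of N "max j N" "0 :: 'p padic"] by auto
    ultimately show False
      using x pball_recentre by blast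
  qed
  then show "indicator (pball c j) x = (0 :: complex)"
    by simp
qed

lemma indicator_pball_L2: "(indicator (pball (c :: 'p::prime_card padic) j) :: _ \<Rightarrow> complex) \<in> L2"
proof -
  obtain n where "c \<in> pball 0 (int n)"
    using in_pball_0_large by blast
  then show ?thesis
    by (intro step_fun_L2(1)[OF indicator_pball_step]) auto
qed

lemma cfun_subspace_sum_scale:
  assumes "cfun.subspace S" "\<And>i. i \<in> A \<Longrightarrow> f i \<in> S"
  shows "(\<lambda>x. \<Sum>i\<in>A. c i * f i x) \<in> S"
proof -
  have "(\<Sum>i\<in>A. (\<lambda>x. c i * f i x)) \<in> S"
    using assms by (intro cfun.subspace_sum cfun.subspace_scale)
  moreover have "(\<Sum>i\<in>A. (\<lambda>x. c i * f i x)) = (\<lambda>x. \<Sum>i\<in>A. c i * f i x)"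
    by (induction A rule: infinite_finite_induct) (auto simp: fun_eq_iff)
  ultimately show ?thesis
    by simp
qed

text \<open>
  Cutting off with a fixed ball keeps all measures finite, so that the sets concerned form a Dynkin system; balls
  generate the Borel sets and are closed under intersection.
\<close>

lemma indicator_Int_pball_in_closure:
  fixes W :: "('p::prime_card padic \<Rightarrow> complex) set"
  assumes W: "cfun.subspace W" and balls: "\<And>c j. indicator (pball c j) \<in> W"
    and A: "A \<in> sets borel"
  shows "indicator (A \<inter> pball 0 R) \<in> L2_closure W"
proof -
  have sub: "cfun.subspace (L2_closure W)"
    by (rule subspace_L2_closure[OF W])
  have ball: "indicator (pball c j) \<in> L2_closure W" for c j
    by (intro L2_closure_superset balls indicator_pball_L2)
  have "(indicator {} :: 'p padic \<Rightarrow> complex) = 0"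
    by (simp add: fun_eq_iff)
  then have empty: "indicator {} \<in> L2_closure W"
    using cfun.subspace_0[OF sub] by simp
  have meas: "(indicator (B \<inter> pball 0 R) :: 'p padic \<Rightarrow> complex) \<in> L2" if "B \<in> sets borel" for B
    using L2_restrict(1)[OF indicator_pball_L2[of 0 R] that] by (simp add: indicator_inter_arith[symmetric])
  have "padic_balls \<subseteq> Pow (UNIV :: 'p padic set)" "A \<in> sigma_sets UNIV padic_balls"
    using A by (simp_all only: sets_borel_padic Pow_UNIV subset_UNIV)
  with Int_stable_padic_balls show ?thesis
  proof (induction rule: sigma_sets_induct_disjoint)
    case (basic B)
    then consider "B = {}" | c j where "B = pball c j"
      by (auto simp: padic_balls_def)
    then show ?case
    proof cases
      case 1
      then show ?thesis
        using empty by (simp only: Int_empty_left)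
    next
      case (2 c j)
      then show ?thesis
        using pball_Int[of c j 0 R] ball empty by metis
    qed
  next
    case empty
    then show ?case
      using \<open>indicator {} \<in> L2_closure W\<close> by (simp only: Int_empty_left)
  next
    case (compl B)
    have eq: "indicator ((UNIV - B) \<inter> pball 0 R) = (indicator (pball 0 R) - indicator (B \<inter> pball 0 R) :: 'p padic \<Rightarrow> complex)"
      by (auto simp: fun_eq_iff indicator_def)
    show ?case
      unfolding eq by (rule cfun.subspace_diff[OF sub ball compl.IH])
  next
    case (union B)
    have disj: "(B i \<inter> pball 0 R) \<inter> (B j \<inter> pball 0 R) = {}" if "i \<noteq> j" for i j
      using union(1) that by (auto simp: disjoint_family_on_def)
    have sums: "(\<lambda>i. indicator (B i \<inter> pball 0 R) x :: real) sums indicator (\<Union>i. B i \<inter> pball 0 R) x" for x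
      by (rule indicator_sums) (rule disj)
    have Un: "(\<Union>i. B i) \<inter> pball 0 R = (\<Union>i. B i \<inter> pball 0 R)"
      by auto
    have "range B \<subseteq> sets borel"
      using union(2) by (simp add: sets_borel_padic)
    then have UB: "(\<Union>i. B i) \<in> sets borel"
      by auto
    show ?case
    proof (rule L2_closure_of_dominated_limit)
      show "indicator ((\<Union>i. B i) \<inter> pball 0 R) \<in> L2"
        by (rule meas[OF UB])
      show "(\<lambda>x. \<Sum>i<m. 1 * indicator (B i \<inter> pball 0 R) x) \<in> L2_closure W" for m
        by (intro cfun_subspace_sum_scale[OF sub] union.IH)
      have eq: "(\<Sum>i<m. 1 * indicator (B i \<inter> pball 0 R) x) = complex_of_real (\<Sum>i<m. indicator (B i \<inter> pball 0 R) x)" for m x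
        by (auto simp: indicator_def intro!: sum.cong)
      have eq': "indicator ((\<Union>i. B i) \<inter> pball 0 R) x = complex_of_real (indicator (\<Union>i. B i \<inter> pball 0 R) x)" for x
        by (auto simp: indicator_def)
      show "(\<lambda>m. \<Sum>i<m. 1 * indicator (B i \<inter> pball 0 R) x) \<longlonglongrightarrow> (indicator ((\<Union>i. B i) \<inter> pball 0 R) x :: complex)" for x
        unfolding eq eq' using sums[of x] by (intro tendsto_of_real) (simp add: sums_def)
      show "cmod (\<Sum>i<m. 1 * indicator (B i \<inter> pball 0 R) x) \<le> 2 * cmod (indicator ((\<Union>i. B i) \<inter> pball 0 R) x)" for m x
      proof -
        have "(\<Sum>i<m. indicator (B i \<inter> pball 0 R) x :: real) \<le> indicator (\<Union>i. B i \<inter> pball 0 R) x"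
          using sums[of x] by (intro sum_le_suminf[of _ "{..<m}", THEN order_trans]) (auto simp: sums_iff)
        moreover have "0 \<le> (\<Sum>i<m. indicator (B i \<inter> pball 0 R) x :: real)" "0 \<le> (indicator (\<Union>i. B i \<inter> pball 0 R) x :: real)"
          by (auto intro: sum_nonneg)
        ultimately show ?thesis
          unfolding eq eq' norm_of_real by simp
      qed
    qed
  qed
qed

text \<open>
  Simple functions dominated by \<open>2 \<bar>f\<bar>\<close> and cut off to growing balls converge to \<open>f\<close>.
\<close>

lemma L2_closure_pballs:
  fixes W :: "('p::prime_card padic \<Rightarrow> complex) set"
  assumes W: "cfun.subspace W" and balls: "\<And>c j. indicator (pball c j) \<in> W"
  shows "L2_closure W = L2"
proof
  show "L2_closure W \<subseteq> L2"
    by (rule L2_closure_subset_L2)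
  show "L2 \<subseteq> L2_closure W"
  proof
    fix f :: "'p padic \<Rightarrow> complex" assume f: "f \<in> L2"
    obtain F where F: "\<And>i. simple_function padic_haar (F i)"
      "\<And>x. x \<in> space padic_haar \<Longrightarrow> (\<lambda>i. F i x) \<longlonglongrightarrow> f x"
      "\<And>i x. x \<in> space padic_haar \<Longrightarrow> dist (F i x) 0 \<le> 2 * dist (f x) 0"
      using borel_measurable_implies_sequence_metric[OF L2_measurable[OF f], of 0] by blast
    have sub: "cfun.subspace (L2_closure W)"
      by (rule subspace_L2_closure[OF W])
    define G where "G i x = indicator (pball 0 (int i)) x * F i x" for i x
    show "f \<in> L2_closure W"
    proof (rule L2_closure_of_dominated_limit[where g=G, OF f])
      fix i
      have fin: "finite (range (F i))"
        using simple_functionD(1)[OF F(1)] by simp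
      have "G i = (\<lambda>x. \<Sum>y\<in>range (F i). y * indicator (F i -` {y} \<inter> pball 0 (int i)) x)"
      proof
        fix x
        have "(\<Sum>y\<in>range (F i). y * indicator (F i -` {y} \<inter> pball 0 (int i)) x) =
            (\<Sum>y\<in>range (F i). if y = F i x then indicator (pball 0 (int i)) x * F i x else 0)"
          by (intro sum.cong) (auto simp: indicator_def)
        then show "G i x = (\<Sum>y\<in>range (F i). y * indicator (F i -` {y} \<inter> pball 0 (int i)) x)"
          using fin by (simp add: G_def)
      qed
      moreover have "F i -` {y} \<in> sets borel" for y
        using simple_functionD(2)[OF F(1), of i "{y}"] by simp
      ultimately show "G i \<in> L2_closure W"
        using indicator_Int_pball_in_closure[OF W balls] by (simp add: cfun_subspace_sum_scale[OF sub])
    next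
      fix x :: "'p padic"
      obtain n where n: "x \<in> pball 0 (int n)"
        using in_pball_0_large by blast
      have "eventually (\<lambda>i. F i x = G i x) sequentially"
        using eventually_ge_at_top[of n]
      proof eventually_elim
        case (elim i)
        then have "x \<in> pball 0 (int i)"
          using n pball_mono[of "int n" "int i" "0 :: 'p padic"] by auto
        then show ?case
          by (simp add: G_def)
      qed
      then show "(\<lambda>i. G i x) \<longlonglongrightarrow> f x"
        using F(2)[of x] by (simp add: tendsto_cong)
    next
      fix i and x :: "'p padic"
      show "cmod (G i x) \<le> 2 * cmod (f x)"
        using F(3)[of x i] by (auto simp: G_def indicator_def)
    qed
  qed
qed

section \<open>Spans of translates\<close>

definition shift_span :: "('p::prime_card padic \<Rightarrow> complex) \<Rightarrow> ('p padic \<Rightarrow> complex) set" where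
  "shift_span \<phi> = cfun.span ((\<lambda>a x. \<phi> (x - a)) ` shifts)"

lemma subspace_shift_span: "cfun.subspace (shift_span \<phi>)"
  unfolding shift_span_def by (rule cfun.subspace_span)

lemma span_affine:
  assumes "\<And>g. g \<in> G \<Longrightarrow> (\<lambda>x. g (h x)) \<in> cfun.span G'" "f \<in> cfun.span G"
  shows "(\<lambda>x. f (h x)) \<in> cfun.span (G' :: ('a \<Rightarrow> complex) set)"
proof -
  have "cfun.subspace {f. (\<lambda>x. f (h x)) \<in> cfun.span G'}"
    unfolding cfun.subspace_def
  proof (intro conjI ballI allI CollectI)
    show "(\<lambda>x. 0 (h x)) \<in> cfun.span G'"
      using cfun.span_zero[of G'] by (simp add: zero_fun_def)
  next
    fix f g assume "f \<in> {f. (\<lambda>x. f (h x)) \<in> cfun.span G'}" "g \<in> {f. (\<lambda>x. f (h x)) \<in> cfun.span G'}"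
    then show "(\<lambda>x. (f + g) (h x)) \<in> cfun.span G'"
      using cfun.span_add[of "\<lambda>x. f (h x)" G' "\<lambda>x. g (h x)"] by (simp add: plus_fun_def)
  next
    fix c f assume "f \<in> {f. (\<lambda>x. f (h x)) \<in> cfun.span G'}"
    then show "(\<lambda>x. c * f (h x)) \<in> cfun.span G'"
      using cfun.span_scale[of "\<lambda>x. f (h x)" G' c] by simp
  qed
  then have "cfun.span G \<subseteq> {f. (\<lambda>x. f (h x)) \<in> cfun.span G'}"
    using assms(1) by (intro cfun.span_minimal) auto
  then show ?thesis
    using assms(2) by blast
qed

lemma L2_closure_affine:
  fixes f :: "'p::prime_card padic \<Rightarrow> complex"
  assumes f: "f \<in> L2_closure S"
    and S: "\<And>g. g \<in> S \<Longrightarrow> g \<in> L2 \<Longrightarrow> (\<lambda>x. g (ppow j * x - a)) \<in> T"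
  shows "(\<lambda>x. f (ppow j * x - a)) \<in> L2_closure T"
  unfolding L2_closure_iff
proof (intro conjI allI impI)
  have fL: "f \<in> L2"
    using f L2_closure_subset_L2 by blast
  then show "(\<lambda>x. f (ppow j * x - a)) \<in> L2"
    by (rule L2_affine)
  fix e :: real assume "e > 0"
  then have "e * real CARD('p) powi (- j) > 0"
    by simp
  from L2_closureD[OF f this] obtain g where g: "g \<in> S \<inter> L2" "L2_sq (\<lambda>x. f x - g x) < e * real CARD('p) powi (- j)"
    by blast
  have "L2_sq (\<lambda>x. f (ppow j * x - a) - g (ppow j * x - a)) = real CARD('p) powi j * L2_sq (\<lambda>x. f x - g x)"
    using L2_sq_affine[OF L2_diff[of f g]] fL g(1) by simp
  also have "\<dots> < real CARD('p) powi j * (e * real CARD('p) powi (- j))"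
    using g(2) by (intro mult_strict_left_mono) auto
  also have "\<dots> = e"
    using card_powi_cancel[of j, where 'p='p] by simp
  finally have "L2_sq (\<lambda>x. f (ppow j * x - a) - g (ppow j * x - a)) < e" .
  then show "\<exists>h\<in>T \<inter> L2. L2_sq (\<lambda>x. f (ppow j * x - a) - h x) < e"
    using g(1) S L2_affine by (intro bexI[of _ "\<lambda>x. g (ppow j * x - a)"]) auto
qed

lemma L2_translate: "f \<in> L2 \<Longrightarrow> (\<lambda>x. f (x - a :: 'p::prime_card padic)) \<in> L2"
  using L2_affine[of f 0 a] by simp

lemma divide_card_eq_ppow: "x / of_nat CARD('p) - a = ppow (- 1) * x - (a :: 'p::prime_card padic)"
  by (simp add: divide_card_eq mult.commute)

section \<open>Consequences of a multiresolution analysis\<close>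

text \<open>
  Once a finite set of shifts contains all mask positions, the partial sum over it equals \<open>\<phi>\<close>.
\<close>

lemma refinable_of_finite_mask:
  fixes \<phi> :: "'p::prime_card padic \<Rightarrow> complex"
  assumes "\<phi> \<in> L2"
    and eq: "\<phi> = (\<lambda>x. \<Sum>j<CARD('p) ^ m. c j * \<phi> (x / of_nat CARD('p) - grid (int m) (int j)))"
  shows "refinable \<phi>"
proof -
  let ?A = "(\<lambda>j. grid (int m) (int j) :: 'p padic) ` {..<CARD('p) ^ m}"
  have inj: "inj_on (\<lambda>j. grid (int m) (int j) :: 'p padic) {..<CARD('p) ^ m}"
  proof (rule inj_onI)
    fix i j assume ij: "i \<in> {..<CARD('p) ^ m}" "j \<in> {..<CARD('p) ^ m}"
      "(grid (int m) (int i) :: 'p padic) = grid (int m) (int j)"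
    then show "i = j"
      by (intro grid_eqI[where 'p='p and M=0 and N="int m"]) auto
  qed
  define \<alpha> where "\<alpha> a = (if a \<in> ?A then c (the_inv_into {..<CARD('p) ^ m} (\<lambda>j. grid (int m) (int j)) a) else 0)" for a
  have A: "finite ?A" "?A \<subseteq> shifts"
    using grid_in_shifts by auto
  have "eventually (\<lambda>F. L2_norm (\<lambda>x. \<phi> x - (\<Sum>a\<in>F. \<alpha> a * \<phi> (x / of_nat CARD('p) - a))) = 0) (finite_subsets_at_top shifts)"
    unfolding eventually_finite_subsets_at_top
  proof (intro exI[of _ ?A] conjI allI impI A)
    fix F :: "'p padic set" assume F: "finite F \<and> ?A \<subseteq> F \<and> F \<subseteq> shifts"
    have "(\<Sum>a\<in>F. \<alpha> a * \<phi> (x / of_nat CARD('p) - a)) = \<phi> x" for x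
    proof -
      have "(\<Sum>a\<in>F. \<alpha> a * \<phi> (x / of_nat CARD('p) - a)) = (\<Sum>a\<in>?A. \<alpha> a * \<phi> (x / of_nat CARD('p) - a))"
        using F by (intro sum.mono_neutral_right) (auto simp: \<alpha>_def)
      also have "\<dots> = (\<Sum>j<CARD('p) ^ m. \<alpha> (grid (int m) (int j)) * \<phi> (x / of_nat CARD('p) - grid (int m) (int j)))"
        using inj by (simp add: sum.reindex)
      also have "\<dots> = (\<Sum>j<CARD('p) ^ m. c j * \<phi> (x / of_nat CARD('p) - grid (int m) (int j)))"
        using the_inv_into_f_f[OF inj] by (intro sum.cong) (auto simp: \<alpha>_def)
      also have "\<dots> = \<phi> x"
        using fun_cong[OF eq, of x] by simp
      finally show ?thesis .
    qed
    then show "L2_norm (\<lambda>x. \<phi> x - (\<Sum>a\<in>F. \<alpha> a * \<phi> (x / of_nat CARD('p) - a))) = 0"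
      by (simp add: L2_norm_eq)
  qed
  from tendsto_eventually[OF this] assms(1) show ?thesis
    unfolding refinable_def by (intro conjI exI[of _ \<alpha>])
qed

text \<open>
  The generators of \<open>V\<^sub>0\<close> that are supported in the ball of radius \<open>p ^ n\<close> lie in \<open>V\<^sub>1\<close>, the closed span of the functions
  \<open>\<phi> (x / p - a)\<close> by the dilation axiom. They are therefore finite combinations of these functions, which is what the
  bound on the discrete Fourier transform requires; the combination for \<open>\<phi>\<close> itself is the refinement equation.
\<close>

lemma generates_MRA_necessary:
  fixes \<phi> :: "'p::prime_card padic \<Rightarrow> complex"
  assumes \<phi>: "step_fun M (int n) \<phi>" and Mn: "M + int n \<ge> 0" and nz: "\<phi> \<noteq> (\<lambda>_. 0)"
    and gen: "generates_MRA \<phi>"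
  shows "refinable \<phi>"
    and "card (unity_support (CARD('p) ^ nat (M + int n)) (\<lambda>k. \<phi> (grid (int n) k))) \<le> CARD('p) ^ n"
proof -
  obtain V where V: "multiresolution_analysis V" "scaling_function V \<phi>"
    using gen unfolding generates_MRA_def by blast
  have V0: "V 0 = L2_closure (shift_span \<phi>)"
    using V(2) by (simp add: scaling_function_def shift_span_def)
  have nest: "V 0 \<subseteq> V 1" and dil: "\<And>f. f \<in> V 0 \<longleftrightarrow> (\<lambda>x. f (x / of_nat CARD('p))) \<in> V 1"
    using V(1) unfolding multiresolution_analysis_def by (metis add_0)+
  let ?G = "(\<lambda>a x. \<phi> (x / of_nat CARD('p) - a)) ` shifts"
  have V1: "f \<in> L2_closure (cfun.span ?G)" if "f \<in> V 1" for f
  proof -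
    define g where "g x = f (of_nat CARD('p) * x)" for x
    have f: "f = (\<lambda>x. g (ppow (- 1) * x - 0))"
      by (simp add: g_def fun_eq_iff ppow_minus ppow_1 flip: mult.assoc)
    have "g \<in> L2_closure (shift_span \<phi>)"
      using that unfolding V0[symmetric] dil by (simp add: g_def)
    then show ?thesis
      unfolding f
    proof (rule L2_closure_affine)
      fix h assume "h \<in> shift_span \<phi>"
      then show "(\<lambda>x. h (ppow (- 1) * x - 0)) \<in> cfun.span ?G"
        unfolding shift_span_def
        by (rule span_affine[rotated]) (auto intro!: cfun.span_base simp: divide_card_eq mult.commute)
    qed
  qed
  have \<phi>L: "\<phi> \<in> L2"
    by (rule step_fun_L2(1)[OF \<phi> Mn])
  have rep: "\<exists>c. (\<lambda>x. \<phi> (x - grid (int n) (int i))) =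
      (\<lambda>x. \<Sum>j<CARD('p) ^ (n + 1). c j * \<phi> (x / of_nat CARD('p) - grid (int n + 1) (int j)))"
    if "i < CARD('p) ^ n" for i
  proof -
    have "(\<lambda>x. \<phi> (x - grid (int n) (int i))) \<in> shift_span \<phi>"
      unfolding shift_span_def using grid_in_shifts[OF that] by (auto intro: cfun.span_base)
    then have "(\<lambda>x. \<phi> (x - grid (int n) (int i))) \<in> V 1"
      using nest L2_closure_superset L2_translate[OF \<phi>L] unfolding V0 by blast
    then have lim: "(\<lambda>x. \<phi> (x - grid (int n) (int i))) \<in> L2_closure (cfun.span ?G)"
      by (rule V1)
    have "step_fun (M + 1) (int n) (\<lambda>x. \<phi> (x - grid (int n) (int i)))"
      by (rule step_fun_mono[OF step_fun_translate[OF \<phi> grid_in_pball]]) simp_all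
    then show ?thesis
      by (rule L2_closure_dilated_shifts_finite[OF \<phi> _ Mn lim]) (rule exI)
  qed
  then show "card (unity_support (CARD('p) ^ nat (M + int n)) (\<lambda>k. \<phi> (grid (int n) k))) \<le> CARD('p) ^ n"
    by (rule card_unity_support_le[OF \<phi> Mn nz])
  have "0 < CARD('p) ^ n"
    using card_gt_1[where 'p='p] by simp
  from rep[OF this] obtain c where
    "\<phi> = (\<lambda>x. \<Sum>j<CARD('p) ^ (n + 1). c j * \<phi> (x / of_nat CARD('p) - grid (int (n + 1)) (int j)))"
    by (auto simp: grid_def add.commute)
  then show "refinable \<phi>"
    by (rule refinable_of_finite_mask[OF \<phi>L])
qed

section \<open>Construction of the multiresolution analysis\<close>

text \<open>
  The refinement series may be infinite, but \<open>\<phi>\<close> is compactly supported, so the terms that meet its support suffice.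
\<close>

lemma finite_mask_of_refinable:
  fixes \<phi> :: "'p::prime_card padic \<Rightarrow> complex"
  assumes \<phi>: "step_fun M (int n) \<phi>" and Mn: "M + int n \<ge> 0" and ref: "refinable \<phi>"
  shows "\<exists>c. \<phi> = (\<lambda>x. \<Sum>j<CARD('p) ^ (n + 1). c j * \<phi> (x / of_nat CARD('p) - grid (int n + 1) (int j)))"
proof -
  let ?G = "(\<lambda>a x. \<phi> (x / of_nat CARD('p) - a)) ` shifts"
  obtain \<alpha> where lim: "((\<lambda>F. L2_norm (\<lambda>x. \<phi> x - (\<Sum>a\<in>F. \<alpha> a * \<phi> (x / of_nat CARD('p) - a)))) \<longlongrightarrow> 0)
       (finite_subsets_at_top shifts)"
    using ref unfolding refinable_def by blast
  have \<phi>L: "\<phi> \<in> L2"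
    by (rule step_fun_L2(1)[OF \<phi> Mn])
  have lim': "\<phi> \<in> L2_closure (cfun.span ?G)"
    unfolding L2_closure_def
  proof (intro CollectI conjI \<phi>L allI impI)
    fix e :: real assume "e > 0"
    define d where "d F = L2_norm (\<lambda>x. \<phi> x - (\<Sum>a\<in>F. \<alpha> a * \<phi> (x / of_nat CARD('p) - a)))" for F
    have "eventually (\<lambda>F. d F < e) (finite_subsets_at_top shifts)"
      unfolding d_def using \<open>e > 0\<close> by (rule order_tendstoD(2)[OF lim])
    then obtain F where F: "finite F" "F \<subseteq> shifts" "d F < e"
      unfolding eventually_finite_subsets_at_top by auto
    let ?g = "\<lambda>x. \<Sum>a\<in>F. \<alpha> a * \<phi> (x / of_nat CARD('p) - a)"
    have "?g \<in> cfun.span ?G"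
      using F(2) by (intro cfun_subspace_sum_scale[OF cfun.subspace_span] cfun.span_base) blast
    moreover have "?g \<in> L2"
      unfolding divide_card_eq_ppow by (intro cfun_subspace_sum_scale[OF subspace_L2] L2_affine \<phi>L)
    ultimately show "\<exists>g\<in>cfun.span ?G \<inter> L2. L2_norm (\<lambda>x. \<phi> x - g x) < e"
      using F(3) unfolding d_def by (intro bexI[of _ ?g]) auto
  qed
  have step: "step_fun (M + 1) (int n) \<phi>"
    by (rule step_fun_mono[OF \<phi>]) simp_all
  show ?thesis
    by (rule L2_closure_dilated_shifts_finite[OF \<phi> step Mn lim']) (rule exI)
qed

text \<open>
  Shifts do not form a group, so translates by sums of shifts need an argument. Up to a period of \<open>\<phi>\<close>, every \<open>a\<close> is a
  multiple \<open>k p ^ (- L)\<close> with \<open>L \<ge> n\<close>. Its digits at the positions from \<open>- n\<close> on make up \<open>t p ^ (- n)\<close>, and this part can be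
  exchanged for the first \<open>p ^ n\<close> multiples of \<open>p ^ (- n)\<close>. Together with the remaining digits, which occupy the positions
  below \<open>- n\<close>, these are shifts.
\<close>

lemma translate_in_shift_span:
  fixes \<phi> :: "'p::prime_card padic \<Rightarrow> complex"
  assumes \<phi>: "step_fun M (int n) \<phi>" and Mn: "M + int n \<ge> 0"
    and few: "\<And>t. \<exists>b. \<forall>x. \<phi> (x - grid (int n) (int t)) = (\<Sum>i<CARD('p) ^ n. b i * \<phi> (x - grid (int n) (int i)))"
  shows "(\<lambda>x. \<phi> (x - a)) \<in> shift_span \<phi>"
proof -
  obtain m where m: "a \<in> pball 0 (int m)"
    using in_pball_0_large by blast
  define L where "L = max m n"
  have "a \<in> pball 0 (int L)"
    using m pball_mono[of "int m" "int L" "0 :: 'p padic"] by (auto simp: L_def)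
  moreover have "M + int L \<ge> 0"
    using Mn by (simp add: L_def)
  ultimately obtain k where k: "padic_norm (a - grid (int L) (int k)) \<le> real CARD('p) powi (- M)"
    using grid_approx[of a "int L" M] unfolding pball_0_iff by blast
  define D where "D = CARD('p) ^ (L - n)"
  have D: "D > 0" "D * CARD('p) ^ n = CARD('p) ^ L"
    using card_gt_1[where 'p='p] by (simp_all add: D_def L_def flip: power_add)
  \<comment> \<open>\<open>s\<close> collects the digits of \<open>k p ^ (- L)\<close> at the positions below \<open>- n\<close>\<close>
  define s t where "s = k mod D" and "t = k div D"
  have lift: "grid (int n) i = (grid (int L) (i * int D) :: 'p padic)" for i
    using grid_lift[of "int n" i "L - n", where 'p='p] by (simp add: L_def D_def of_nat_diff)
  have split: "(grid (int L) (int k) :: 'p padic) = grid (int L) (int s) + grid (int n) (int t)"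
    unfolding lift grid_add s_def t_def by (simp flip: of_nat_mult of_nat_add)
  obtain b where b: "\<And>x. \<phi> (x - grid (int n) (int t)) = (\<Sum>i<CARD('p) ^ n. b i * \<phi> (x - grid (int n) (int i)))"
    using few by metis
  have "(\<lambda>x. \<phi> (x - a)) = (\<lambda>x. \<Sum>i<CARD('p) ^ n. b i * \<phi> (x - grid (int L) (int (s + i * D))))"
  proof
    fix x
    have "\<phi> (x - a) = \<phi> (x - grid (int L) (int k))"
      using k by (intro step_funD(1)[OF \<phi>]) (simp add: padic_norm_diff_commute)
    also have "\<dots> = \<phi> ((x - grid (int L) (int s)) - grid (int n) (int t))"
      by (simp add: split diff_diff_eq)
    also have "\<dots> = (\<Sum>i<CARD('p) ^ n. b i * \<phi> (x - grid (int L) (int s) - grid (int n) (int i)))"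
      by (rule b)
    also have "\<dots> = (\<Sum>i<CARD('p) ^ n. b i * \<phi> (x - grid (int L) (int (s + i * D))))"
      unfolding lift diff_diff_eq grid_add by simp
    finally show "\<phi> (x - a) = (\<Sum>i<CARD('p) ^ n. b i * \<phi> (x - grid (int L) (int (s + i * D))))" .
  qed
  also have "\<dots> \<in> shift_span \<phi>"
  proof (intro cfun_subspace_sum_scale subspace_shift_span)
    fix i assume "i \<in> {..<CARD('p) ^ n}"
    have "s + i * D < D + i * D"
      using D(1) by (simp add: s_def)
    also have "\<dots> = Suc i * D"
      by simp
    also have "\<dots> \<le> CARD('p) ^ n * D"
      using \<open>i \<in> _\<close> by (intro mult_right_mono) auto
    finally have "s + i * D < CARD('p) ^ L"
      using D(2) by (simp add: mult.commute)
    then show "(\<lambda>x. \<phi> (x - grid (int L) (int (s + i * D)))) \<in> shift_span \<phi>"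
      unfolding shift_span_def using grid_in_shifts by (intro cfun.span_base) blast
  qed
  finally show ?thesis .
qed

text \<open>
  The sum runs over all cosets of the period ball in the support ball, so it does not depend on the point of
  the support ball at which it is evaluated.
\<close>

lemma sum_grid_translates:
  fixes \<phi> :: "'p::prime_card padic \<Rightarrow> complex"
  assumes \<phi>: "step_fun M N \<phi>" and MN: "M + N \<ge> 0"
  shows "(\<Sum>k<CARD('p) ^ nat (M + N). \<phi> (x - grid N (int k))) =
    (\<Sum>k<CARD('p) ^ nat (M + N). \<phi> (grid N (int k))) * indicator (pball 0 N) x"
proof -
  let ?Q = "CARD('p) ^ nat (M + N)"
  let ?C = "\<Sum>k<?Q. \<phi> (grid N (int k))"
  have "(\<lambda>x. \<Sum>k<?Q. \<phi> (x - grid N (int k))) = (\<lambda>x. ?C * indicator (pball 0 N) x)"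
  proof (rule step_fun_eqI[OF _ _ MN])
    show "step_fun M N (\<lambda>x. \<Sum>k<?Q. \<phi> (x - grid N (int k)))"
      by (intro step_fun_sum step_fun_translate[OF \<phi>]) simp
    have "step_fun (- N) N (indicator (pball 0 N) :: 'p padic \<Rightarrow> complex)"
      using indicator_pball_step[of 0 N N] by simp
    then show "step_fun M N (\<lambda>x. ?C * indicator (pball (0 :: 'p padic) N) x)"
      using MN by (intro step_fun_comp[where h="\<lambda>x. _ * x"] step_fun_mono[of "- N" N _ M N]) auto
    show "(\<Sum>k<?Q. \<phi> (grid N (int l) - grid N (int k))) = ?C * indicator (pball 0 N) (grid N (int l) :: 'p padic)"
      if "l < ?Q" for l
    proof -
      let ?u = "\<lambda>k. \<phi> (grid N k)"
      \<comment> \<open>reversing the order of summation turns the reflected argument into a shifted one\<close>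
      have "(\<Sum>k<?Q. \<phi> (grid N (int l) - grid N (int k))) = (\<Sum>k<?Q. ?u (int l - int (?Q - Suc k)))"
        by (simp only: grid_diff sum.nat_diff_reindex[of "\<lambda>k. ?u (int l - int k)"])
      also have "\<dots> = unity_sum ?Q (\<lambda>k. ?u (k - int (?Q - 1 - l))) 1"
        unfolding unity_sum_def using that by (intro sum.cong) (auto simp: of_nat_diff algebra_simps)
      also have "\<dots> = ?C"
        using unity_sum_shift[of ?u ?Q 1 "?Q - 1 - l", OF step_fun_grid_periodic[OF \<phi> MN]] that
        by (simp add: unity_sum_def)
      finally show ?thesis
        by simp
    qed
  qed
  then show ?thesis
    by (simp add: fun_eq_iff)
qed

text \<open>
  The dilation axiom leaves this as the only choice of \<open>V\<^sub>j\<close> once \<open>V\<^sub>0\<close> is the closed span of the shifts of \<open>\<phi>\<close>.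
\<close>

definition dilated_space :: "('p::prime_card padic \<Rightarrow> complex) \<Rightarrow> int \<Rightarrow> ('p padic \<Rightarrow> complex) set" where
  "dilated_space \<phi> j = {f \<in> L2. (\<lambda>x. f (ppow j * x)) \<in> L2_closure (shift_span \<phi>)}"

lemma L2_dilate: "f \<in> L2 \<Longrightarrow> (\<lambda>x. f (ppow j * x :: 'p::prime_card padic)) \<in> L2"
  using L2_affine[of f j 0] by simp

lemma L2_sq_dilate: "f \<in> L2 \<Longrightarrow> L2_sq (\<lambda>x. f (ppow j * x :: 'p::prime_card padic)) = real CARD('p) powi j * L2_sq f"
  using L2_sq_affine[of f j 0] by simp

lemma L2_closure_dilate:
  fixes f :: "'p::prime_card padic \<Rightarrow> complex"
  assumes "f \<in> L2_closure S" "\<And>g. g \<in> S \<Longrightarrow> g \<in> L2 \<Longrightarrow> (\<lambda>x. g (ppow j * x)) \<in> T"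
  shows "(\<lambda>x. f (ppow j * x)) \<in> L2_closure T"
  using L2_closure_affine[of f S j 0 T] assms by simp

lemma dilated_space_0: "dilated_space \<phi> 0 = L2_closure (shift_span (\<phi> :: 'p::prime_card padic \<Rightarrow> complex))"
  using L2_closure_subset_L2 by (auto simp: dilated_space_def)

lemma L2_closed_subspace_dilated_space:
  "L2_closed_subspace (dilated_space (\<phi> :: 'p::prime_card padic \<Rightarrow> complex) j)"
  unfolding L2_closed_subspace_def
proof (intro conjI)
  have sub: "cfun.subspace (L2_closure (shift_span \<phi>))"
    by (rule subspace_L2_closure[OF subspace_shift_span])
  show subL2: "dilated_space \<phi> j \<subseteq> L2"
    by (auto simp: dilated_space_def)
  show "cfun.subspace (dilated_space \<phi> j)"
    unfolding cfun.subspace_def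
  proof (intro conjI ballI allI)
    show "0 \<in> dilated_space \<phi> j"
      using cfun.subspace_0[OF sub] L2_0 by (simp add: zero_fun_def dilated_space_def)
  next
    fix f g assume "f \<in> dilated_space \<phi> j"
      "g \<in> dilated_space \<phi> j"
    then show "f + g \<in> dilated_space \<phi> j"
      using cfun.subspace_add[OF sub, of "\<lambda>x. f (ppow j * x)" "\<lambda>x. g (ppow j * x)"] L2_add[of f g]
      by (simp add: plus_fun_def dilated_space_def)
  next
    fix c f assume "f \<in> dilated_space \<phi> j"
    then show "(\<lambda>x. c * f x) \<in> dilated_space \<phi> j"
      using cfun.subspace_scale[OF sub, of "\<lambda>x. f (ppow j * x)" c] L2_scale[of f c]
      by (simp add: dilated_space_def)
  qed
  show "L2_closure (dilated_space \<phi> j) = dilated_space \<phi> j"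
  proof
    show "dilated_space \<phi> j \<subseteq> L2_closure (dilated_space \<phi> j)"
      using L2_closure_superset subL2 by blast
    show "L2_closure (dilated_space \<phi> j) \<subseteq> dilated_space \<phi> j"
    proof
      fix f assume f: "f \<in> L2_closure (dilated_space \<phi> j)"
      then have "(\<lambda>x. f (ppow j * x)) \<in> L2_closure (L2_closure (shift_span \<phi>))"
        by (rule L2_closure_dilate) (simp add: dilated_space_def)
      then show "f \<in> dilated_space \<phi> j"
        using f L2_closure_subset_L2 by (auto simp: dilated_space_def L2_closure_idem)
    qed
  qed
qed

lemma dilated_space_dilate_iff:
  fixes f :: "'p::prime_card padic \<Rightarrow> complex"
  shows "f \<in> dilated_space \<phi> j \<longleftrightarrow> (\<lambda>x. f (x / of_nat CARD('p))) \<in> dilated_space \<phi> (j + 1)"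
proof -
  have dil: "(\<lambda>x. f (x / of_nat CARD('p))) = (\<lambda>x. f (ppow (- 1) * x))"
    by (simp add: divide_card_eq mult.commute)
  have "f = (\<lambda>x. f (ppow (- 1) * (ppow 1 * x)))"
    by (simp flip: mult.assoc ppow_add)
  then have "f \<in> L2 \<longleftrightarrow> (\<lambda>x. f (ppow (- 1) * x)) \<in> L2"
    using L2_dilate[of "\<lambda>x. f (ppow (- 1) * x)" 1] L2_dilate[of f "- 1"] by auto
  moreover have "(\<lambda>x. f (ppow (- 1) * (ppow (j + 1) * x))) = (\<lambda>x. f (ppow j * x))"
    by (simp flip: mult.assoc ppow_add)
  ultimately show ?thesis
    by (simp add: dilated_space_def dil)
qed

lemma shift_span_translate:
  fixes \<phi> g :: "'p::prime_card padic \<Rightarrow> complex"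
  assumes trans: "\<And>a. (\<lambda>x. \<phi> (x - a)) \<in> shift_span \<phi>" and g: "g \<in> shift_span \<phi>"
  shows "(\<lambda>x. g (x - a)) \<in> shift_span \<phi>"
  using g unfolding shift_span_def
proof (rule span_affine[rotated])
  fix h assume "h \<in> (\<lambda>a x. \<phi> (x - a)) ` shifts"
  then obtain b where "h = (\<lambda>x. \<phi> (x - b))"
    by blast
  then show "(\<lambda>x. h (x - a)) \<in> cfun.span ((\<lambda>a x. \<phi> (x - a)) ` shifts)"
    using trans[of "a + b"] by (simp add: shift_span_def diff_diff_eq)
qed

text \<open>
  By the mask equation \<open>\<phi> (p x - a)\<close> is a combination of the translates of \<open>\<phi>\<close> by \<open>a / p + b j\<close>. These are not shifts in
  general, which is why the span has to contain all translates.
\<close>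

lemma shift_span_dilate:
  fixes \<phi> g :: "'p::prime_card padic \<Rightarrow> complex"
  assumes trans: "\<And>a. (\<lambda>x. \<phi> (x - a)) \<in> shift_span \<phi>" and g: "g \<in> shift_span \<phi>"
    and mask: "\<phi> = (\<lambda>x. \<Sum>j\<in>J. c j * \<phi> (x / of_nat CARD('p) - b j))"
  shows "(\<lambda>x. g (ppow 1 * x)) \<in> shift_span \<phi>"
  using g unfolding shift_span_def
proof (rule span_affine[rotated])
  fix h assume "h \<in> (\<lambda>a x. \<phi> (x - a)) ` shifts"
  then obtain a where h: "h = (\<lambda>x. \<phi> (x - a))"
    by blast
  have "(\<lambda>x. h (ppow 1 * x)) = (\<lambda>x. \<Sum>j\<in>J. c j * \<phi> (x - (a / of_nat CARD('p) + b j)))"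
  proof
    fix x :: "'p padic"
    have "(ppow 1 * x - a) / of_nat CARD('p) = x - a / of_nat CARD('p)"
      by (simp add: ppow_1 diff_divide_distrib)
    then show "h (ppow 1 * x) = (\<Sum>j\<in>J. c j * \<phi> (x - (a / of_nat CARD('p) + b j)))"
      unfolding h by (subst mask) (simp add: diff_diff_eq)
  qed
  also have "\<dots> \<in> shift_span \<phi>"
    by (intro cfun_subspace_sum_scale subspace_shift_span trans)
  finally show "(\<lambda>x. h (ppow 1 * x)) \<in> cfun.span ((\<lambda>a x. \<phi> (x - a)) ` shifts)"
    by (simp add: shift_span_def)
qed

lemma dilated_space_nested:
  fixes \<phi> :: "'p::prime_card padic \<Rightarrow> complex"
  assumes "\<And>g. g \<in> shift_span \<phi> \<Longrightarrow> (\<lambda>x. g (ppow 1 * x)) \<in> shift_span \<phi>"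
  shows "dilated_space \<phi> j \<subseteq> dilated_space \<phi> (j + 1)"
proof
  fix f assume f: "f \<in> dilated_space \<phi> j"
  then have "(\<lambda>x. f (ppow j * (ppow 1 * x))) \<in> L2_closure (shift_span \<phi>)"
    using L2_closure_dilate[of "\<lambda>x. f (ppow j * x)" "shift_span \<phi>" 1] assms
    by (simp add: dilated_space_def)
  moreover have "(\<lambda>x. f (ppow j * (ppow 1 * x))) = (\<lambda>x. f (ppow (j + 1) * x))"
    by (simp add: ppow_add mult.assoc)
  ultimately show "f \<in> dilated_space \<phi> (j + 1)"
    using f by (simp add: dilated_space_def)
qed

text \<open>
  Translates and dilates of a single ball are all balls, and their indicators span a dense subspace.
\<close>

lemma L2_closure_Union_dilated_space:
  fixes \<phi> :: "'p::prime_card padic \<Rightarrow> complex"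
  assumes nested: "\<And>j. dilated_space \<phi> j \<subseteq> dilated_space \<phi> (j + 1)"
    and trans: "\<And>g a. g \<in> shift_span \<phi> \<Longrightarrow> (\<lambda>x. g (x - a)) \<in> shift_span \<phi>"
    and ind: "indicator (pball 0 N) \<in> shift_span \<phi>"
  shows "L2_closure (\<Union>j. dilated_space \<phi> j) = L2"
proof (rule L2_closure_pballs)
  have mono: "dilated_space \<phi> i \<subseteq> dilated_space \<phi> (i + int d)" for i d
  proof (induction d)
    case (Suc d)
    then show ?case
      using nested[of "i + int d"] by (auto simp: algebra_simps)
  qed simp
  have mono': "dilated_space \<phi> i \<subseteq> dilated_space \<phi> k" if "i \<le> k" for i k
    using mono[of i "nat (k - i)"] that by simp
  have sub: "cfun.subspace (dilated_space \<phi> j)" for j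
    using L2_closed_subspace_dilated_space by (auto simp: L2_closed_subspace_def)
  show "cfun.subspace (\<Union>j. dilated_space \<phi> j)"
    unfolding cfun.subspace_def
  proof (intro conjI ballI allI)
    show "0 \<in> (\<Union>j. dilated_space \<phi> j)"
      using cfun.subspace_0[OF sub] by blast
  next
    fix f g assume "f \<in> (\<Union>j. dilated_space \<phi> j)" "g \<in> (\<Union>j. dilated_space \<phi> j)"
    then obtain i k where "f \<in> dilated_space \<phi> i" "g \<in> dilated_space \<phi> k"
      by blast
    then have "f \<in> dilated_space \<phi> (max i k)" "g \<in> dilated_space \<phi> (max i k)"
      using mono'[of i "max i k"] mono'[of k "max i k"] by auto
    then show "f + g \<in> (\<Union>j. dilated_space \<phi> j)"
      using cfun.subspace_add[OF sub] by blast
  next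
    fix c f assume "f \<in> (\<Union>j. dilated_space \<phi> j)"
    then show "(\<lambda>x. c * f x) \<in> (\<Union>j. dilated_space \<phi> j)"
      using cfun.subspace_scale[OF sub] by blast
  qed
  show "indicator (pball c i) \<in> (\<Union>j. dilated_space \<phi> j)" for c :: "'p padic" and i
  proof -
    let ?a = "c * ppow (i - N)"
    have iff: "ppow (N - i) * x \<in> pball c i \<longleftrightarrow> x - ?a \<in> pball 0 N" for x
    proof -
      have "ppow (N - i) * x - 0 \<in> pball c i \<longleftrightarrow> x \<in> pball ((c + 0) * ppow (- (N - i))) (i + (N - i))"
        by (rule affine_pball_iff)
      then show ?thesis
        by (simp add: pball_def)
    qed
    have "(\<lambda>x. indicator (pball c i) (ppow (N - i) * x)) = (\<lambda>x. indicator (pball 0 N) (x - ?a) :: complex)"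
      using iff by (simp add: indicator_def)
    then have "(\<lambda>x. indicator (pball c i) (ppow (N - i) * x)) \<in> shift_span \<phi>"
      using trans[OF ind, of ?a] by simp
    then have "indicator (pball c i) \<in> dilated_space \<phi> (N - i)"
      unfolding dilated_space_def
      using indicator_pball_L2[of c i] L2_closure_superset L2_dilate[OF indicator_pball_L2[of c i]] by blast
    then show ?thesis
      by blast
  qed
qed

text \<open>
  A function that is constant on a large ball distributes its mass evenly there, so a fixed smaller ball
  receives only a small share.
\<close>

lemma L2_sq_restrict_small:
  fixes h :: "'p::prime_card padic \<Rightarrow> complex"
  assumes h: "h \<in> L2" and const: "\<And>x. x \<in> pball 0 R \<Longrightarrow> h x = h 0" and KR: "K \<le> R"
  shows "L2_sq (\<lambda>x. indicator (pball 0 K) x * h x) \<le> real CARD('p) powi (K - R) * L2_sq h"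
proof -
  have mass: "L2_sq (\<lambda>x. indicator (pball 0 j) x * h x) = (cmod (h 0))\<^sup>2 * real CARD('p) powi j" if "j \<le> R" for j
  proof -
    have "(cmod (indicator (pball 0 j) x * h x))\<^sup>2 = indicator (pball 0 j) x * (cmod (h 0))\<^sup>2" for x
    proof (cases "x \<in> pball 0 j")
      case True
      then have "h x = h 0"
        using const pball_mono[OF that, of "0 :: 'p padic"] by blast
      with True show ?thesis
        by simp
    qed simp
    then show ?thesis
      by (simp add: L2_sq_def)
  qed
  have "L2_sq (\<lambda>x. indicator (pball 0 K) x * h x) = real CARD('p) powi (K - R) * L2_sq (\<lambda>x. indicator (pball 0 R) x * h x)"
    using mass[OF KR] mass[of R] card_powi_add[of "K - R" R, where 'p='p] by simp
  also have "\<dots> \<le> real CARD('p) powi (K - R) * L2_sq h"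
    by (intro mult_left_mono L2_restrict(2) h) (auto simp: less_imp_le)
  finally show ?thesis .
qed

text \<open>
  Elements of the span are invariant under the ball of radius \<open>p ^ (- M)\<close>. Dilation to the space with index \<open>- j\<close>
  stretches this ball to radius \<open>p ^ (j - M)\<close>, so an element of the intersection is a limit of functions that are
  constant on arbitrarily large balls.
\<close>

lemma Inter_dilated_space:
  fixes \<phi> :: "'p::prime_card padic \<Rightarrow> complex"
  assumes inv: "\<And>g x y. g \<in> shift_span \<phi> \<Longrightarrow> padic_norm (y - x) \<le> real CARD('p) powi (- M) \<Longrightarrow> g y = g x"
  shows "(\<Inter>j. dilated_space \<phi> j) = {f \<in> L2. AE x in padic_haar. f x = 0}"
proof (intro equalityI subsetI)
  fix f assume f: "f \<in> (\<Inter>j. dilated_space \<phi> j)"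
  then have fL: "f \<in> L2"
    by (auto simp: dilated_space_def)
  have "L2_sq (\<lambda>x. indicator (pball 0 K) x * f x) \<le> e" if e: "e > 0" for K e
  proof -
    define A where "A = 2 * L2_sq f + e"
    have A: "A > 0"
      using e by (simp add: A_def add_nonneg_pos)
    obtain d where d: "real CARD('p) powi (- int d) < e / (4 * A)"
      using exists_card_powi_less[of "e / (4 * A)"] e A by auto
    \<comment> \<open>elements of the space with index \<open>- j\<close> are constant on the ball of radius \<open>p ^ R\<close>, and the ball of radius \<open>p ^ K\<close>
      is the share \<open>p ^ (- d)\<close> of it\<close>
    define R where "R = K + int d"
    define j where "j = R + M"
    have pos: "e / 4 * real CARD('p) powi (- j) > 0"
      using e by simp
    have "(\<lambda>x. f (ppow (- j) * x)) \<in> L2_closure (shift_span \<phi>)"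
      using f by (simp add: dilated_space_def)
    from L2_closureD[OF this pos] obtain g where g: "g \<in> shift_span \<phi>" "g \<in> L2"
      "L2_sq (\<lambda>x. f (ppow (- j) * x) - g x) < e / 4 * real CARD('p) powi (- j)"
      by blast
    define h where "h x = g (ppow j * x)" for x
    have hL: "h \<in> L2"
      unfolding h_def by (rule L2_dilate[OF g(2)])
    have "L2_sq (\<lambda>x. f x - h x) = L2_sq (\<lambda>x. (\<lambda>y. f (ppow (- j) * y) - g y) (ppow j * x))"
      by (simp add: h_def flip: mult.assoc ppow_add)
    also have "\<dots> = real CARD('p) powi j * L2_sq (\<lambda>x. f (ppow (- j) * x) - g x)"
      by (rule L2_sq_dilate[OF L2_diff[OF L2_dilate[OF fL] g(2)]])
    also have "\<dots> < real CARD('p) powi j * (e / 4 * real CARD('p) powi (- j))"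
      using g(3) by (intro mult_strict_left_mono) auto
    also have "\<dots> = e / 4"
      using card_powi_cancel(1)[of j, where 'p='p] by simp
    finally have fh: "L2_sq (\<lambda>x. f x - h x) < e / 4" .
    have const: "h x = h 0" if "x \<in> pball 0 R" for x
      unfolding h_def
    proof (rule inv[OF g(1)])
      have "padic_norm (ppow j * x - ppow j * 0) = real CARD('p) powi (- j) * padic_norm x"
        by (simp add: padic_norm_mult)
      also have "\<dots> \<le> real CARD('p) powi (- j) * real CARD('p) powi R"
        using that unfolding pball_0_iff by (intro mult_left_mono) (auto simp: less_imp_le)
      also have "\<dots> = real CARD('p) powi (- M)"
        by (subst card_powi_add[symmetric]) (simp add: j_def)
      finally show "padic_norm (ppow j * x - ppow j * 0) \<le> real CARD('p) powi (- M)" .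
    qed
    have KR: "K \<le> R"
      by (simp add: R_def)
    have "L2_sq (\<lambda>x. indicator (pball 0 K) x * h x) \<le> real CARD('p) powi (K - R) * L2_sq h"
      by (rule L2_sq_restrict_small[OF hL _ KR]) (rule const)
    also have "\<dots> \<le> real CARD('p) powi (- int d) * A"
    proof -
      have "L2_sq h \<le> 2 * L2_sq (\<lambda>x. h x - f x) + 2 * L2_sq f"
        using L2_sq_triangle[OF hL fL L2_0] by simp
      also have "\<dots> \<le> A"
        using fh L2_sq_commute[of h f] e by (simp add: A_def)
      finally show ?thesis
        unfolding R_def by (intro mult_mono) (auto simp: less_imp_le)
    qed
    also have "\<dots> \<le> e / (4 * A) * A"
      using d A by (intro mult_right_mono) auto
    also have "\<dots> = e / 4"
      using A by simp
    finally have small: "L2_sq (\<lambda>x. indicator (pball 0 K) x * h x) \<le> e / 4" .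
    have "(\<lambda>x. indicator (pball 0 K) x * f x) =
        (\<lambda>x. indicator (pball 0 K) x * (f x - h x) + indicator (pball 0 K) x * h x)"
      by (simp add: fun_eq_iff right_diff_distrib)
    then have "L2_sq (\<lambda>x. indicator (pball 0 K) x * f x) \<le>
        2 * L2_sq (\<lambda>x. indicator (pball 0 K) x * (f x - h x)) + 2 * L2_sq (\<lambda>x. indicator (pball 0 K) x * h x)"
      using L2_sq_add_le[OF L2_restrict(1)[OF L2_diff[OF fL hL] pball_borel] L2_restrict(1)[OF hL pball_borel]]
      by simp
    also have "\<dots> \<le> 2 * L2_sq (\<lambda>x. f x - h x) + 2 * (e / 4)"
      using L2_restrict(2)[OF L2_diff[OF fL hL] pball_borel[of 0 K]] small by linarith
    also have "\<dots> \<le> e"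
      using fh by simp
    finally show ?thesis .
  qed
  then have "L2_sq (\<lambda>x. indicator (pball 0 K) x * f x) = 0" for K
    using field_le_epsilon[of "L2_sq (\<lambda>x. indicator (pball 0 K) x * f x)" 0] by (simp add: order_antisym)
  then have "AE x in padic_haar. (cmod (indicator (pball 0 (int K)) x * f x))\<^sup>2 = 0" for K
    using integral_nonneg_eq_0_iff_AE[OF L2_integrable[OF L2_restrict(1)[OF fL pball_borel]]]
    by (simp add: L2_sq_def)
  then have "AE x in padic_haar. \<forall>K. (cmod (indicator (pball 0 (int K)) x * f x))\<^sup>2 = 0"
    unfolding AE_all_countable by (rule allI)
  then have "AE x in padic_haar. f x = 0"
  proof eventually_elim
    case (elim x)
    obtain K where "x \<in> pball 0 (int K)"
      using in_pball_0_large by blast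
    then show ?case
      using elim[rule_format, of K] by simp
  qed
  then show "f \<in> {f \<in> L2. AE x in padic_haar. f x = 0}"
    using fL by simp
next
  fix f :: "'p padic \<Rightarrow> complex" assume "f \<in> {f \<in> L2. AE x in padic_haar. f x = 0}"
  then have fL: "f \<in> L2" and ae: "AE x in padic_haar. f x = 0"
    by auto
  have "L2_sq f = (\<integral>x. 0 \<partial>(padic_haar :: 'p padic measure))"
    unfolding L2_sq_def using ae L2_measurable[OF fL] by (intro integral_cong_AE) auto
  then have f0: "L2_sq f = 0"
    by simp
  have "(\<lambda>x. f (ppow j * x)) \<in> L2_closure (shift_span \<phi>)" for j
    unfolding L2_closure_iff
  proof (intro conjI allI impI L2_dilate fL)
    fix e :: real assume "e > 0"
    then have "L2_sq (\<lambda>x. f (ppow j * x) - 0) < e"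
      using f0 by (simp add: L2_sq_dilate[OF fL])
    moreover have "(\<lambda>_. 0) \<in> shift_span \<phi>"
      using cfun.subspace_0[OF subspace_shift_span] by (simp add: zero_fun_def)
    ultimately show "\<exists>g\<in>shift_span \<phi> \<inter> L2. L2_sq (\<lambda>x. f (ppow j * x) - g x) < e"
      using L2_0 by (intro bexI[of _ "\<lambda>_. 0"]) auto
  qed
  then show "f \<in> (\<Inter>j. dilated_space \<phi> j)"
    using fL by (simp add: dilated_space_def)
qed

text \<open>
  The bound on the support of the discrete Fourier transform makes the span of the shifts invariant under all
  translations. Together with the mask equation this gives the inclusions \<open>V\<^sub>j \<subseteq> V\<^bsub>j+1\<^esub>\<close>, and with the nonzero mean it puts the indicator of a ball into \<open>V\<^sub>0\<close>, which
  yields density.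
\<close>

lemma generates_MRA_sufficient:
  fixes \<phi> :: "'p::prime_card padic \<Rightarrow> complex"
  assumes \<phi>: "step_fun M (int n) \<phi>" and Mn: "M + int n \<ge> 0" and ref: "refinable \<phi>"
    and mean: "(\<Sum>k<CARD('p) ^ nat (M + int n). \<phi> (grid (int n) (int k))) \<noteq> 0"
    and card: "card (unity_support (CARD('p) ^ nat (M + int n)) (\<lambda>k. \<phi> (grid (int n) k))) \<le> CARD('p) ^ n"
  shows "generates_MRA \<phi>"
proof -
  have trans_\<phi>: "(\<lambda>x. \<phi> (x - a)) \<in> shift_span \<phi>" for a
    by (rule translate_in_shift_span[OF \<phi> Mn translate_in_span_few[OF \<phi> Mn card]])
  have trans: "(\<lambda>x. g (x - a)) \<in> shift_span \<phi>" if "g \<in> shift_span \<phi>" for g a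
    by (rule shift_span_translate[OF trans_\<phi> that])
  obtain c where mask: "\<phi> = (\<lambda>x. \<Sum>j<CARD('p) ^ (n + 1). c j * \<phi> (x / of_nat CARD('p) - grid (int n + 1) (int j)))"
    using finite_mask_of_refinable[OF \<phi> Mn ref] by (elim exE)
  have nested: "dilated_space \<phi> j \<subseteq> dilated_space \<phi> (j + 1)" for j
    by (rule dilated_space_nested, rule shift_span_dilate[OF trans_\<phi> _ mask])
  let ?Q = "CARD('p) ^ nat (M + int n)" and ?C = "\<Sum>k<CARD('p) ^ nat (M + int n). \<phi> (grid (int n) (int k))"
  have "indicator (pball 0 (int n)) = (\<lambda>x. \<Sum>k<?Q. inverse ?C * \<phi> (x - grid (int n) (int k)))"
    using mean by (simp add: fun_eq_iff sum_grid_translates[OF \<phi> Mn] flip: sum_distrib_left)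
  also have "\<dots> \<in> shift_span \<phi>"
    by (intro cfun_subspace_sum_scale subspace_shift_span trans_\<phi>)
  finally have ind: "indicator (pball 0 (int n)) \<in> shift_span \<phi>" .
  have "cfun.subspace {g. \<forall>x y. padic_norm (y - x) \<le> real CARD('p) powi (- M) \<longrightarrow> (g y :: complex) = g x}"
    unfolding cfun.subspace_def by auto
  moreover have "(\<lambda>a x. \<phi> (x - a)) ` shifts \<subseteq> {g. \<forall>x y. padic_norm (y - x) \<le> real CARD('p) powi (- M) \<longrightarrow> g y = g x}"
    using step_funD(1)[OF \<phi>] by auto
  ultimately have "shift_span \<phi> \<subseteq> {g. \<forall>x y. padic_norm (y - x) \<le> real CARD('p) powi (- M) \<longrightarrow> g y = g x}"
    unfolding shift_span_def by (rule cfun.span_minimal[rotated])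
  then have inv: "g y = g x" if "g \<in> shift_span \<phi>" "padic_norm (y - x) \<le> real CARD('p) powi (- M)" for g x y
    using that by blast
  have "\<phi> \<in> shift_span \<phi>"
    using trans_\<phi>[of 0] by simp
  then have scaling: "scaling_function (dilated_space \<phi>) \<phi>"
    unfolding scaling_function_def dilated_space_0
    using L2_closure_superset step_fun_L2(1)[OF \<phi> Mn] by (auto simp: shift_span_def)
  have "multiresolution_analysis (dilated_space \<phi>)"
    unfolding multiresolution_analysis_def
  proof (intro conjI allI)
    show "L2_closed_subspace (dilated_space \<phi> j)" for j
      by (rule L2_closed_subspace_dilated_space)
    show "dilated_space \<phi> j \<subseteq> dilated_space \<phi> (j + 1)" for j
      by (rule nested)
    show "L2_closure (\<Union>j. dilated_space \<phi> j) = L2"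
      by (rule L2_closure_Union_dilated_space[OF nested trans ind])
    show "(\<Inter>j. dilated_space \<phi> j) = {f \<in> L2. AE x in padic_haar. f x = 0}"
      by (rule Inter_dilated_space[OF inv])
    show "f \<in> dilated_space \<phi> j \<longleftrightarrow> (\<lambda>x. f (x / of_nat CARD('p))) \<in> dilated_space \<phi> (j + 1)" for j f
      by (rule dilated_space_dilate_iff)
    show "\<exists>\<psi>. scaling_function (dilated_space \<phi>) \<psi>"
      using scaling by blast
  qed
  then show ?thesis
    using scaling unfolding generates_MRA_def by blast
qed

section \<open>The criterion\<close>

text \<open>
  The points \<open>l / p ^ M\<close> correspond to the roots of unity of order \<open>p ^ (M + N)\<close>, where the Fourier transform of \<open>\<phi>\<close> is a
  multiple of the discrete one.
\<close>

lemma card_fourier_zeros: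
  fixes \<phi> :: "'p::prime_card padic \<Rightarrow> complex"
  assumes \<phi>: "step_fun M N \<phi>" and MN: "M + N \<ge> 0"
  shows "card {l :: int. 0 \<le> l \<and> real_of_int l < real CARD('p) powi (M + N) \<and>
        padic_fourier \<phi> (of_int l / of_nat CARD('p) powi M) = 0}
      + card (unity_support (CARD('p) ^ nat (M + N)) (\<lambda>k. \<phi> (grid N k))) = CARD('p) ^ nat (M + N)"
proof -
  define Q where "Q = CARD('p) ^ nat (M + N)"
  have Q: "Q > 0"
    using card_gt_1[where 'p='p] by (simp add: Q_def)
  define root where "root l = cis (2 * pi * real l / real Q)" for l
  have bij: "bij_betw root {..<Q} {z. z ^ Q = 1}"
    unfolding root_def by (rule Complex.bij_betw_roots_unity[OF Q])
  define u where "u k = \<phi> (grid N k)" for k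
  have zero_iff: "padic_fourier \<phi> (of_int (int l) / of_nat CARD('p) powi M) = 0 \<longleftrightarrow> unity_sum Q u (root l) = 0" for l
  proof -
    have "of_int (int l) / of_nat CARD('p) powi M = (of_nat l * ppow (- M) :: 'p padic)"
      by (simp add: ppow_minus divide_inverse) (simp add: ppow_def)
    moreover have "real CARD('p) powi (- M) \<noteq> 0"
      using card_powi_pos[of "- M", where 'p='p] by linarith
    ultimately show ?thesis
      using padic_fourier_step_fun[OF \<phi> MN, of l] by (simp add: unity_sum_def root_def u_def Q_def)
  qed
  have real_Q: "real CARD('p) powi (M + N) = real Q"
    unfolding Q_def by (rule card_powi_nat[OF MN])
  let ?Z = "{l :: int. 0 \<le> l \<and> real_of_int l < real CARD('p) powi (M + N) \<and>
      padic_fourier \<phi> (of_int l / of_nat CARD('p) powi M) = 0}"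
  let ?A = "{l. l < Q \<and> unity_sum Q u (root l) = 0}" and ?B = "{l. l < Q \<and> unity_sum Q u (root l) \<noteq> 0}"
  have "?Z = int ` ?A"
  proof (intro equalityI subsetI)
    fix l :: int
    assume l: "l \<in> ?Z"
    then obtain k where k: "l = int k"
      using nonneg_int_cases by blast
    then show "l \<in> int ` ?A"
      using l zero_iff[of k] unfolding real_Q by auto
  next
    fix l assume "l \<in> int ` ?A"
    then obtain k where "l = int k" "k < Q" "unity_sum Q u (root k) = 0"
      by blast
    then show "l \<in> ?Z"
      using zero_iff[of k] unfolding real_Q by simp
  qed
  then have 1: "card ?Z = card ?A"
    by (simp add: card_image)
  have "root ` ?B = unity_support Q u"
    using bij_betw_imp_surj_on[OF bij] unfolding unity_support_def by auto
  moreover have "inj_on root ?B"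
    using bij_betw_imp_inj_on[OF bij] by (rule inj_on_subset) auto
  ultimately have 2: "card (unity_support Q u) = card ?B"
    by (metis card_image)
  have "card ?A + card ?B =
      card (?A \<union> ?B)"
    by (intro card_Un_disjoint[symmetric]) auto
  also have "?A \<union> ?B = {..<Q}"
    by auto
  finally show ?thesis
    using 1 2 by (simp add: Q_def u_def[abs_def])
qed

theorem theorem3p9:
  fixes \<phi> :: "'p::prime_card padic \<Rightarrow> complex" and M N :: int
  assumes "N \<ge> 0"
    and "\<phi> \<in> test_functions_within M N"
    and "padic_fourier \<phi> 0 \<noteq> 0"
  shows "generates_MRA \<phi> \<longleftrightarrow>
    refinable \<phi> \<and>
    real (card {l :: int. 0 \<le> l \<and> real_of_int l < real CARD('p) powi (M + N) \<and>
        padic_fourier \<phi> (of_int l / of_nat CARD('p) powi M) = 0})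
      \<ge> real CARD('p) powi (M + N) - real CARD('p) powi N"
proof -
  obtain n where n: "N = int n"
    using assms(1) nonneg_int_cases by blast
  have \<phi>: "step_fun M (int n) \<phi>"
    using step_fun_test_functions_within[OF assms(2)] n by simp
  have nz: "\<phi> \<noteq> (\<lambda>_. 0)"
    using assms(3) by (auto simp: padic_fourier_def)
  then obtain x where "\<phi> x \<noteq> 0"
    by (auto simp: fun_eq_iff)
  with \<phi> have Mn: "M + int n \<ge> 0"
    by (rule step_fun_nonneg_order)
  have mean: "(\<Sum>k<CARD('p) ^ nat (M + int n). \<phi> (grid (int n) (int k))) \<noteq> 0"
    using assms(3) padic_fourier_step_fun[OF \<phi> Mn, of 0] by auto
  define z where "z = card {l :: int. 0 \<le> l \<and> real_of_int l < real CARD('p) powi (M + N) \<and>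
        padic_fourier \<phi> (of_int l / of_nat CARD('p) powi M) = 0}"
  define s where "s = card (unity_support (CARD('p) ^ nat (M + int n)) (\<lambda>k. \<phi> (grid (int n) k)))"
  have "z + s = CARD('p) ^ nat (M + int n)"
    using card_fourier_zeros[OF \<phi> Mn] by (simp add: z_def s_def n)
  then have "real z + real s = real CARD('p) powi (M + N)"
    using card_powi_nat[OF Mn, where 'p='p] by (simp add: n flip: of_nat_add)
  moreover have "real CARD('p) powi N = real (CARD('p) ^ n)"
    by (simp add: n)
  ultimately have "real z \<ge> real CARD('p) powi (M + N) - real CARD('p) powi N \<longleftrightarrow> real s \<le> real (CARD('p) ^ n)"
    by linarith
  also have "\<dots> \<longleftrightarrow> s \<le> CARD('p) ^ n"
    by (rule of_nat_le_iff)
  finally have iff: "real z \<ge> real CARD('p) powi (M + N) - real CARD('p) powi N \<longleftrightarrow> s \<le> CARD('p) ^ n" .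
  show ?thesis
    unfolding z_def[symmetric] iff unfolding s_def
    using generates_MRA_necessary[OF \<phi> Mn nz] generates_MRA_sufficient[OF \<phi> Mn _ mean] by blast
qed

end
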